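(* Let $\mu>0$. There exist constants $\varepsilon_0>0$ and $K>0$, depending only on $\mu$, such that for every $v_0\in X^{-1}$ with $\|v_0\|_{X^{-1}}<\varepsilon_0$ there exists one and only one mild solution $v\in\mathcal{Y}$ of the incompressible Navier-Stokes equations on $\mathbb{T}^3$ with viscosity $\mu$ and initial data $v_0$ satisfying $$|||v|||\le K\,\|v_0\|_{X^{-1}}.$$ Furthermore, the solution $v$ depends continuously on the initial data $v_0$, i.e. the map $v_0\mapsto v$ is continuous from $\{v_0\in X^{-1}:\|v_0\|_{X^{-1}}<\varepsilon_0\}$ (with the norm $\|\cdot\|_{X^{-1}}$) to $\mathcal{Y}$ (with the norm $|||\cdot|||$).
   Context: $\mathbb{T}^3$ is the cube $[0,2\pi]^3$ with periodic boundary conditions; $\hat f(k)=\frac{1}{(2\pi)^3}\int_{\mathbb{T}^3}f(x)e^{-ik\cdot x}\,dx$, $k\in\mathbb{Z}^3$, are Fourier coefficients, so $f(x)=\sum_{k\in\mathbb{Z}^3}\hat f(k)e^{ik\cdot x}$ (extended to distributions as usual). For $f$ depending also on time, $\hat f(t,k)$ is the Fourier coefficient in $x$ at time $t$. $|k|$ is the Euclidean norm and $\mathbb{Z}^3_*=\mathbb{Z}^3\setminus\{(0,0,0)\}$. Function spaces (used for scalar fields and, componentwise, for vector fields with values in three dimensions): $X^{-1}=\{f\in\mathcal{D}'(\mathbb{T}^3): \hat f(0)=0,\ \|f\|_{X^{-1}}=\sum_{k\in\mathbb{Z}^3_*}\frac{|\hat f(k)|}{|k|}<\infty\}$. $\mathcal{X}^{-1}=\{f\in\mathcal{D}'(\mathbb{R}_+\times\mathbb{T}^3):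 \hat f(\cdot,0)=0 \text{ in } \mathcal{D}'(\mathbb{R}_+),\ \|f\|_{\mathcal{X}^{-1}}=\sum_{k\in\mathbb{Z}^3_*}\sup_{t\ge 0}\frac{|\hat f(t,k)|}{|k|}<\infty\}$. $\mathcal{X}^{1}=\{f\in\mathcal{D}'(\mathbb{R}_+\times\mathbb{T}^3): \|f\|_{\mathcal{X}^{1}}=\sum_{k\in\mathbb{Z}^3_*}\int_0^\infty |k||\hat f(t,k)|\,dt<\infty\}$. $\mathcal{Y}=\mathcal{X}^{-1}\cap\mathcal{X}^{1}$, a Banach space with norm $|||u|||=\|u\|_{\mathcal{X}^{-1}}+\|u\|_{\mathcal{X}^{1}}$. The incompressible Navier-Stokes equations are $\partial_t v+(v\cdot\nabla)v=-\nabla p+\mu\Delta v$ in $(0,\infty)\times\mathbb{T}^3$, $\mathrm{div}\,v=0$ in $[0,\infty)\times\mathbb{T}^3$, $v(0,\cdot)=v_0$. The Leray projector is $\mathbb{P}=\mathbb{I}-\nabla\Delta^{-1}\mathrm{div}$, and $e^{\mu t\Delta}$ is the heat semigroup, with Fourier multiplier $e^{-\mu t|k|^2}$; $\mathrm{div}(v\otimes v)$ is the vector field with $i$-th component $\sum_j\partial_j(v_iv_j)$. Mild solution: given $v_0\in X^{-1}$, $v\in\mathcal{Y}$ is a mild solution with initial data $v_0$ if $$v(t,\cdot)=e^{\mu t\Delta}[v_0]-\int_0^t e^{\mu(t-s)\Delta}\left[\mathbb{P}\,\mathrm{div}(v\otimes v)(s,\cdot)\right]ds .$$ *)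

theory Defs
  imports
    "HOL-Analysis.Analysis"
    "HOL-Library.Function_Algebras"
    "HOL-Probability.Essential_Supremum"
begin

section \<open>Test functions and distributions\<close>

text \<open>Functions on the torus are functions on \<open>real^3\<close> that are \<open>2\<pi>\<close>-periodic in every coordinate;
  functions on \<open>(0,\<infinity>) \<times> torus\<close> are functions on \<open>real \<times> real^3\<close> (time first). Distributions are
  complex valued. The half-line is the open one as regards test functions: these have compact
  support in \<open>(0,\<infinity>)\<close> with respect to time.\<close>

primrec iter_deriv ::
  "'a::euclidean_space list \<Rightarrow> ('a \<Rightarrow> complex) \<Rightarrow> 'a \<Rightarrow> complex" where
  "iter_deriv [] f = f"
| "iter_deriv (b # bs) f = (\<lambda>x. frechet_derivative (iter_deriv bs f) (at x) b)"

definition smooth :: "('a::euclidean_space \<Rightarrow> complex) \<Rightarrow> bool" where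
  "smooth f \<longleftrightarrow> (\<forall>bs. set bs \<subseteq> Basis \<longrightarrow> iter_deriv bs f differentiable_on UNIV)"

text \<open>The \<open>C\<^sup>N\<close> norm; the suprema are finite for the test functions below.\<close>

definition CN_norm :: "nat \<Rightarrow> ('a::euclidean_space \<Rightarrow> complex) \<Rightarrow> real" where
  "CN_norm N f =
     (SUP (bs, x) \<in> {bs. set bs \<subseteq> Basis \<and> length bs \<le> N} \<times> UNIV. norm (iter_deriv bs f x))"

definition ivec :: "int^3 \<Rightarrow> real^3" where
  "ivec k = (\<chi> i. real_of_int (k $ i))"

definition test_torus :: "(real^3 \<Rightarrow> complex) set" where
  "test_torus = {\<phi>. smooth \<phi> \<and> (\<forall>k x. \<phi> (x + (2 * pi) *\<^sub>R ivec k) = \<phi> x)}"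

definition test_time :: "(real \<Rightarrow> complex) set" where
  "test_time = {\<psi>. smooth \<psi> \<and> (\<exists>a b. 0 < a \<and> (\<forall>t. t \<notin> {a..b} \<longrightarrow> \<psi> t = 0))}"

definition test_spacetime_in :: "real \<Rightarrow> real \<Rightarrow> (real \<times> (real^3) \<Rightarrow> complex) set" where
  "test_spacetime_in a b = {\<phi>. smooth \<phi> \<and>
     (\<forall>t k x. \<phi> (t, x + (2 * pi) *\<^sub>R ivec k) = \<phi> (t, x)) \<and>
     (\<forall>t x. t \<notin> {a..b} \<longrightarrow> \<phi> (t, x) = 0)}"

definition test_spacetime :: "(real \<times> (real^3) \<Rightarrow> complex) set" where
  "test_spacetime = (\<Union>a\<in>{0<..}. \<Union>b. test_spacetime_in a b)"

type_synonym 'a functional = "('a \<Rightarrow> complex) \<Rightarrow> complex"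

text \<open>As HOL functions are total, functionals on a space \<open>D\<close> of test functions are normalised to
  vanish outside \<open>D\<close>, so that equality in HOL is equality of functionals on \<open>D\<close>.\<close>

definition linear_functional_on :: "('a \<Rightarrow> complex) set \<Rightarrow> 'a functional \<Rightarrow> bool" where
  "linear_functional_on D u \<longleftrightarrow>
     (\<forall>\<phi>\<in>D. \<forall>\<psi>\<in>D. u (\<lambda>x. \<phi> x + \<psi> x) = u \<phi> + u \<psi>) \<and>
     (\<forall>c. \<forall>\<phi>\<in>D. u (\<lambda>x. c * \<phi> x) = c * u \<phi>) \<and>
     (\<forall>\<phi>. \<phi> \<notin> D \<longrightarrow> u \<phi> = 0)"

text \<open>Continuity is expressed by the usual seminorm estimates.\<close>

definition distr_torus :: "(real^3) functional set" where
  "distr_torus = {u. linear_functional_on test_torus u \<and>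
     (\<exists>C N. \<forall>\<phi>\<in>test_torus. norm (u \<phi>) \<le> C * CN_norm N \<phi>)}"

definition distr_spacetime :: "(real \<times> (real^3)) functional set" where
  "distr_spacetime = {f. linear_functional_on test_spacetime f \<and>
     (\<forall>a>0. \<forall>b. \<exists>C N. \<forall>\<phi>\<in>test_spacetime_in a b. norm (f \<phi>) \<le> C * CN_norm N \<phi>)}"


section \<open>Fourier coefficients\<close>

definition wave :: "int^3 \<Rightarrow> real^3 \<Rightarrow> complex" where
  "wave k x = cis (ivec k \<bullet> x)"

definition cube :: "(real^3) set" where
  "cube = cbox 0 (\<chi> i. 2 * pi)"

definition fourier_coeff :: "(real^3) functional \<Rightarrow> int^3 \<Rightarrow> complex" where
  "fourier_coeff u k = u (wave (- k)) / (2 * pi) ^ 3"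

text \<open>For \<open>f\<close> on space-time the \<open>k\<close>-th coefficient is a distribution in time. If it is a
  locally integrable function, \<open>time_coeff f k\<close> is a representative of it, determined up to
  equality almost everywhere.\<close>

definition time_coeff_distr :: "(real \<times> (real^3)) functional \<Rightarrow> int^3 \<Rightarrow> real functional" where
  "time_coeff_distr f k \<psi> = f (\<lambda>(t, x). \<psi> t * wave (- k) x) / (2 * pi) ^ 3"

definition represents :: "(real \<Rightarrow> complex) \<Rightarrow> real functional \<Rightarrow> bool" where
  "represents g T \<longleftrightarrow> g \<in> borel_measurable lborel \<and>
     (\<forall>a>0. \<forall>b. set_integrable lborel {a..b} g) \<and>
     (\<forall>\<psi>\<in>test_time. T \<psi> = (LINT t:{0<..}|lborel. g t * \<psi> t))"

definition time_coeff :: "(real \<times> (real^3)) functional \<Rightarrow> int^3 \<Rightarrow> real \<Rightarrow> complex" where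
  "time_coeff f k = (SOME g. represents g (time_coeff_distr f k))"


section \<open>The function spaces\<close>

text \<open>All spaces consist of vector fields; moduli of vectors are Euclidean norms. The norms take
  values in \<open>[0,\<infinity>]\<close>. As elements of the space-time spaces are distributions, the supremum over
  \<open>t \<ge> 0\<close> is the essential one.\<close>

definition norm_Xm1 :: "(real^3) functional^3 \<Rightarrow> ennreal" where
  "norm_Xm1 u = (\<Sum>\<^sub>\<infinity>k\<in>UNIV - {0}. 
     ennreal (norm (\<chi> i. fourier_coeff (u $ i) k) / norm (ivec k)))"

definition Xm1 :: "((real^3) functional^3) set" where
  "Xm1 = {u. (\<forall>i. u $ i \<in> distr_torus \<and> fourier_coeff (u $ i) 0 = 0) \<and> norm_Xm1 u < \<infinity>}"

definition regular_coeffs :: "(real \<times> (real^3)) functional^3 \<Rightarrow> bool" where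
  "regular_coeffs v \<longleftrightarrow> (\<forall>i. \<forall>k. k \<noteq> 0 \<longrightarrow> (\<exists>g. represents g (time_coeff_distr (v $ i) k)))"

definition norm_calXm1 :: "(real \<times> (real^3)) functional^3 \<Rightarrow> ennreal" where
  "norm_calXm1 v = (\<Sum>\<^sub>\<infinity>k\<in>UNIV - {0}. esssup (restrict_space lborel {0..})
     (\<lambda>t. ennreal (norm (\<chi> i. time_coeff (v $ i) k t) / norm (ivec k))))"

definition calXm1 :: "((real \<times> (real^3)) functional^3) set" where
  "calXm1 = {v. (\<forall>i. v $ i \<in> distr_spacetime) \<and>
     (\<forall>i. \<forall>\<psi>\<in>test_time. time_coeff_distr (v $ i) 0 \<psi> = 0) \<and>
     regular_coeffs v \<and> norm_calXm1 v < \<infinity>}"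

definition norm_calX1 :: "(real \<times> (real^3)) functional^3 \<Rightarrow> ennreal" where
  "norm_calX1 v = (\<Sum>\<^sub>\<infinity>k\<in>UNIV - {0}.
     \<integral>\<^sup>+t\<in>{0..}. ennreal (norm (ivec k) * norm (\<chi> i. time_coeff (v $ i) k t)) \<partial>lborel)"

definition calX1 :: "((real \<times> (real^3)) functional^3) set" where
  "calX1 = {v. (\<forall>i. v $ i \<in> distr_spacetime) \<and> regular_coeffs v \<and> norm_calX1 v < \<infinity>}"

definition calY :: "((real \<times> (real^3)) functional^3) set" where
  "calY = calXm1 \<inter> calX1"

definition norm_Y :: "(real \<times> (real^3)) functional^3 \<Rightarrow> ennreal" where
  "norm_Y v = norm_calXm1 v + norm_calX1 v"


section \<open>Operators on distributions on the torus\<close>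

text \<open>The results of these operators are only meaningful on \<open>test_torus\<close>.\<close>

text \<open>The distribution \<open>\<Sum>k. c k * wave k\<close>.\<close>

definition fourier_distr :: "(int^3 \<Rightarrow> complex) \<Rightarrow> (real^3) functional" where
  "fourier_distr c \<phi> = (\<Sum>\<^sub>\<infinity>k. c k * (LINT x:cube|lborel. wave k x * \<phi> x))"

definition fourier_multiplier :: "(int^3 \<Rightarrow> real) \<Rightarrow> (real^3) functional \<Rightarrow> (real^3) functional" where
  "fourier_multiplier m u = fourier_distr (\<lambda>k. of_real (m k) * fourier_coeff u k)"

definition heat :: "real \<Rightarrow> real \<Rightarrow> (real^3) functional \<Rightarrow> (real^3) functional" where
  "heat \<mu> t = fourier_multiplier (\<lambda>k. exp (- \<mu> * t * (norm (ivec k))\<^sup>2))"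

definition inv_laplacian :: "(real^3) functional \<Rightarrow> (real^3) functional" where
  "inv_laplacian = fourier_multiplier (\<lambda>k. if k = 0 then 0 else - 1 / (norm (ivec k))\<^sup>2)"

definition distr_deriv :: "3 \<Rightarrow> (real^3) functional \<Rightarrow> (real^3) functional" where
  "distr_deriv j u \<phi> = - u (\<lambda>x. frechet_derivative \<phi> (at x) (axis j 1))"

definition leray :: "(real^3) functional^3 \<Rightarrow> (real^3) functional^3" where
  "leray w = (\<chi> i. w $ i - distr_deriv i (inv_laplacian (\<Sum>j\<in>UNIV. distr_deriv j (w $ j))))"

text \<open>The product of two distributions that are given by absolutely convergent Fourier series,
  hence by continuous functions. For \<open>v\<close> in \<open>calY\<close> this applies to the components of \<open>v(t,\<cdot>)\<close>,
  for almost every \<open>t\<close>.\<close>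

definition fourier_series :: "(real^3) functional \<Rightarrow> real^3 \<Rightarrow> complex" where
  "fourier_series u x = (\<Sum>\<^sub>\<infinity>k. fourier_coeff u k * wave k x)"

definition distr_mult :: "(real^3) functional \<Rightarrow> (real^3) functional \<Rightarrow> (real^3) functional" where
  "distr_mult u w \<phi> = (LINT x:cube|lborel. fourier_series u x * fourier_series w x * \<phi> x)"

definition div_tensor_square :: "(real^3) functional^3 \<Rightarrow> (real^3) functional^3" where
  "div_tensor_square v = (\<chi> i. \<Sum>j\<in>UNIV. distr_deriv j (distr_mult (v $ i) (v $ j)))"


section \<open>Mild solutions\<close>

text \<open>\<open>at_time v t\<close> is \<open>v(t,\<cdot>)\<close>, for almost every \<open>t\<close>.\<close>

definition at_time :: "(real \<times> (real^3)) functional^3 \<Rightarrow> real \<Rightarrow> (real^3) functional^3" where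
  "at_time v t = (\<chi> i. fourier_distr (\<lambda>k. time_coeff (v $ i) k t))"

text \<open>The integral of a time-dependent distribution is the weak one: it is taken after pairing
  with a test function.\<close>

definition mild_solution ::
  "real \<Rightarrow> (real^3) functional^3 \<Rightarrow> (real \<times> (real^3)) functional^3 \<Rightarrow> bool" where
  "mild_solution \<mu> v0 v \<longleftrightarrow> v \<in> calY \<and>
     (AE t in lebesgue. 0 < t \<longrightarrow> (\<forall>i. \<forall>\<phi>\<in>test_torus.
        (at_time v t $ i) \<phi> = heat \<mu> t (v0 $ i) \<phi> -
          (LINT s:{0..t}|lebesgue.
             heat \<mu> (t - s) (leray (div_tensor_square (at_time v s)) $ i) \<phi>)))"

end

theory Submission
  imports Defs
begin

text \<open>Since \<open>X\<^sup>-\<^sup>1\<close> and \<open>\<Y>\<close> are weighted sequence spaces, the theorem is proved for sequences of Fourier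
coefficients. In these variables the mild formulation is a fixed-point equation \<open>a = \<Phi>(c, a)\<close>, where
\<open>c\<close> are the coefficients of the initial datum and \<open>\<Phi>\<close> is the heat evolution of \<open>c\<close> minus the Duhamel
integral of a quadratic term, a convolution to which one derivative is applied.

The estimate that makes \<open>\<Phi>\<close> a contraction on a small ball has two parts. The time integral of the
heat factor is \<open>1 / (\<mu> |k|\<^sup>2)\<close>, so a right-hand side \<open>|k| h\<^sub>k(s)\<close> produces a function whose norm in \<open>\<Y>\<close>
is at most \<open>1 + 1/\<mu>\<close> times the sum over \<open>k\<close> of the integrals of \<open>h\<^sub>k\<close> (\<open>duhamel_estimate\<close>). For a
convolution of \<open>a\<close> and \<open>b\<close> this sum is the time integral of \<open>(\<Sum>|a\<^sub>k|) (\<Sum>|b\<^sub>l|)\<close>, and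
\<open>1 \<le> |k|/|l| + |l|/|k|\<close> bounds each product \<open>|a\<^sub>k| |b\<^sub>l|\<close> by terms that carry the weight \<open>|k|\<close> on one
factor and \<open>1/|l|\<close> on the other: the first is integrated in time, the second is bounded uniformly in
time (\<open>pair_estimate\<close>). Hence \<open>\<Phi>\<close> is Lipschitz (\<open>Phi_diff\<close>), with a constant that is small on small
balls. Picard iteration gives existence, and subtracting the equations of two solutions gives
uniqueness and Lipschitz dependence on the datum (\<open>stability\<close>).

The other half of the proof links coefficients to distributions. A coefficient in time is only
determined almost everywhere, by a du Bois-Reymond lemma (\<open>represents_unique\<close>). A space-time
distribution is determined by its coefficients, because every test function is approximated, with
all derivatives up to a given order, by its convolutions in space with trigonometric kernels, which
are finite sums of products of a function of time and a plane wave (\<open>distr_spacetime_eqI\<close>).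
Conversely, coefficients of finite norm define a distribution (\<open>realize_coeffs\<close>). Finally, the
coefficients of a mild solution satisfy the fixed-point equation for almost every time
(\<open>mild_imp_solves\<close>), and this equation implies the mild formulation (\<open>solves_imp_mild\<close>). For the
latter, sums over \<open>k\<close> and integrals over \<open>s\<close> have to be exchanged after pairing with an arbitrary
test function. The Duhamel terms, even with absolute values inside the integral, have finite norm in
\<open>\<Y>\<close> and are therefore summable over \<open>k\<close> for almost every time; together with the boundedness of the
Fourier coefficients of the test function this justifies the exchange.\<close>

section \<open>Smooth functions and plane waves\<close>

lemma iter_deriv_append: "iter_deriv (bs @ cs) f = iter_deriv bs (iter_deriv cs f)"
  by (induction bs) auto

text \<open>Closed formulas for all iterated derivatives are rarely needed: it is enough to place the function
in a class that is closed under partial derivatives.\<close>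

lemma smooth_coinduct:
  assumes "P f"
    and step: "\<And>g. P g \<Longrightarrow> g differentiable_on UNIV \<and>
      (\<forall>b\<in>Basis. P (\<lambda>x. frechet_derivative g (at x) b))"
  shows "smooth f"
proof -
  have "P (iter_deriv bs f)" if "set bs \<subseteq> Basis" for bs
    using that by (induction bs) (use assms in auto)
  then show ?thesis
    unfolding smooth_def using step by blast
qed

lemma smooth_differentiable: "smooth f \<Longrightarrow> f differentiable (at x)"
  unfolding smooth_def by (drule spec[of _ "[]"]) (simp add: differentiable_on_def)

lemma smooth_differentiable_on: "smooth f \<Longrightarrow> f differentiable_on UNIV"
  by (simp add: differentiable_on_def smooth_differentiable)

lemma smooth_iter_deriv: "smooth f \<Longrightarrow> set bs \<subseteq> Basis \<Longrightarrow> smooth (iter_deriv bs f)"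
  unfolding smooth_def by (auto simp flip: iter_deriv_append)

lemma smooth_frechet_derivative:
  "smooth f \<Longrightarrow> b \<in> Basis \<Longrightarrow> smooth (\<lambda>x. frechet_derivative f (at x) b)"
  using smooth_iter_deriv[of f "[b]"] by simp

lemma smooth_continuous_on: "smooth f \<Longrightarrow> continuous_on A f"
  by (meson continuous_on_subset differentiable_imp_continuous_on smooth_differentiable_on subset_UNIV)

lemma frechet_derivative_eqI: "(f has_derivative D) (at x) \<Longrightarrow> frechet_derivative f (at x) b = D b"
  by (metis frechet_derivative_at)

lemma smooth_has_derivative: "smooth f \<Longrightarrow> (f has_derivative frechet_derivative f (at x)) (at x)"
  using smooth_differentiable frechet_derivative_works by blast

lemma smooth_const [simp]: "smooth (\<lambda>x. c)"
proof (rule smooth_coinduct[where P="\<lambda>f. \<exists>c. f = (\<lambda>x. c)"])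
  fix g :: "'a \<Rightarrow> complex" assume "\<exists>c. g = (\<lambda>x. c)"
  then obtain c where g: "g = (\<lambda>x. c)" by blast
  then have "frechet_derivative g (at x) b = 0" for x b
    using frechet_derivative_eqI[of g "\<lambda>_. 0" x b] by simp
  then show "g differentiable_on UNIV \<and> (\<forall>b\<in>Basis. \<exists>c. (\<lambda>x. frechet_derivative g (at x) b) = (\<lambda>x. c))"
    using g by auto
qed blast

lemma smooth_add:
  assumes "smooth f" "smooth g" shows "smooth (\<lambda>x. f x + g x)"
proof (rule smooth_coinduct[where P="\<lambda>h. \<exists>f g. smooth f \<and> smooth g \<and> h = (\<lambda>x. f x + g x)"])
  fix h :: "'a \<Rightarrow> complex" assume "\<exists>f g. smooth f \<and> smooth g \<and> h = (\<lambda>x. f x + g x)"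
  then obtain f g where h: "smooth f" "smooth g" "h = (\<lambda>x. f x + g x)" by blast
  have "(h has_derivative (\<lambda>b. frechet_derivative f (at x) b + frechet_derivative g (at x) b)) (at x)" for x
    unfolding h(3) by (intro has_derivative_add smooth_has_derivative h)
  then have e: "(\<lambda>x. frechet_derivative h (at x) b) = (\<lambda>x. frechet_derivative f (at x) b + frechet_derivative g (at x) b)" for b
    by (intro ext frechet_derivative_eqI)
  show "h differentiable_on UNIV \<and> (\<forall>b\<in>Basis. \<exists>f g. smooth f \<and> smooth g \<and> (\<lambda>x. frechet_derivative h (at x) b) = (\<lambda>x. f x + g x))"
  proof (intro conjI ballI)
    show "h differentiable_on UNIV"
      unfolding h(3) by (intro differentiable_on_add smooth_differentiable_on h)
    show "\<exists>f g. smooth f \<and> smooth g \<and> (\<lambda>x. frechet_derivative h (at x) b) = (\<lambda>x. f x + g x)"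
      if "b \<in> Basis" for b
      using e that h(1,2) smooth_frechet_derivative by blast
  qed
qed (use assms in blast)

text \<open>The derivative of a product is a sum of two products, so coinduction for products needs a class that
contains sums of products as well.\<close>

inductive prod_span :: "('a::euclidean_space \<Rightarrow> complex) \<Rightarrow> bool" where
  prod: "smooth f \<Longrightarrow> smooth g \<Longrightarrow> prod_span (\<lambda>x. f x * g x)"
| add: "prod_span f \<Longrightarrow> prod_span g \<Longrightarrow> prod_span (\<lambda>x. f x + g x)"

lemma smooth_mult:
  assumes "smooth f" "smooth g" shows "smooth (\<lambda>x. f x * g x)"
proof (rule smooth_coinduct[where P=prod_span])
  show "prod_span (\<lambda>x. f x * g x)" using assms by (rule prod_span.prod)
next
  fix h :: "'a \<Rightarrow> complex" assume "prod_span h"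
  then have "(\<forall>x. h differentiable (at x)) \<and> (\<forall>b\<in>Basis. prod_span (\<lambda>x. frechet_derivative h (at x) b))"
  proof induction
    case (prod f g)
    have d: "((\<lambda>x. f x * g x) has_derivative (\<lambda>b. f x * frechet_derivative g (at x) b + frechet_derivative f (at x) b * g x)) (at x)" for x
      by (intro has_derivative_mult smooth_has_derivative prod)
    then have "frechet_derivative (\<lambda>x. f x * g x) (at x) b = f x * frechet_derivative g (at x) b + frechet_derivative f (at x) b * g x" for x b
      by (rule frechet_derivative_eqI)
    then show ?case
      using prod smooth_frechet_derivative differentiableI[OF d]
      by (auto intro!: prod_span.intros)
  next
    case (add f g)
    have d: "((\<lambda>x. f x + g x) has_derivative (\<lambda>b. frechet_derivative f (at x) b + frechet_derivative g (at x) b)) (at x)" for x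
      using add by (intro has_derivative_add) (auto simp flip: frechet_derivative_works)
    then have "frechet_derivative (\<lambda>x. f x + g x) (at x) b = frechet_derivative f (at x) b + frechet_derivative g (at x) b" for x b
      by (rule frechet_derivative_eqI)
    then show ?case
      using add differentiableI[OF d] by (auto intro!: prod_span.intros)
  qed
  then show "h differentiable_on UNIV \<and> (\<forall>b\<in>Basis. prod_span (\<lambda>x. frechet_derivative h (at x) b))"
    by (auto simp: differentiable_on_def)
qed

lemma smooth_cmult: "smooth f \<Longrightarrow> smooth (\<lambda>x. c * f x)"
  by (intro smooth_mult smooth_const)

lemma smooth_diff: "smooth f \<Longrightarrow> smooth g \<Longrightarrow> smooth (\<lambda>x. f x - g x)"
  using smooth_add[of f "\<lambda>x. (-1) * g x"] smooth_cmult[of g "-1"] by simp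

lemma frechet_derivative_affine:
  fixes f :: "'b::euclidean_space \<Rightarrow> complex" and L :: "'a::euclidean_space \<Rightarrow> 'b" and w :: 'b
  assumes "f differentiable (at (L x + w))" "bounded_linear L"
  shows "((\<lambda>x. f (L x + w)) has_derivative (\<lambda>b. frechet_derivative f (at (L x + w)) (L b))) (at x)"
proof -
  have "((\<lambda>x. L x + w) has_derivative L) (at x)"
    using has_derivative_add[OF bounded_linear_imp_has_derivative[OF assms(2)] has_derivative_const] by simp
  moreover have "(f has_derivative frechet_derivative f (at (L x + w))) (at (L x + w))"
    using assms(1) frechet_derivative_works by blast
  ultimately show ?thesis
    using has_derivative_compose by fastforce
qed

lemma frechet_derivative_basis_scaled:
  assumes "f differentiable (at z)"
  shows "frechet_derivative f (at z) (c *\<^sub>R b) = of_real c * (frechet_derivative f (at z) b :: complex)"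
  using linear_frechet_derivative[OF assms]
  by (simp add: linear_cmul scaleR_conv_of_real)

text \<open>The condition on \<open>L\<close> covers translations, dilations, the projections and the embeddings of the factors
of a product. It keeps each partial derivative of \<open>\<lambda>x. f (L x + w)\<close> a multiple of such a composition.\<close>

lemma smooth_affine:
  fixes f :: "'b::euclidean_space \<Rightarrow> complex" and L :: "'a::euclidean_space \<Rightarrow> 'b" and w :: 'b
  assumes f: "smooth f" and L: "bounded_linear L"
    and B: "\<And>b. b \<in> Basis \<Longrightarrow> \<exists>c. \<exists>b'\<in>Basis. L b = c *\<^sub>R b'"
  shows "smooth (\<lambda>x. f (L x + w))"
proof (rule smooth_coinduct[where P="\<lambda>h. \<exists>f. smooth f \<and> h = (\<lambda>x. f (L x + w))"])
  show "\<exists>g. smooth g \<and> (\<lambda>x. f (L x + w)) = (\<lambda>x. g (L x + w))" using f by blast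
next
  fix h :: "'a \<Rightarrow> complex" assume "\<exists>f. smooth f \<and> h = (\<lambda>x. f (L x + w))"
  then obtain f where f: "smooth f" and h: "h = (\<lambda>x. f (L x + w))" by blast
  note d = frechet_derivative_affine[OF smooth_differentiable[OF f] L, where w=w]
  have "\<exists>g. smooth g \<and> (\<lambda>x. frechet_derivative h (at x) b) = (\<lambda>x. g (L x + w))" if b: "b \<in> Basis" for b
  proof -
    obtain c b' where c: "b' \<in> Basis" "L b = c *\<^sub>R b'" using B[OF b] by blast
    have "frechet_derivative h (at x) b = of_real c * frechet_derivative f (at (L x + w)) b'" for x
      using frechet_derivative_eqI[OF d, of x b] frechet_derivative_basis_scaled[OF smooth_differentiable[OF f]]
      by (simp add: h c)
    then show ?thesis
      using smooth_cmult[OF smooth_frechet_derivative[OF f c(1)], of "of_real c"]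
      by (intro exI[of _ "\<lambda>z. of_real c * frechet_derivative f (at z) b'"]) auto
  qed
  then show "h differentiable_on UNIV \<and> (\<forall>b\<in>Basis. \<exists>f. smooth f \<and> (\<lambda>x. frechet_derivative h (at x) b) = (\<lambda>x. f (L x + w)))"
    using d by (auto simp: h differentiable_on_def differentiable_def)
qed

lemma smooth_fst:
  assumes "smooth f" shows "smooth (\<lambda>(x::'a::euclidean_space, y::'b::euclidean_space). f x)"
proof -
  have "smooth (\<lambda>z::'a\<times>'b. f (fst z + 0))"
  proof (intro smooth_affine assms bounded_linear_fst)
    fix b :: "'a \<times> 'b" assume "b \<in> Basis"
    then consider "fst b \<in> Basis" | "fst b = 0" by (auto simp: Basis_prod_def)
    then show "\<exists>c. \<exists>b'\<in>Basis. fst b = c *\<^sub>R b'"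
    proof cases
      case 1 then show ?thesis by (intro exI[of _ 1] bexI[of _ "fst b"]) auto
    next
      case 2 then show ?thesis using nonempty_Basis by (intro exI[of _ 0]) (auto simp: ex_in_conv)
    qed
  qed
  then show ?thesis by (simp add: case_prod_unfold)
qed

lemma smooth_snd:
  assumes "smooth f" shows "smooth (\<lambda>(x::'a::euclidean_space, y::'b::euclidean_space). f y)"
proof -
  have "smooth (\<lambda>z::'a\<times>'b. f (snd z + 0))"
  proof (intro smooth_affine assms bounded_linear_snd)
    fix b :: "'a \<times> 'b" assume "b \<in> Basis"
    then consider "snd b \<in> Basis" | "snd b = 0" by (auto simp: Basis_prod_def)
    then show "\<exists>c. \<exists>b'\<in>Basis. snd b = c *\<^sub>R b'"
    proof cases
      case 1 then show ?thesis by (intro exI[of _ 1] bexI[of _ "snd b"]) auto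
    next
      case 2 then show ?thesis using nonempty_Basis by (intro exI[of _ 0]) (auto simp: ex_in_conv)
    qed
  qed
  then show ?thesis by (simp add: case_prod_unfold)
qed

lemma smooth_Pair:
  assumes "smooth f" shows "smooth (\<lambda>x::'a::euclidean_space. f (x, y::'b::euclidean_space))"
proof -
  have "smooth (\<lambda>x. f ((x, 0) + (0, y)))"
  proof (intro smooth_affine assms)
    show "bounded_linear (\<lambda>x::'a. (x, 0::'b))"
      by (simp add: bounded_linear_Pair bounded_linear_ident bounded_linear_zero)
    show "\<exists>c. \<exists>b'\<in>Basis. (b, 0) = c *\<^sub>R (b'::'a\<times>'b)" if "b \<in> Basis" for b
      using that by (intro exI[of _ 1] bexI[of _ "(b, 0)"]) (auto simp: Basis_prod_def)
  qed
  then show ?thesis by simp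
qed

lemma has_derivative_wave:
  "(wave k has_derivative (\<lambda>h. \<i> * of_real (ivec k \<bullet> h) * wave k x)) (at x)"
proof -
  have "((\<lambda>x. cis (ivec k \<bullet> x)) has_derivative (\<lambda>h. (ivec k \<bullet> h) *\<^sub>R (\<i> * cis (ivec k \<bullet> x)))) (at x)"
    by (auto intro!: derivative_eq_intros)
  then show ?thesis
    by (simp add: wave_def[abs_def] scaleR_conv_of_real mult_ac)
qed

lemma smooth_wave: "smooth (wave k)"
proof (rule smooth_coinduct[where P="\<lambda>f. \<exists>c. f = (\<lambda>x. c * wave k x)"])
  show "\<exists>c. wave k = (\<lambda>x. c * wave k x)" by (auto intro: exI[of _ 1])
next
  fix g assume "\<exists>c. g = (\<lambda>x. c * wave k x)"
  then obtain c where g: "g = (\<lambda>x. c * wave k x)" by blast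
  have d: "(g has_derivative (\<lambda>h. c * (\<i> * of_real (ivec k \<bullet> h) * wave k x))) (at x)" for x
    unfolding g by (intro has_derivative_mult_right has_derivative_wave)
  then have "\<exists>c. (\<lambda>x. frechet_derivative g (at x) b) = (\<lambda>x. c * wave k x)" for b
    using frechet_derivative_eqI[OF d] by (auto simp: fun_eq_iff mult_ac intro!: exI[of _ "c * (\<i> * of_real (ivec k \<bullet> b))"])
  then show "g differentiable_on UNIV \<and> (\<forall>b\<in>Basis. \<exists>c. (\<lambda>x. frechet_derivative g (at x) b) = (\<lambda>x. c * wave k x))"
    using d by (auto simp: differentiable_on_def differentiable_def)
qed

lemma norm_wave [simp]: "norm (wave k x) = 1"
  by (simp add: wave_def)

lemma ivec_add [simp]: "ivec (k + l) = ivec k + ivec l"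
  by (simp add: ivec_def vec_eq_iff)
lemma ivec_minus [simp]: "ivec (- k) = - ivec k"
  by (simp add: ivec_def vec_eq_iff)
lemma ivec_0 [simp]: "ivec 0 = 0"
  by (simp add: ivec_def vec_eq_iff)
lemma ivec_eq_iff [simp]: "ivec k = ivec l \<longleftrightarrow> k = l"
  by (simp add: ivec_def vec_eq_iff)
lemma ivec_eq_0_iff [simp]: "ivec k = 0 \<longleftrightarrow> k = 0"
  using ivec_eq_iff[of k 0] by simp

lemma wave_add_freq: "wave (k + l) x = wave k x * wave l x"
  by (simp add: wave_def inner_add_left cis_mult)
lemma wave_add_point: "wave k (x + y) = wave k x * wave k y"
  by (simp add: wave_def inner_add_right cis_mult)
lemma wave_0 [simp]: "wave 0 x = 1" "wave k 0 = 1"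
  by (simp_all add: wave_def)

lemma inner_ivec: "ivec k \<bullet> ivec l = of_int (\<Sum>i\<in>UNIV. k $ i * l $ i)"
  by (simp add: inner_vec_def ivec_def)

lemma wave_lattice [simp]: "wave k ((2 * pi) *\<^sub>R ivec l) = 1"
proof -
  have "wave k ((2 * pi) *\<^sub>R ivec l) = cis (2 * pi * of_int (\<Sum>i\<in>UNIV. k $ i * l $ i))"
    by (simp only: wave_def inner_ivec inner_scaleR_right)
  also have "\<dots> = 1"
    by (rule cis_multiple_2pi) auto
  finally show ?thesis .
qed

lemma wave_periodic [simp]: "wave k (x + (2 * pi) *\<^sub>R ivec l) = wave k x"
  by (simp add: wave_add_point)

lemma wave_test_torus [simp]: "wave k \<in> test_torus"
  by (simp add: test_torus_def smooth_wave)

lemma continuous_on_wave [continuous_intros]: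
  "continuous_on A f \<Longrightarrow> continuous_on A (\<lambda>x. wave k (f x))"
  unfolding wave_def by (intro continuous_intros)

lemma borel_measurable_wave [measurable]: "wave k \<in> borel_measurable borel"
  by (intro borel_measurable_continuous_onI continuous_on_wave continuous_on_id)

section \<open>Sums over the lattice of frequencies\<close>

text \<open>The norms are sums in \<open>[0,\<infinity>]\<close>. As integrals over counting measure they obey Tonelli and monotone
convergence.\<close>

lemma infsum_ennreal_conv_nn_integral:
  fixes f :: "'a \<Rightarrow> ennreal"
  assumes "countable A"
  shows "infsum f A = (\<integral>\<^sup>+k. f k \<partial>count_space A)"
proof (rule antisym)
  have *: "infsum f A = (SUP F\<in>{F. finite F \<and> F\<subseteq>A}. sum f F)"
    by (rule nonneg_infsum_complete) simp
  have "sum f F \<le> (\<integral>\<^sup>+k. f k \<partial>count_space A)" if "finite F" "F \<subseteq> A" for F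
  proof -
    have "sum f F = (\<integral>\<^sup>+k. f k \<partial>count_space F)"
      by (simp add: nn_integral_count_space_finite that)
    also have "\<dots> = (\<integral>\<^sup>+k. f k * indicator F k \<partial>count_space A)"
      by (subst nn_integral_count_space_eq[of A F]) (use that in \<open>auto intro!: nn_integral_cong simp: indicator_def\<close>)
    also have "\<dots> \<le> (\<integral>\<^sup>+k. f k \<partial>count_space A)"
      by (intro nn_integral_mono) (auto simp: indicator_def)
    finally show ?thesis .
  qed
  then show "infsum f A \<le> (\<integral>\<^sup>+k. f k \<partial>count_space A)"
    unfolding * by (intro SUP_least) auto
  show "(\<integral>\<^sup>+k. f k \<partial>count_space A) \<le> infsum f A"
  proof (cases "finite A")
    case True then show ?thesis by (simp add: nn_integral_count_space_finite)
  next
    case False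
    have bij: "bij_betw (from_nat_into A) UNIV A"
      by (rule bij_betw_from_nat_into[OF assms False])
    have "(\<integral>\<^sup>+k. f k \<partial>count_space A) = (\<integral>\<^sup>+n. f (from_nat_into A n) \<partial>count_space UNIV)"
      by (rule nn_integral_bij_count_space[OF bij, symmetric])
    also have "\<dots> = (\<Sum>n. f (from_nat_into A n))"
      by (rule nn_integral_count_space_nat)
    also have "\<dots> = (SUP n. \<Sum>i<n. f (from_nat_into A i))"
      by (rule suminf_eq_SUP)
    also have "\<dots> \<le> infsum f A"
      unfolding *
    proof (rule SUP_least)
      fix n
      have "(\<Sum>i<n. f (from_nat_into A i)) = sum f (from_nat_into A ` {..<n})"
        using bij by (subst sum.reindex) (auto simp: bij_betw_def inj_on_def)
      then show "(\<Sum>i<n. f (from_nat_into A i)) \<le> (SUP F\<in>{F. finite F \<and> F\<subseteq>A}. sum f F)"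
        using bij by (intro SUP_upper2[of "from_nat_into A ` {..<n}"]) (auto simp: bij_betw_def)
    qed
    finally show ?thesis .
  qed
qed

abbreviation nsum :: "('k \<Rightarrow> ennreal) \<Rightarrow> ennreal" where
  "nsum f \<equiv> (\<integral>\<^sup>+k. f k \<partial>count_space UNIV)"

lemma summable_iff_nn_integral:
  fixes f :: "'a::countable \<Rightarrow> complex"
  shows "f summable_on UNIV \<longleftrightarrow> (nsum (\<lambda>k. ennreal (norm (f k)))) < \<infinity>"
proof -
  have "f summable_on UNIV \<longleftrightarrow> Infinite_Sum.abs_summable_on f UNIV"
    by (rule summable_on_iff_abs_summable_on_complex)
  also have "\<dots> \<longleftrightarrow> integrable (count_space UNIV) f"
    unfolding abs_summable_equivalent by (simp add: Infinite_Set_Sum.abs_summable_on_def)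
  also have "\<dots> \<longleftrightarrow> (nsum (\<lambda>k. ennreal (norm (f k)))) < \<infinity>"
    by (simp add: integrable_iff_bounded)
  finally show ?thesis .
qed

text \<open>Convergence of complex sums is absolute, and both sides are \<open>0\<close> in the absence of convergence. This
is how Fubini and measurability become available for sums.\<close>

lemma infsum_conv_integral:
  fixes f :: "'a::countable \<Rightarrow> complex"
  shows "infsum f UNIV = (\<integral>k. f k \<partial>count_space UNIV)"
proof (cases "integrable (count_space UNIV) f")
  case True
  then have "Infinite_Set_Sum.abs_summable_on f UNIV" by (simp add: abs_summable_on_def)
  then show ?thesis
    using infsetsum_infsum[of f UNIV] by (simp add: infsetsum_def)
next
  case False
  then have "\<not> f summable_on UNIV"
    by (simp add: summable_iff_nn_integral integrable_iff_bounded)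
  then show ?thesis
    using False by (simp add: infsum_not_exists not_integrable_integral_eq)
qed

lemma sigma_finite_count_space_countable:
  "sigma_finite_measure (count_space (UNIV :: 'a::countable set))"
  by (rule sigma_finite_measure_count_space_countable) simp

lemma measurable_count_space_pair [measurable (raw)]:
  fixes f :: "'k::countable \<Rightarrow> 'a \<Rightarrow> 'b::topological_space"
  assumes "\<And>k. f k \<in> borel_measurable M"
  shows "(\<lambda>(k, x). f k x) \<in> borel_measurable (count_space UNIV \<Otimes>\<^sub>M M)"
  using assms by (intro measurable_pair_measure_countable1) auto

lemma measurable_count_space_pair' [measurable (raw)]:
  fixes f :: "'k::countable \<Rightarrow> 'a \<Rightarrow> 'b::topological_space"
  assumes "\<And>k. f k \<in> borel_measurable M"
  shows "(\<lambda>(x, k). f k x) \<in> borel_measurable (M \<Otimes>\<^sub>M count_space UNIV)"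
  using measurable_pair_swap[OF measurable_count_space_pair[of f M, OF assms]] by simp

lemma borel_measurable_nn_sum:
  fixes f :: "'k::countable \<Rightarrow> 'a \<Rightarrow> ennreal"
  assumes [measurable]: "\<And>k. f k \<in> borel_measurable M"
  shows "(\<lambda>x. \<integral>\<^sup>+k. f k x \<partial>count_space UNIV) \<in> borel_measurable M"
proof -
  interpret C: sigma_finite_measure "count_space (UNIV::'k set)"
    by (rule sigma_finite_count_space_countable)
  have "(\<lambda>(x, k). f k x) \<in> borel_measurable (M \<Otimes>\<^sub>M count_space UNIV)"
    by (rule measurable_count_space_pair') measurable
  then show ?thesis by (rule C.borel_measurable_nn_integral)
qed

lemma borel_measurable_infsum:
  fixes f :: "'k::countable \<Rightarrow> 'a \<Rightarrow> complex"
  assumes [measurable]: "\<And>k. f k \<in> borel_measurable M"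
  shows "(\<lambda>x. \<Sum>\<^sub>\<infinity>k. f k x) \<in> borel_measurable M"
proof -
  interpret C: sigma_finite_measure "count_space (UNIV::'k set)"
    by (rule sigma_finite_count_space_countable)
  have "(\<lambda>(x, k). f k x) \<in> borel_measurable (M \<Otimes>\<^sub>M count_space UNIV)"
    by (rule measurable_count_space_pair') measurable
  then show ?thesis unfolding infsum_conv_integral by (rule C.borel_measurable_lebesgue_integral)
qed

lemma nn_sum_swap:
  fixes f :: "'k::countable \<Rightarrow> 'a \<Rightarrow> ennreal"
  assumes [measurable]: "\<And>k. f k \<in> borel_measurable M"
  shows "(\<integral>\<^sup>+x. (nsum (\<lambda>k. f k x)) \<partial>M) = (nsum (\<lambda>k. (\<integral>\<^sup>+x. f k x \<partial>M)))"
  by (rule nn_integral_count_space_nn_integral) auto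

lemma
  fixes f :: "'k::countable \<Rightarrow> 'a \<Rightarrow> complex"
  assumes M: "sigma_finite_measure M"
    and f: "\<And>k. f k \<in> borel_measurable M"
    and fin: "(nsum (\<lambda>k. (\<integral>\<^sup>+x. norm (f k x) \<partial>M))) < \<infinity>"
  shows integral_infsum: "(\<integral>x. (\<Sum>\<^sub>\<infinity>k. f k x) \<partial>M) = (\<Sum>\<^sub>\<infinity>k. \<integral>x. f k x \<partial>M)"
    and summable_integrals: "(\<lambda>k. \<integral>x. f k x \<partial>M) summable_on UNIV"
proof -
  note f[measurable]
  interpret sigma_finite_measure M by (rule M)
  interpret C: sigma_finite_measure "count_space (UNIV::'k set)"
    by (rule sigma_finite_count_space_countable)
  interpret P: pair_sigma_finite "count_space (UNIV::'k set)" M ..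
  have I: "integrable (count_space UNIV \<Otimes>\<^sub>M M) (\<lambda>(k, x). f k x)"
    unfolding integrable_iff_bounded
  proof
    have "(\<integral>\<^sup>+z. norm (case z of (k, x) \<Rightarrow> f k x) \<partial>(count_space UNIV \<Otimes>\<^sub>M M)) =
      (nsum (\<lambda>k. (\<integral>\<^sup>+x. norm (f k x) \<partial>M)))"
      by (subst nn_integral_fst[symmetric]) (auto simp: case_prod_unfold)
    then show "(\<integral>\<^sup>+z. norm (case z of (k, x) \<Rightarrow> f k x) \<partial>(count_space UNIV \<Otimes>\<^sub>M M)) < \<infinity>"
      using fin by simp
  qed measurable
  show "(\<integral>x. (\<Sum>\<^sub>\<infinity>k. f k x) \<partial>M) = (\<Sum>\<^sub>\<infinity>k. \<integral>x. f k x \<partial>M)"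
    unfolding infsum_conv_integral using P.Fubini_integral[OF I] by simp
  have "integrable (count_space UNIV) (\<lambda>k. \<integral>x. f k x \<partial>M)"
    using P.integrable_fst[OF I] by simp
  then show "(\<lambda>k. \<integral>x. f k x \<partial>M) summable_on UNIV"
    by (simp add: summable_iff_nn_integral integrable_iff_bounded)
qed

lemma infsum_single:
  fixes f :: "'a \<Rightarrow> 'b::{comm_monoid_add, t2_space}"
  assumes "\<And>x. x \<noteq> a \<Longrightarrow> f x = 0"
  shows "(\<Sum>\<^sub>\<infinity>x. f x) = f a"
proof -
  have "infsum f UNIV = infsum f {a}"
    by (rule infsum_cong_neutral) (use assms in auto)
  then show ?thesis by simp
qed

section \<open>Integrals of periodic functions over the cube\<close>

definition periodic :: "(real^3 \<Rightarrow> 'b) \<Rightarrow> bool" where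
  "periodic f \<longleftrightarrow> (\<forall>k x. f (x + (2 * pi) *\<^sub>R ivec k) = f x)"

text \<open>The half-open cube at \<open>h\<close>, moved by \<open>2\<pi>k\<close>. For fixed \<open>h\<close> these cells partition space, so that no boundary
has to be discussed when one of them is cut along the cells of another corner.\<close>

definition cell :: "real^3 \<Rightarrow> int^3 \<Rightarrow> (real^3) set" where
  "cell h k = {x. \<forall>j. \<lfloor>(x $ j - h $ j) / (2 * pi)\<rfloor> = k $ j}"

lemma cell_measurable [measurable]: "cell h k \<in> sets borel"
  unfolding cell_def by measurable

lemma cell_shift: "x + (2 * pi) *\<^sub>R ivec l \<in> cell h k \<longleftrightarrow> x \<in> cell h (k - l)"
proof -
  have "\<lfloor>(x $ j + 2 * pi * of_int (l $ j) - h $ j) / (2 * pi)\<rfloor> = k $ j \<longleftrightarrow>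
     \<lfloor>(x $ j - h $ j) / (2 * pi)\<rfloor> = k $ j - l $ j" for j
  proof -
    have "(x $ j + 2 * pi * of_int (l $ j) - h $ j) / (2 * pi) = (x $ j - h $ j) / (2 * pi) + of_int (l $ j)"
      by (simp add: field_simps)
    then show ?thesis by (auto simp del: add_divide_distrib)
  qed
  then show ?thesis by (simp add: cell_def ivec_def)
qed

lemma cell_translate: "x \<in> cell h 0 \<longleftrightarrow> x - h \<in> cell 0 0"
  by (simp add: cell_def)

lemma cell_subset_cube: "cell 0 0 \<subseteq> cube" and box_subset_cell: "box 0 (\<chi> i. 2 * pi) \<subseteq> cell 0 0"
  by (auto simp: cell_def cube_def mem_box_cart floor_eq_iff field_simps less_imp_le)

lemma compact_cube [simp]: "compact cube" by (simp add: cube_def)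
lemma cube_measurable [measurable, simp]: "cube \<in> sets borel" by (simp add: cube_def)

lemma exists_cell: "\<exists>k. x \<in> cell h k"
  by (intro exI[of _ "\<chi> j. \<lfloor>(x $ j - h $ j) / (2 * pi)\<rfloor>"]) (simp add: cell_def)

lemma indicator_cell_sum: "(\<Sum>\<^sub>\<infinity>k. indicator (cell h k) x * (c::complex)) = c"
proof -
  obtain k where k: "x \<in> cell h k" using exists_cell by blast
  then have "l \<noteq> k \<Longrightarrow> indicator (cell h l) x * c = 0" for l
    by (auto simp: cell_def vec_eq_iff indicator_def) metis
  from infsum_single[where a=k and f="\<lambda>l. indicator (cell h l) x * c", OF this] k show ?thesis by simp
qed

lemma nn_indicator_cell_sum: "(nsum (\<lambda>k. indicator (cell h k) x * (c::ennreal))) = c"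
proof -
  obtain k where k: "x \<in> cell h k" using exists_cell by blast
  then have "l \<noteq> k \<Longrightarrow> indicator (cell h l) x * c = 0" for l
    by (auto simp: cell_def vec_eq_iff indicator_def) metis
  from infsum_single[where a=k and f="\<lambda>l. indicator (cell h l) x * c", OF this] k show ?thesis
    by (simp flip: infsum_ennreal_conv_nn_integral)
qed

lemma reduce_to_cube: "\<exists>k. x - (2 * pi) *\<^sub>R ivec k \<in> cube"
proof -
  obtain k where "x \<in> cell 0 k" using exists_cell by blast
  then have "x - (2 * pi) *\<^sub>R ivec k \<in> cell 0 0"
    using cell_shift[of "x - (2 * pi) *\<^sub>R ivec k" k 0 k] by simp
  then show ?thesis using cell_subset_cube by blast
qed

lemma periodic_bounded:
  fixes f :: "real^3 \<Rightarrow> complex"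
  assumes "periodic f" "continuous_on UNIV f"
  shows "\<exists>B. \<forall>x. norm (f x) \<le> B"
proof -
  have "compact (f ` cube)"
    using assms(2) by (intro compact_continuous_image) (auto intro: continuous_on_subset)
  then obtain B where B: "\<And>x. x \<in> cube \<Longrightarrow> norm (f x) \<le> B"
    by (meson bounded_iff compact_imp_bounded image_eqI)
  show ?thesis
  proof (intro exI allI)
    fix x
    obtain k where k: "x - (2 * pi) *\<^sub>R ivec k \<in> cube" using reduce_to_cube by blast
    have "f (x - (2 * pi) *\<^sub>R ivec k) = f x"
      using assms(1) unfolding periodic_def by (metis diff_add_cancel)
    then show "norm (f x) \<le> B" using B[OF k] by simp
  qed
qed

lemma cell_AE: "AE x in lborel. x \<in> cell 0 0 \<longleftrightarrow> x \<in> cube"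
proof -
  have "negligible (cbox 0 (\<chi> i. 2 * pi) - box 0 (\<chi> i. 2 * pi) :: (real^3) set)"
    by (rule negligible_frontier_interval)
  then have "(cbox 0 (\<chi> i. 2 * pi) - box 0 (\<chi> i. 2 * pi) :: (real^3) set) \<in> null_sets lborel"
    by (simp add: negligible_iff_null_sets null_sets_completion_iff)
  then have "AE x in lborel. x \<notin> (cbox 0 (\<chi> i. 2 * pi) - box 0 (\<chi> i. 2 * pi) :: (real^3) set)"
    by (rule AE_not_in)
  then show ?thesis
    by eventually_elim (use cell_subset_cube box_subset_cell in \<open>auto simp: cube_def\<close>)
qed

lemma emeasure_cube_finite: "emeasure lborel cube < \<infinity>"
  by (rule emeasure_compact_finite) simp

lemma emeasure_cell: "emeasure lborel (cell h 0) < \<infinity>"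
proof -
  have "emeasure lborel (cell h 0) = emeasure (distr lborel borel ((+) h)) (cell h 0)"
    by (simp add: lborel_distr_plus)
  also have "\<dots> = emeasure lborel {x. h + x \<in> cell h 0}"
    by (subst emeasure_distr) (auto simp: vimage_def)
  also have "{x. h + x \<in> cell h 0} = cell 0 0" by (auto simp: cell_translate[of _ h])
  also have "emeasure lborel (cell 0 0) \<le> emeasure lborel cube"
    using cell_subset_cube by (intro emeasure_mono) auto
  finally show ?thesis using emeasure_cube_finite by order
qed

text \<open>The cell at \<open>h\<close> is cut along the cells \<open>cell 0 k\<close>; moved back by the lattice, the pieces tile \<open>cell 0 0\<close>,
and a periodic function does not notice the move.\<close>

lemma integral_cell:
  fixes f :: "real^3 \<Rightarrow> complex"
  assumes per: "periodic f" and cont: "continuous_on UNIV f"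
  shows "(\<integral>x. indicator (cell h 0) x * f x \<partial>lborel) = (\<integral>x. indicator (cell 0 0) x * f x \<partial>lborel)"
proof -
  have [measurable]: "f \<in> borel_measurable borel"
    by (rule borel_measurable_continuous_onI[OF cont])
  obtain B where B: "\<And>x. norm (f x) \<le> B" using periodic_bounded[OF per cont] by blast
  have fin: "(nsum (\<lambda>k. (\<integral>\<^sup>+x. norm (indicator (cell h' k) x * (indicator (cell h'' 0) x * f x)) \<partial>lborel))) < \<infinity>" for h' h''
  proof -
    have "(nsum (\<lambda>k. (\<integral>\<^sup>+x. norm (indicator (cell h' k) x * (indicator (cell h'' 0) x * f x)) \<partial>lborel)))
      = (\<integral>\<^sup>+x. (nsum (\<lambda>k. indicator (cell h' k) x * ennreal (norm (indicator (cell h'' 0) x * f x)))) \<partial>lborel)"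
      by (subst nn_sum_swap) (auto intro!: nn_integral_cong simp: indicator_def)
    also have "\<dots> = (\<integral>\<^sup>+x. ennreal (norm (indicator (cell h'' 0) x * f x)) \<partial>lborel)"
      by (simp only: nn_indicator_cell_sum)
    also have "\<dots> \<le> (\<integral>\<^sup>+x. ennreal B * indicator (cell h'' 0) x \<partial>lborel)"
      using B by (intro nn_integral_mono) (auto simp: indicator_def intro!: ennreal_leI)
    also have "\<dots> = ennreal B * emeasure lborel (cell h'' 0)"
      by (subst nn_integral_cmult_indicator) auto
    also have "\<dots> < \<infinity>" using emeasure_cell by (simp add: ennreal_mult_less_top)
    finally show ?thesis .
  qed
  have shift: "f (x + (2 * pi) *\<^sub>R ivec k) = f x" for x k using per by (simp add: periodic_def)
  note swap = integral_infsum[OF sigma_finite_lborel _ fin]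
  have "(\<integral>x. indicator (cell h 0) x * f x \<partial>lborel)
     = (\<integral>x. (\<Sum>\<^sub>\<infinity>k. indicator (cell 0 k) x * (indicator (cell h 0) x * f x)) \<partial>lborel)"
    by (simp only: indicator_cell_sum)
  also have "\<dots> = (\<Sum>\<^sub>\<infinity>k. \<integral>x. indicator (cell 0 k) x * (indicator (cell h 0) x * f x) \<partial>lborel)"
    by (rule swap) measurable
  also have "\<dots> = (\<Sum>\<^sub>\<infinity>k. \<integral>x. indicator (cell 0 0) x * (indicator (cell h (-k)) x * f x) \<partial>lborel)"
  proof (rule infsum_cong)
    fix k
    have "(\<integral>x. indicator (cell 0 k) x * (indicator (cell h 0) x * f x) \<partial>lborel) =
      (\<integral>x. indicator (cell 0 k) x * (indicator (cell h 0) x * f x) \<partial>distr lborel borel ((+) ((2 * pi) *\<^sub>R ivec k)))"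
      by (simp add: lborel_distr_plus)
    also have "\<dots> = (\<integral>x. indicator (cell 0 k) (x + (2 * pi) *\<^sub>R ivec k) * (indicator (cell h 0) (x + (2 * pi) *\<^sub>R ivec k) * f (x + (2 * pi) *\<^sub>R ivec k)) \<partial>lborel)"
      by (subst integral_distr) (auto simp: add.commute)
    also have "\<dots> = (\<integral>x. indicator (cell 0 0) x * (indicator (cell h (-k)) x * f x) \<partial>lborel)"
      by (simp add: indicator_def cell_shift shift cong: if_cong)
    finally show "(\<integral>x. indicator (cell 0 k) x * (indicator (cell h 0) x * f x) \<partial>lborel)
      = (\<integral>x. indicator (cell 0 0) x * (indicator (cell h (-k)) x * f x) \<partial>lborel)" .
  qed
  also have "\<dots> = (\<Sum>\<^sub>\<infinity>k. \<integral>x. indicator (cell 0 0) x * (indicator (cell h k) x * f x) \<partial>lborel)"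
    by (rule infsum_reindex_bij_betw[where g=uminus, unfolded o_def]) (auto intro!: bij_uminus)
  also have "\<dots> = (\<Sum>\<^sub>\<infinity>k. \<integral>x. indicator (cell h k) x * (indicator (cell 0 0) x * f x) \<partial>lborel)"
    by (simp add: mult_ac)
  also have "\<dots> = (\<integral>x. (\<Sum>\<^sub>\<infinity>k. indicator (cell h k) x * (indicator (cell 0 0) x * f x)) \<partial>lborel)"
    by (rule swap[symmetric]) measurable
  also have "\<dots> = (\<integral>x. indicator (cell 0 0) x * f x \<partial>lborel)"
    by (simp only: indicator_cell_sum)
  finally show ?thesis .
qed

lemma set_integral_cube_cell:
  fixes f :: "real^3 \<Rightarrow> complex"
  assumes [measurable]: "f \<in> borel_measurable borel"
  shows "(LINT x:cube|lborel. f x) = (\<integral>x. indicator (cell 0 0) x * f x \<partial>lborel)"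
  unfolding set_lebesgue_integral_def
proof (rule integral_cong_AE)
  show "AE x in lborel. indicat_real cube x *\<^sub>R f x = indicator (cell 0 0) x * f x"
    using cell_AE by eventually_elim (auto simp: indicator_def)
qed auto

lemma integral_cube_translate:
  fixes f :: "real^3 \<Rightarrow> complex"
  assumes per: "periodic f" and cont: "continuous_on UNIV f"
  shows "(LINT x:cube|lborel. f (x + h)) = (LINT x:cube|lborel. f x)"
proof -
  have [measurable]: "f \<in> borel_measurable borel"
    by (rule borel_measurable_continuous_onI[OF cont])
  have "(LINT x:cube|lborel. f (x + h)) = (\<integral>x. indicator (cell 0 0) x * f (x + h) \<partial>lborel)"
    by (rule set_integral_cube_cell) measurable
  also have "\<dots> = (\<integral>x. indicator (cell h 0) x * f x \<partial>distr lborel borel ((+) h))"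
    by (subst integral_distr) (auto simp: add.commute indicator_def cell_translate[of _ h])
  also have "\<dots> = (LINT x:cube|lborel. f x)"
    using integral_cell[OF per cont] by (simp add: lborel_distr_plus set_integral_cube_cell)
  finally show ?thesis .
qed

lemma measure_cube: "measure lborel cube = (2 * pi) ^ 3"
  by (simp add: cube_def content_cbox_cart interval_eq_empty_cart not_less)

text \<open>For \<open>k \<noteq> 0\<close> a translation by some \<open>h\<close> with \<open>ivec k \<bullet> h = \<pi>\<close> changes the sign of the wave but not the
integral.\<close>

lemma integral_wave_cube: "(LINT x:cube|lborel. wave k x) = (if k = 0 then of_real ((2 * pi) ^ 3) else 0)"
proof (cases "k = 0")
  case True
  have "(LINT x:cube|lborel. wave 0 x) = of_real (measure lborel cube)"
    by (simp add: set_lebesgue_integral_def scaleR_conv_of_real)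
  then show ?thesis using True by (simp add: measure_cube)
next
  case False
  then obtain j where j: "k $ j \<noteq> 0" by (auto simp: vec_eq_iff)
  define h :: "real^3" where "h = axis j (pi / of_int (k $ j))"
  have "ivec k \<bullet> h = pi"
    using j by (simp add: h_def inner_axis ivec_def)
  then have w: "wave k h = -1" by (simp add: wave_def)
  have "(LINT x:cube|lborel. wave k x) = (LINT x:cube|lborel. wave k (x + h))"
    by (rule integral_cube_translate[symmetric]) (auto simp: periodic_def intro!: continuous_intros)
  also have "\<dots> = - (LINT x:cube|lborel. wave k x)"
    by (simp add: wave_add_point w set_lebesgue_integral_def)
  finally show ?thesis using False by simp
qed

lemma set_integrable_cube:
  fixes f :: "real^3 \<Rightarrow> complex"
  assumes "continuous_on cube f" shows "set_integrable lborel cube f"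
  unfolding set_integrable_def by (rule borel_integrable_compact) (auto intro: assms)

lemma norm_integral_cube_le:
  fixes f :: "real^3 \<Rightarrow> complex"
  assumes "\<And>x. x \<in> cube \<Longrightarrow> norm (f x) \<le> B" and f: "continuous_on cube f"
  shows "norm (LINT x:cube|lborel. f x) \<le> (2 * pi) ^ 3 * B"
proof -
  have "norm (LINT x:cube|lborel. f x) \<le> (\<integral>x. norm (indicator cube x *\<^sub>R f x) \<partial>lborel)"
    unfolding set_lebesgue_integral_def by (rule integral_norm_bound)
  also have "\<dots> \<le> (\<integral>x. indicator cube x *\<^sub>R B \<partial>lborel)"
  proof (rule integral_mono)
    show "integrable lborel (\<lambda>x. norm (indicat_real cube x *\<^sub>R f x))"
      using set_integrable_cube[OF f] unfolding set_integrable_def by (rule integrable_norm)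
    show "integrable lborel (\<lambda>x. indicat_real cube x *\<^sub>R B)"
      by (rule borel_integrable_compact) auto
  qed (use assms in \<open>auto simp: indicator_def\<close>)
  also have "\<dots> = measure lborel cube *\<^sub>R B"
    using emeasure_cube_finite by simp
  finally show ?thesis by (simp add: measure_cube)
qed

text \<open>Up to normalisation this is the Fourier coefficient of \<open>\<phi>\<close> at \<open>- k\<close>, the factor of the \<open>k\<close>-th mode when
a Fourier series is applied to \<open>\<phi>\<close>.\<close>

definition pairing :: "int^3 \<Rightarrow> (real^3 \<Rightarrow> complex) \<Rightarrow> complex" where
  "pairing k \<phi> = (LINT x:cube|lborel. wave k x * \<phi> x)"

lemma pairing_wave: "pairing k (wave l) = (if k + l = 0 then (2 * pi) ^ 3 else 0)"
  using integral_wave_cube[of "k + l"] by (simp add: pairing_def wave_add_freq)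

lemma pairing_cmult: "pairing k (\<lambda>x. c * \<phi> x) = c * pairing k \<phi>"
  by (simp add: pairing_def mult.left_commute)

lemma pairing_add:
  "continuous_on cube \<phi> \<Longrightarrow> continuous_on cube \<psi> \<Longrightarrow>
    pairing k (\<lambda>x. \<phi> x + \<psi> x) = pairing k \<phi> + pairing k \<psi>"
  unfolding pairing_def distrib_left
  by (intro set_integral_add set_integrable_cube continuous_intros continuous_on_id)

lemma norm_pairing_le:
  assumes "\<And>x. x \<in> cube \<Longrightarrow> norm (\<phi> x) \<le> B" "continuous_on cube \<phi>"
  shows "norm (pairing k \<phi>) \<le> (2 * pi) ^ 3 * B"
  unfolding pairing_def
  by (rule norm_integral_cube_le) (auto simp: norm_mult assms intro!: continuous_intros)

section \<open>Locally integrable functions as distributions in time\<close>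

text \<open>For \<open>p = 1\<close> this is the standard smooth function that is flat at \<open>0\<close>; the factor \<open>p\<close> makes the class closed
under derivatives.\<close>

definition flat :: "real poly \<Rightarrow> real \<Rightarrow> real" where
  "flat p x = (if x > 0 then poly p (1 / x) * exp (- 1 / x) else 0)"

lemma tendsto_poly_exp: "((\<lambda>y::real. poly p y * exp (- y)) \<longlongrightarrow> 0) at_top"
proof -
  have "((\<lambda>y. \<Sum>i\<le>degree p. coeff p i * (y ^ i / exp y)) \<longlongrightarrow> (\<Sum>i\<le>degree p. coeff p i * 0)) at_top"
    by (intro tendsto_intros tendsto_power_div_exp_0)
  then show ?thesis
    by (simp add: poly_altdef sum_distrib_right sum_divide_distrib exp_minus field_simps)
qed

lemma flat_has_derivative:
  "(flat p has_real_derivative flat ([:0, 0, 1:] * (p - pderiv p)) x) (at x)"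
proof (cases x "0::real" rule: linorder_cases)
  case less
  have "((\<lambda>x. 0) has_real_derivative 0) (at x)" by simp
  then have "(flat p has_real_derivative 0) (at x)"
    by (rule DERIV_cong_ev[THEN iffD1, rotated 3, OF _ refl _ refl])
       (use less in \<open>auto simp: flat_def intro!: eventually_mono[OF eventually_nhds_in_open[of "{..<0}" x]]\<close>)
  then show ?thesis using less by (simp add: flat_def)
next
  case greater
  have *: "((\<lambda>x. poly p (1 / x)) has_real_derivative poly (pderiv p) (1 / x) * (- 1 / x\<^sup>2)) (at x)"
    by (rule DERIV_chain2[OF poly_DERIV]) (use greater in \<open>auto intro!: derivative_eq_intros simp: power2_eq_square\<close>)
  have "((\<lambda>x. poly p (1 / x) * exp (- 1 / x)) has_real_derivative
      poly p (1 / x) * (exp (- 1 / x) * (1 / x\<^sup>2)) + poly (pderiv p) (1 / x) * (- 1 / x\<^sup>2) * exp (- 1 / x)) (at x)"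
    using greater by (auto intro!: derivative_eq_intros * simp: power2_eq_square)
  also have "poly p (1 / x) * (exp (- 1 / x) * (1 / x\<^sup>2)) + poly (pderiv p) (1 / x) * (- 1 / x\<^sup>2) * exp (- 1 / x)
     = flat ([:0, 0, 1:] * (p - pderiv p)) x"
    using greater by (simp add: flat_def field_simps power2_eq_square)
  finally show ?thesis
    by (rule DERIV_cong_ev[THEN iffD1, rotated 3, OF _ refl _ refl])
       (use greater in \<open>auto simp: flat_def intro!: eventually_mono[OF eventually_nhds_in_open[of "{0<..}" x]]\<close>)
next
  case equal
  have "((\<lambda>h. poly (pCons 0 p) (1 / h) * exp (- (1 / h))) \<longlongrightarrow> 0) (at_right (0::real))"
    by (rule filterlim_compose[OF tendsto_poly_exp]) (use filterlim_inverse_at_top_right in \<open>simp add: divide_inverse\<close>)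
  then have "((\<lambda>h. flat p h / h) \<longlongrightarrow> 0) (at_right 0)"
    by (rule Lim_transform_eventually)
       (auto simp: flat_def eventually_at_filter)
  moreover have "((\<lambda>h. flat p h / h) \<longlongrightarrow> 0) (at_left 0)"
    by (rule Lim_transform_eventually[of "\<lambda>_. 0"])
       (auto simp: flat_def eventually_at_filter)
  ultimately have "((\<lambda>h. flat p h / h) \<longlongrightarrow> 0) (at 0)"
    by (simp add: filterlim_split_at)
  then show ?thesis using equal by (simp add: DERIV_def flat_def)
qed

lemma smooth_flat: "smooth (\<lambda>x. complex_of_real (flat p x))"
proof (rule smooth_coinduct[where P="\<lambda>f. \<exists>p. f = (\<lambda>x. complex_of_real (flat p x))"])
  fix g assume "\<exists>p. g = (\<lambda>x. complex_of_real (flat p x))"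
  then obtain p where g: "g = (\<lambda>x. complex_of_real (flat p x))" by blast
  define q where "q = [:0, 0, 1:] * (p - pderiv p)"
  have d: "(g has_derivative (\<lambda>h. of_real (flat q x * h))) (at x)" for x
    unfolding g q_def
    by (intro has_derivative_of_real has_field_derivative_imp_has_derivative flat_has_derivative)
  then have "(\<lambda>x. frechet_derivative g (at x) 1) = (\<lambda>x. complex_of_real (flat q x))"
    using frechet_derivative_eqI[OF d] by (simp add: fun_eq_iff)
  then show "g differentiable_on UNIV \<and> (\<forall>b\<in>Basis. \<exists>p. (\<lambda>x. frechet_derivative g (at x) b) = (\<lambda>x. complex_of_real (flat p x)))"
    using differentiableI[OF d] by (auto simp: differentiable_on_def)
qed blast

text \<open>Smooth functions supported in \<open>[c, d]\<close> with values in \<open>[0,1]\<close>, which tend to the indicator function of the interval as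
both transitions are steepened.\<close>

definition bump :: "real \<Rightarrow> real \<Rightarrow> nat \<Rightarrow> real \<Rightarrow> complex" where
  "bump c d n t = of_real (flat 1 (real (Suc n) * (t - c))) * of_real (flat 1 (real (Suc n) * (d - t)))"

lemma smooth_bump: "smooth (bump c d n)"
proof -
  let ?f = "\<lambda>x. complex_of_real (flat 1 x)"
  have 1: "smooth (\<lambda>t. ?f (a * t + w))" for a w :: real
    by (rule smooth_affine[OF smooth_flat]) (auto intro: bounded_linear_mult_right)
  have "smooth (\<lambda>t. ?f (real (Suc n) * t + (- real (Suc n) * c)) * ?f ((- real (Suc n)) * t + real (Suc n) * d))"
    by (intro smooth_mult 1)
  then show ?thesis
    by (simp add: bump_def[abs_def] algebra_simps)
qed

lemma bump_test_time: "0 < c \<Longrightarrow> bump c d n \<in> test_time"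
  unfolding test_time_def
  by (rule CollectI, intro conjI exI[of _ c] exI[of _ d])
    (auto simp: smooth_bump bump_def flat_def zero_less_mult_iff)

lemma norm_bump_le: "norm (bump c d n t) \<le> 1"
  by (auto simp: bump_def flat_def norm_mult mult_le_one)

lemma bump_tendsto: "(\<lambda>n. bump c d n t) \<longlonglongrightarrow> indicator {c<..<d} t"
proof -
  have *: "(\<lambda>n. flat 1 (real (Suc n) * x)) \<longlonglongrightarrow> indicator {0<..} x" for x
  proof (cases "x > 0")
    case True
    have "(\<lambda>n. - (1 / x) * (1 / real (Suc n))) \<longlonglongrightarrow> - (1 / x) * 0"
      by (intro tendsto_intros lim_1_over_n[THEN LIMSEQ_Suc])
    from tendsto_exp[OF this] have "(\<lambda>n. exp (- (1 / x) * (1 / real (Suc n)))) \<longlonglongrightarrow> 1" by simp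
    then show ?thesis using True by (simp add: flat_def zero_less_mult_iff field_simps del: of_nat_Suc)
  next
    case False
    then show ?thesis by (simp add: flat_def zero_less_mult_iff del: of_nat_Suc)
  qed
  have "(\<lambda>n. bump c d n t) \<longlonglongrightarrow> of_real (indicator {0<..} (t - c)) * of_real (indicator {0<..} (d - t))"
    unfolding bump_def by (intro tendsto_intros *)
  also have "of_real (indicator {0<..} (t - c)) * of_real (indicator {0<..} (d - t)) = (indicator {c<..<d} t :: complex)"
    by (auto simp: indicator_def)
  finally show ?thesis .
qed

lemma smooth_measurable: "smooth f \<Longrightarrow> f \<in> borel_measurable borel"
  by (rule borel_measurable_continuous_onI) (rule smooth_continuous_on)

text \<open>Intervals generate the Borel sets and are stable under intersection, so all integrals over Borel
sets vanish, in particular those over the sets where the real or imaginary part has a given sign.\<close>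

lemma AE_zero_of_interval_integrals:
  fixes g :: "real \<Rightarrow> complex"
  assumes g: "integrable lborel g"
    and I: "\<And>c d. (LINT x:{c<..<d}|lborel. g x) = 0"
    and U: "(LINT x|lborel. g x) = 0"
  shows "AE x in lborel. g x = 0"
proof -
  have int: "set_integrable lborel A g" if "A \<in> sets borel" for A
    using integrable_mult_indicator[of A lborel g] that g by (simp add: set_integrable_def)
  have meas [measurable]: "g \<in> borel_measurable borel" using g by auto
  have Z: "(LINT x:A|lborel. g x) = 0" if "A \<in> sets borel" for A
  proof -
    have s: "sets borel = sigma_sets UNIV (range (\<lambda>(c, d). {c<..<d::real}))"
      by (subst borel_eq_box) (simp add: case_prod_unfold)
    have "Int_stable (range (\<lambda>(c, d). {c<..<d::real}))"
      by (auto simp: Int_stable_def greaterThanLessThan_def)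
        (metis (no_types, lifting) UNIV_I Int_greaterThanLessThan case_prod_conv greaterThanLessThan_def image_eqI)
    moreover have "range (\<lambda>(c, d). {c<..<d::real}) \<subseteq> Pow UNIV" by simp
    moreover have "A \<in> sigma_sets UNIV (range (\<lambda>(c, d). {c<..<d::real}))" using that s by simp
    ultimately show ?thesis
    proof (induction rule: sigma_sets_induct_disjoint)
      case (basic A) then show ?case using I by auto
    next
      case empty then show ?case by (simp add: set_lebesgue_integral_def)
    next
      case (compl A)
      then have A: "A \<in> sets borel" using s by simp
      have "(LINT x:A \<union> (UNIV - A)|lborel. g x) = (LINT x:A|lborel. g x) + (LINT x:UNIV - A|lborel. g x)"
        by (intro set_integral_Un int) (use A in auto)
      then show ?case using compl U by (simp add: set_lebesgue_integral_def)
    next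
      case (union A)
      then have A: "A i \<in> sets borel" for i using s by auto
      have "(LINT x:(\<Union>i. A i)|lborel. g x) = (\<Sum>i. LINT x:A i|lborel. g x)"
        by (intro lebesgue_integral_countable_add int) (use A union in \<open>auto simp: disjoint_family_on_def\<close>)
      then show ?case using union by simp
    qed
  qed
  have R: "AE x in lborel. h x = 0" if h: "integrable lborel h" and Zh: "\<And>A. A \<in> sets borel \<Longrightarrow> (LINT x:A|lborel. h x) = 0" for h :: "real \<Rightarrow> real"
  proof -
    have [measurable]: "h \<in> borel_measurable borel" using h by auto
    have 1: "AE x in lborel. indicator {x. h x \<ge> 0} x * h x = 0"
      using Zh[of "{x. h x \<ge> 0}"] integrable_mult_indicator[of "{x. h x \<ge> 0}" lborel h] h
      by (subst integral_nonneg_eq_0_iff_AE[symmetric]) (auto simp: indicator_def set_lebesgue_integral_def)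
    have 2: "AE x in lborel. - (indicator {x. h x \<le> 0} x * h x) = 0"
      using Zh[of "{x. h x \<le> 0}"] integrable_mult_indicator[of "{x. h x \<le> 0}" lborel h] h
      by (subst integral_nonneg_eq_0_iff_AE[symmetric]) (auto simp: indicator_def set_lebesgue_integral_def)
    show ?thesis using 1 2 by eventually_elim (auto simp: indicator_def split: if_splits)
  qed
  have "(LINT x:A|lborel. Re (g x)) = Re (LINT x:A|lborel. g x)" "(LINT x:A|lborel. Im (g x)) = Im (LINT x:A|lborel. g x)"
    if "A \<in> sets borel" for A
    using int[OF that] by (simp_all add: set_lebesgue_integral_def set_integrable_def flip: integral_Re integral_Im)
  then have "AE x in lborel. Re (g x) = 0" "AE x in lborel. Im (g x) = 0"
    using g Z by (auto intro!: R integrable_Re integrable_Im)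
  then show ?thesis by eventually_elim (simp add: complex_eq_iff)
qed

text \<open>Testing with \<open>bump c d n\<close> and passing to the limit shows that all integrals over intervals vanish.\<close>

lemma du_Bois_Reymond:
  fixes h :: "real \<Rightarrow> complex"
  assumes meas[measurable]: "h \<in> borel_measurable borel"
    and loc: "\<And>a b. a > 0 \<Longrightarrow> set_integrable lborel {a..b} h"
    and Z: "\<And>\<psi>. \<psi> \<in> test_time \<Longrightarrow> (LINT t:{0<..}|lborel. h t * \<psi> t) = 0"
  shows "AE t in lborel. 0 < t \<longrightarrow> h t = 0"
proof -
  have I: "(LINT x:{c<..<d}|lborel. h x) = 0" if c: "0 < c" for c d
  proof -
    have "(\<lambda>n. LINT t|lborel. indicator {0<..} t *\<^sub>R (h t * bump c d n t)) \<longlonglongrightarrow> (LINT t|lborel. indicator {c<..<d} t *\<^sub>R h t)"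
    proof (rule integral_dominated_convergence[where w="\<lambda>t. norm (indicator {c..d} t *\<^sub>R h t)"])
      show "integrable lborel (\<lambda>t. norm (indicator {c..d} t *\<^sub>R h t))"
        using loc[OF c] by (intro integrable_norm) (simp add: set_integrable_def)
      have "(\<lambda>n. indicator {0<..} t *\<^sub>R (h t * bump c d n t)) \<longlonglongrightarrow> indicator {0<..} t *\<^sub>R (h t * indicator {c<..<d} t)" for t
        by (intro tendsto_intros bump_tendsto)
      moreover have "indicator {0<..} t *\<^sub>R (h t * indicator {c<..<d} t) = indicator {c<..<d} t *\<^sub>R h t" for t
        using c by (auto simp: indicator_def)
      ultimately show "AE t in lborel. (\<lambda>n. indicator {0<..} t *\<^sub>R (h t * bump c d n t)) \<longlonglongrightarrow> indicator {c<..<d} t *\<^sub>R h t" by simp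
      have "norm (indicator {0<..} t *\<^sub>R (h t * bump c d n t)) \<le> norm (indicator {c..d} t *\<^sub>R h t)" for n t
      proof (cases "t \<in> {c..d}")
        case True
        then show ?thesis using norm_bump_le[of c d n t] mult_left_mono[of "norm (bump c d n t)" 1 "norm (h t)"]
          by (simp add: norm_mult indicator_def)
      next
        case False
        then have "bump c d n t = 0"
          by (auto simp: bump_def flat_def zero_less_mult_iff)
        then show ?thesis by simp
      qed
      then show "AE t in lborel. norm (indicator {0<..} t *\<^sub>R (h t * bump c d n t)) \<le> norm (indicator {c..d} t *\<^sub>R h t)" for n by simp
      have [measurable]: "bump c d n \<in> borel_measurable borel" for n by (intro smooth_measurable smooth_bump)
      show "(\<lambda>t. indicator {0<..} t *\<^sub>R (h t * bump c d n t)) \<in> borel_measurable lborel" for n by measurable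
    qed measurable
    moreover have "(LINT t|lborel. indicator {0<..} t *\<^sub>R (h t * bump c d n t)) = 0" for n
      using Z[OF bump_test_time[OF c]] by (simp add: set_lebesgue_integral_def)
    ultimately show ?thesis by (simp add: set_lebesgue_integral_def LIMSEQ_const_iff)
  qed
  have AEn: "AE t in lborel. indicator {1 / real (Suc n)<..<real n} t *\<^sub>R h t = 0" for n
  proof (rule AE_zero_of_interval_integrals)
    have n: "0 < 1 / real (Suc n)" by simp
    have "set_integrable lborel {1 / real (Suc n)<..<real n} h"
      by (rule set_integrable_subset[OF loc[OF n, of "real n"]]) auto
    then show "integrable lborel (\<lambda>t. indicator {1 / real (Suc n)<..<real n} t *\<^sub>R h t)"
      by (simp add: set_integrable_def)
    show "(LINT t:{c<..<d}|lborel. indicator {1 / real (Suc n)<..<real n} t *\<^sub>R h t) = 0" for c d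
    proof -
      have "(LINT t:{c<..<d}|lborel. indicator {1 / real (Suc n)<..<real n} t *\<^sub>R h t) =
         (LINT t:{max c (1 / real (Suc n))<..<min d (real n)}|lborel. h t)"
        unfolding set_lebesgue_integral_def by (intro Bochner_Integration.integral_cong) (auto simp: indicator_def)
      also have "\<dots> = 0" by (rule I) (use n in linarith)
      finally show ?thesis .
    qed
    show "(LINT t|lborel. indicator {1 / real (Suc n)<..<real n} t *\<^sub>R h t) = 0"
      using I[OF n, of "real n"] by (simp add: set_lebesgue_integral_def)
  qed
  then have "AE t in lborel. \<forall>n. indicator {1 / real (Suc n)<..<real n} t *\<^sub>R h t = 0"
    by (subst AE_all_countable) blast
  then show ?thesis
  proof eventually_elim
    case (elim t)
    show ?case
    proof
      assume t: "0 < t"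
      obtain m where m: "t < real m" using reals_Archimedean2 by blast
      obtain m' where m': "1 / real (Suc m') < t" using t nat_approx_posE by blast
      let ?n = "max m m'"
      have "1 / real (Suc ?n) \<le> 1 / real (Suc m')" by (intro divide_left_mono) auto
      then have "t \<in> {1 / real (Suc ?n)<..<real ?n}" using m m' by auto
      then show "h t = 0" using elim[rule_format, of ?n] by simp
    qed
  qed
qed

lemma set_integrable_test_mult:
  assumes g: "\<And>a b. a > 0 \<Longrightarrow> set_integrable lborel {a..b} g" and \<psi>: "\<psi> \<in> test_time"
  shows "set_integrable lborel {0<..} (\<lambda>t. g t * \<psi> t :: complex)"
proof -
  obtain a b where ab: "smooth \<psi>" "0 < a" "\<And>t. t \<notin> {a..b} \<Longrightarrow> \<psi> t = 0"
    using \<psi> by (auto simp: test_time_def)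
  have [measurable]: "\<psi> \<in> borel_measurable borel" using ab smooth_measurable by blast
  have "compact (\<psi> ` {a..b})"
    by (intro compact_continuous_image smooth_continuous_on ab) auto
  then obtain B where B: "\<And>t. t \<in> {a..b} \<Longrightarrow> norm (\<psi> t) \<le> B"
    by (meson bounded_iff compact_imp_bounded image_eqI)
  have "integrable lborel (\<lambda>t. (indicator {a..b} t *\<^sub>R g t) * \<psi> t)"
  proof (rule Bochner_Integration.integrable_bound[of _ "\<lambda>t. B * norm (indicator {a..b} t *\<^sub>R g t)"])
    show "integrable lborel (\<lambda>t. B * norm (indicator {a..b} t *\<^sub>R g t))"
      using g[OF ab(2), of b] by (intro integrable_mult_right integrable_norm) (simp add: set_integrable_def)
    show "(\<lambda>t. indicator {a..b} t *\<^sub>R g t * \<psi> t) \<in> borel_measurable lborel"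
      using g[OF ab(2), of b] unfolding set_integrable_def by (intro borel_measurable_times) auto
    show "AE t in lborel. norm (indicator {a..b} t *\<^sub>R g t * \<psi> t) \<le> norm (B * norm (indicator {a..b} t *\<^sub>R g t))"
      using B by (intro AE_I2)
        (auto simp: indicator_def norm_mult mult.commute intro!: order_trans[OF mult_right_mono[OF B norm_ge_zero] abs_ge_self])
  qed
  also have "(\<lambda>t. (indicator {a..b} t *\<^sub>R g t) * \<psi> t) = (\<lambda>t. indicator {0<..} t *\<^sub>R (g t * \<psi> t))"
    using ab(2,3) by (force simp: fun_eq_iff indicator_def)
  finally show ?thesis by (simp add: set_integrable_def)
qed

text \<open>Because of this, the choice made in \<open>time_coeff\<close> does not matter.\<close>

lemma represents_unique:
  assumes f: "represents f S" and g: "represents g T" and eq: "\<And>\<psi>. \<psi> \<in> test_time \<Longrightarrow> S \<psi> = T \<psi>"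
  shows "AE t in lborel. 0 < t \<longrightarrow> f t = g t"
proof -
  have "AE t in lborel. 0 < t \<longrightarrow> f t - g t = 0"
  proof (rule du_Bois_Reymond)
    show "(\<lambda>t. f t - g t) \<in> borel_measurable borel" using f g by (auto simp: represents_def)
    show "set_integrable lborel {a..b} (\<lambda>t. f t - g t)" if "a > 0" for a b
      using that f g by (intro set_integral_diff) (auto simp: represents_def)
    show "(LINT t:{0<..}|lborel. (f t - g t) * \<psi> t) = 0" if "\<psi> \<in> test_time" for \<psi>
    proof -
      have "(LINT t:{0<..}|lborel. (f t - g t) * \<psi> t) = (LINT t:{0<..}|lborel. f t * \<psi> t) - (LINT t:{0<..}|lborel. g t * \<psi> t)"
        unfolding left_diff_distrib using that f g
        by (intro set_integral_diff set_integrable_test_mult) (auto simp: represents_def)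
      also have "\<dots> = S \<psi> - T \<psi>" using that f g by (auto simp: represents_def)
      finally show ?thesis using eq[OF that] by simp
    qed
  qed
  then show ?thesis by eventually_elim simp
qed

lemma represents_diff:
  assumes f: "represents f S" and g: "represents g T"
  shows "represents (\<lambda>t. f t - g t) (\<lambda>\<psi>. S \<psi> - T \<psi>)"
  unfolding represents_def
proof (intro conjI allI impI ballI)
  show "(\<lambda>t. f t - g t) \<in> borel_measurable lborel" using f g by (auto simp: represents_def)
  show "set_integrable lborel {a..b} (\<lambda>t. f t - g t)" if "a > 0" for a b
    using that f g by (intro set_integral_diff) (auto simp: represents_def)
  show "S \<psi> - T \<psi> = (LINT t:{0<..}|lborel. (f t - g t) * \<psi> t)" if "\<psi> \<in> test_time" for \<psi>
  proof -
    have "(LINT t:{0<..}|lborel. (f t - g t) * \<psi> t) = (LINT t:{0<..}|lborel. f t * \<psi> t) - (LINT t:{0<..}|lborel. g t * \<psi> t)"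
      unfolding left_diff_distrib using that f g
      by (intro set_integral_diff set_integrable_test_mult) (auto simp: represents_def)
    also have "\<dots> = S \<psi> - T \<psi>" using that f g by (auto simp: represents_def)
    finally show ?thesis ..
  qed
qed

section \<open>Test functions on space-time and their mollification in space\<close>

lemma test_spacetime_in_smooth: "\<phi> \<in> test_spacetime_in a b \<Longrightarrow> smooth \<phi>"
  by (simp add: test_spacetime_in_def)

lemma test_spacetime_in_periodic: "\<phi> \<in> test_spacetime_in a b \<Longrightarrow> \<phi> (t, x + (2 * pi) *\<^sub>R ivec k) = \<phi> (t, x)"
  by (simp add: test_spacetime_in_def)

lemma test_spacetime_in_zero: "\<phi> \<in> test_spacetime_in a b \<Longrightarrow> t \<notin> {a..b} \<Longrightarrow> \<phi> (t, x) = 0"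
  unfolding test_spacetime_in_def by blast

lemma test_spacetime_in_add:
  "\<phi> \<in> test_spacetime_in a b \<Longrightarrow> \<psi> \<in> test_spacetime_in a b \<Longrightarrow> (\<lambda>z. \<phi> z + \<psi> z) \<in> test_spacetime_in a b"
  by (auto simp: test_spacetime_in_def smooth_add)

lemma test_spacetime_in_cmult:
  "\<phi> \<in> test_spacetime_in a b \<Longrightarrow> (\<lambda>z. c * \<phi> z) \<in> test_spacetime_in a b"
  by (auto simp: test_spacetime_in_def smooth_cmult)

lemma test_spacetime_in_diff:
  "\<phi> \<in> test_spacetime_in a b \<Longrightarrow> \<psi> \<in> test_spacetime_in a b \<Longrightarrow> (\<lambda>z. \<phi> z - \<psi> z) \<in> test_spacetime_in a b"
  by (auto simp: test_spacetime_in_def smooth_diff)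

lemma test_spacetime_in_frechet_derivative:
  assumes \<phi>: "\<phi> \<in> test_spacetime_in a b" and h: "h \<in> Basis"
  shows "(\<lambda>z. frechet_derivative \<phi> (at z) h) \<in> test_spacetime_in a b"
  unfolding test_spacetime_in_def
proof (intro CollectI conjI allI impI)
  have sm: "smooth \<phi>" using \<phi> by (rule test_spacetime_in_smooth)
  show "smooth (\<lambda>z. frechet_derivative \<phi> (at z) h)"
    by (intro smooth_frechet_derivative sm h)
  show "frechet_derivative \<phi> (at (t, x + (2 * pi) *\<^sub>R ivec k)) h = frechet_derivative \<phi> (at (t, x)) h" for t x k
  proof -
    have "((\<lambda>z. \<phi> (z + (0, (2 * pi) *\<^sub>R ivec k))) has_derivative (\<lambda>h. frechet_derivative \<phi> (at ((t, x) + (0, (2 * pi) *\<^sub>R ivec k))) h)) (at (t, x))"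
      by (rule frechet_derivative_affine[where L="\<lambda>z. z"]) (auto intro: smooth_differentiable[OF sm])
    moreover have "(\<lambda>z. \<phi> (z + (0, (2 * pi) *\<^sub>R ivec k))) = \<phi>"
      using test_spacetime_in_periodic[OF \<phi>] by (auto simp: fun_eq_iff)
    ultimately show ?thesis
      using frechet_derivative_eqI[of \<phi> _ "(t, x)" h] by simp
  qed
  show "frechet_derivative \<phi> (at (t, x)) h = 0" if t: "t \<notin> {a..b}" for t x
  proof -
    have "((\<lambda>z. 0) has_derivative (\<lambda>h. 0)) (at (t, x))" by simp
    moreover have "open ((- {a..b}) \<times> (UNIV :: (real^3) set))" by (intro open_Times) auto
    ultimately have "(\<phi> has_derivative (\<lambda>h. 0)) (at (t, x))"
      by (rule has_derivative_transform_within_open[where s="(- {a..b}) \<times> UNIV"])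
        (use t test_spacetime_in_zero[OF \<phi>] in auto)
    then show ?thesis using frechet_derivative_eqI[of \<phi> _ "(t, x)" h] by simp
  qed
qed

lemma test_spacetime_in_iter_deriv:
  "\<phi> \<in> test_spacetime_in a b' \<Longrightarrow> set bs \<subseteq> Basis \<Longrightarrow> iter_deriv bs \<phi> \<in> test_spacetime_in a b'"
proof (induction bs)
  case (Cons b bs)
  then show ?case using test_spacetime_in_frechet_derivative[of "iter_deriv bs \<phi>" a b' b] by simp
qed simp

text \<open>A test function is only seen on the compact set \<open>[a,b] \<times> cube\<close>: it vanishes at other times and is
periodic. For the same reason \<open>y\<close> may be near any point of the lattice.\<close>

lemma test_spacetime_in_uniform:
  assumes \<phi>: "\<phi> \<in> test_spacetime_in a b" and e: "e > 0"
  shows "\<forall>\<^sub>F \<delta> in at_right 0. \<forall>t x y k. dist y ((2 * pi) *\<^sub>R ivec k) < \<delta> \<longrightarrow> norm (\<phi> (t, x + y) - \<phi> (t, x)) < e"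
proof -
  define S where "S = {x + y | x y :: real^3. x \<in> cube \<and> y \<in> cball 0 1}"
  have "compact S" unfolding S_def by (intro compact_sums) auto
  then have "compact ({a..b} \<times> S)" by (intro compact_Times) auto
  then have "uniformly_continuous_on ({a..b} \<times> S) \<phi>"
    by (intro compact_uniformly_continuous smooth_continuous_on test_spacetime_in_smooth[OF \<phi>])
  then obtain d where d: "d > 0" and D: "\<And>z w. z \<in> {a..b} \<times> S \<Longrightarrow> w \<in> {a..b} \<times> S \<Longrightarrow> dist w z < d \<Longrightarrow> dist (\<phi> w) (\<phi> z) < e"
    using e unfolding uniformly_continuous_on_def by meson
  have main: "norm (\<phi> (t, x + y) - \<phi> (t, x)) < e"
    if y: "dist y ((2 * pi) *\<^sub>R ivec k) < \<delta>" and \<delta>: "\<delta> < min d 1" for t x y k \<delta>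
  proof (cases "t \<in> {a..b}")
    case False
    then show ?thesis using test_spacetime_in_zero[OF \<phi>] e by simp
  next
    case True
    obtain l where l: "x - (2 * pi) *\<^sub>R ivec l \<in> cube" using reduce_to_cube by blast
    define x' y' where "x' = x - (2 * pi) *\<^sub>R ivec l" and "y' = y - (2 * pi) *\<^sub>R ivec k"
    have y': "norm y' < d" "norm y' < 1" using y \<delta> by (auto simp: y'_def dist_norm)
    have "x + y = (x' + y') + (2 * pi) *\<^sub>R ivec (l + k)" "x = x' + (2 * pi) *\<^sub>R ivec l"
      by (simp_all add: x'_def y'_def algebra_simps)
    then have eq: "\<phi> (t, x + y) = \<phi> (t, x' + y')" "\<phi> (t, x) = \<phi> (t, x')"
      using test_spacetime_in_periodic[OF \<phi>] by metis+
    have "x' \<in> cube" "y' \<in> cball 0 1" "(0 :: real^3) \<in> cball 0 1" using l y' by (auto simp: x'_def)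
    then have "x' + 0 \<in> S" "x' + y' \<in> S" unfolding S_def by blast+
    then have "dist (\<phi> (t, x' + y')) (\<phi> (t, x')) < e"
      using True y' by (intro D) (auto simp: dist_Pair_Pair dist_norm)
    then show ?thesis using eq by (simp add: dist_norm)
  qed
  have "\<forall>\<^sub>F \<delta> in at_right 0. \<delta> < min d 1"
    using d by (intro order_tendstoD(2)[OF tendsto_ident_at]) auto
  then show ?thesis
    by eventually_elim (use main in blast)
qed

lemma test_spacetime_in_bounded:
  assumes \<phi>: "\<phi> \<in> test_spacetime_in a b"
  shows "\<exists>B. \<forall>z. norm (\<phi> z) \<le> B"
proof -
  have "compact (\<phi> ` ({a..b} \<times> cube))"
    by (intro compact_continuous_image smooth_continuous_on test_spacetime_in_smooth[OF \<phi>] compact_Times) auto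
  then obtain B where B: "\<And>z. z \<in> {a..b} \<times> cube \<Longrightarrow> norm (\<phi> z) \<le> B"
    by (meson bounded_iff compact_imp_bounded image_eqI)
  show ?thesis
  proof (intro exI allI)
    fix z show "norm (\<phi> z) \<le> max B 0"
    proof (cases z)
      case (Pair t x)
      obtain l where l: "x - (2 * pi) *\<^sub>R ivec l \<in> cube" using reduce_to_cube by blast
      have "\<phi> (t, x) = \<phi> (t, x - (2 * pi) *\<^sub>R ivec l)"
        using test_spacetime_in_periodic[OF \<phi>, of t "x - (2 * pi) *\<^sub>R ivec l" l] by simp
      then show ?thesis
        using B[of "(t, x - (2 * pi) *\<^sub>R ivec l)"] l test_spacetime_in_zero[OF \<phi>, of t x] Pair
        by (cases "t \<in> {a..b}") auto
    qed
  qed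
qed

text \<open>The supremum in \<open>CN_norm\<close> is meaningful only for bounded functions, as test functions are.\<close>

lemma CN_norm_0_ge:
  assumes \<phi>: "\<phi> \<in> test_spacetime_in a b"
  shows "norm (\<phi> z) \<le> CN_norm 0 \<phi>"
proof -
  obtain B where B: "\<And>z. norm (\<phi> z) \<le> B" using test_spacetime_in_bounded[OF \<phi>] by blast
  have "norm (iter_deriv (fst ([], z)) \<phi> (snd ([] :: (real \<times> (real^3)) list, z))) \<le> CN_norm 0 \<phi>"
    unfolding CN_norm_def case_prod_unfold
    by (intro cSUP_upper) (auto intro!: bdd_aboveI[of _ B] B)
  then show ?thesis by simp
qed

lemma CN_norm_le:
  assumes "\<And>bs z. set bs \<subseteq> Basis \<Longrightarrow> length bs \<le> N \<Longrightarrow> norm (iter_deriv bs f z) \<le> e"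
  shows "CN_norm N f \<le> e"
  unfolding CN_norm_def
proof (rule cSUP_least)
  have "([], undefined) \<in> {bs. set bs \<subseteq> Basis \<and> length bs \<le> N} \<times> UNIV" by simp
  then show "{bs. set bs \<subseteq> Basis \<and> length bs \<le> N} \<times> UNIV \<noteq> {}" by (metis empty_iff)
qed (use assms in auto)

lemma iter_deriv_diff:
  assumes "smooth f" "smooth g" "set bs \<subseteq> Basis"
  shows "iter_deriv bs (\<lambda>z. f z - g z) = (\<lambda>z. iter_deriv bs f z - iter_deriv bs g z)"
  using assms(3)
proof (induction bs)
  case (Cons b bs)
  have s: "smooth (iter_deriv bs f)" "smooth (iter_deriv bs g)"
    using Cons assms smooth_iter_deriv by auto
  have "((\<lambda>z. iter_deriv bs f z - iter_deriv bs g z) has_derivative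
      (\<lambda>h. frechet_derivative (iter_deriv bs f) (at z) h - frechet_derivative (iter_deriv bs g) (at z) h)) (at z)" for z
    by (intro has_derivative_diff smooth_has_derivative s)
  note d = frechet_derivative_eqI[OF this]
  have "iter_deriv bs (\<lambda>z. f z - g z) = (\<lambda>z. iter_deriv bs f z - iter_deriv bs g z)"
    using Cons by simp
  then show ?case by (simp add: d)
qed simp

lemma tensor_test_spacetime_in:
  assumes "smooth \<psi>" "\<And>t. t \<notin> {a..b} \<Longrightarrow> \<psi> t = 0"
  shows "(\<lambda>(t, x). \<psi> t * wave k x) \<in> test_spacetime_in a b"
proof -
  have "smooth (\<lambda>z. (case z of (t, x) \<Rightarrow> \<psi> t) * (case z of (t, x) \<Rightarrow> wave k x))"
    by (intro smooth_mult smooth_fst smooth_snd smooth_wave assms)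
  also have "(\<lambda>z. (case z of (t, x) \<Rightarrow> \<psi> t) * (case z of (t, x) \<Rightarrow> wave k x)) = (\<lambda>(t, x). \<psi> t * wave k x)"
    by (simp add: fun_eq_iff)
  finally show ?thesis using assms(2) by (auto simp: test_spacetime_in_def)
qed

lemma tensor_test_spacetime:
  assumes "\<psi> \<in> test_time" shows "(\<lambda>(t, x). \<psi> t * wave k x) \<in> test_spacetime"
proof -
  obtain a b where "smooth \<psi>" "0 < a" "\<And>t. t \<notin> {a..b} \<Longrightarrow> \<psi> t = 0"
    using assms by (auto simp: test_time_def)
  then show ?thesis unfolding test_spacetime_def using tensor_test_spacetime_in[of \<psi> a b k] by blast
qed

text \<open>The translates \<open>\<phi> (t, x + y)\<close> integrated with weight \<open>K y\<close>, so a convolution with the reflection of \<open>K\<close>.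
With this sign, translation invariance on the torus is the only change of variables that is needed.\<close>

definition mollify :: "(real^3 \<Rightarrow> complex) \<Rightarrow> (real \<times> (real^3) \<Rightarrow> complex) \<Rightarrow> real \<times> (real^3) \<Rightarrow> complex" where
  "mollify K \<phi> z = (LINT y:cube|lborel. \<phi> (z + (0, y)) * K y)"

lemma continuous_on_mollify_integrand:
  fixes \<phi> :: "real \<times> (real^3) \<Rightarrow> complex"
  assumes "continuous_on UNIV K" "continuous_on UNIV \<phi>"
  shows "continuous_on A (\<lambda>y. \<phi> (z + (0, y)) * K y)"
proof -
  have "continuous_on UNIV (\<lambda>y. \<phi> (z + (0, y)))"
    by (rule continuous_on_compose2[OF assms(2)]) (intro continuous_intros, simp)
  then have "continuous_on UNIV (\<lambda>y. \<phi> (z + (0, y)) * K y)"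
    using assms(1) by (rule continuous_on_mult)
  then show ?thesis using continuous_on_subset by blast
qed

lemma mollify_conv_integral:
  assumes "continuous_on UNIV K" "continuous_on UNIV \<phi>"
  shows "mollify K \<phi> z = integral cube (\<lambda>y. \<phi> (z + (0, y)) * K y)"
  unfolding mollify_def
  by (rule set_borel_integral_eq_integral(2)[OF set_integrable_cube[OF continuous_on_mollify_integrand[OF assms]]])

text \<open>Differentiation under the integral sign, with the total derivative in space and time as the
integrand; all partial derivatives of \<open>\<phi>\<close> are continuous.\<close>

lemma mollify_has_derivative:
  assumes K: "continuous_on UNIV K" and \<phi>: "smooth \<phi>"
  shows "(mollify K \<phi> has_derivative (\<lambda>h. integral cube (\<lambda>y. frechet_derivative \<phi> (at (z + (0, y))) h * K y))) (at z)"
proof -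
  define D where "D x y = Blinfun (\<lambda>h. frechet_derivative \<phi> (at (x + (0, y))) h * K y)" for x :: "real \<times> (real^3)" and y
  have D: "blinfun_apply (D x y) = (\<lambda>h. frechet_derivative \<phi> (at (x + (0, y))) h * K y)" for x y
    unfolding D_def
    by (rule bounded_linear_Blinfun_apply)
      (intro bounded_linear_mult_const has_derivative_bounded_linear[OF smooth_has_derivative[OF \<phi>]])
  have cont: "continuous_on (UNIV \<times> cbox 0 (\<chi> i. 2 * pi)) (\<lambda>(x, y). D x y)"
  proof (rule continuous_on_blinfun_componentwise)
    fix b :: "real \<times> (real^3)" assume b: "b \<in> Basis"
    have "continuous_on UNIV (\<lambda>z. frechet_derivative \<phi> (at (fst z + (0, snd z))) b * K (snd z))"
      by (intro continuous_on_mult continuous_on_compose2[OF smooth_continuous_on[OF smooth_frechet_derivative[OF \<phi> b], of UNIV]]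
         continuous_on_compose2[OF K] continuous_intros) auto
    then show "continuous_on (UNIV \<times> cbox 0 (\<chi> i. 2 * pi)) (\<lambda>z. blinfun_apply (case z of (x, y) \<Rightarrow> D x y) b)"
      by (auto simp: D case_prod_unfold intro: continuous_on_subset)
  qed
  have *: "((\<lambda>x. integral (cbox 0 (\<chi> i. 2 * pi)) (\<lambda>y. \<phi> (x + (0, y)) * K y)) has_derivative
      integral (cbox 0 (\<chi> i. 2 * pi)) (D z)) (at z within UNIV)"
  proof (rule leibniz_rule)
    fix x :: "real \<times> (real^3)" and y
    have "((\<lambda>x. \<phi> (x + (0, y))) has_derivative (\<lambda>b. frechet_derivative \<phi> (at (x + (0, y))) b)) (at x)"
      using frechet_derivative_affine[OF smooth_differentiable[OF \<phi>] bounded_linear_ident] by simp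
    then show "((\<lambda>x. \<phi> (x + (0, y)) * K y) has_derivative blinfun_apply (D x y)) (at x within UNIV)"
      unfolding D by (intro has_derivative_mult_left) simp
  next
    show "(\<lambda>y. \<phi> (x + (0, y)) * K y) integrable_on cbox 0 (\<chi> i. 2 * pi)" for x
      by (intro integrable_continuous continuous_on_mollify_integrand K smooth_continuous_on \<phi>)
  next
    show "continuous_on (UNIV \<times> cbox 0 (\<chi> i. 2 * pi)) (\<lambda>(x, t). D x t)" by (rule cont)
  qed simp_all
  have int: "D z integrable_on cube"
    unfolding cube_def
    by (intro integrable_continuous continuous_on_compose2[OF cont, of _ "\<lambda>y. (z, y)", simplified] continuous_intros) auto
  have 1: "blinfun_apply (integral cube (D z)) = (\<lambda>h. integral cube (\<lambda>y. frechet_derivative \<phi> (at (z + (0, y))) h * K y))"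
    using blinfun_apply_integral[OF int] by (simp add: fun_eq_iff D)
  have 2: "mollify K \<phi> = (\<lambda>x. integral cube (\<lambda>y. \<phi> (x + (0, y)) * K y))"
    by (intro ext mollify_conv_integral K smooth_continuous_on \<phi>)
  show ?thesis
    using * unfolding 2 cube_def[symmetric] 1 by simp
qed

lemma frechet_derivative_mollify:
  assumes K: "continuous_on UNIV K" and \<phi>: "smooth \<phi>" and h: "h \<in> Basis"
  shows "frechet_derivative (mollify K \<phi>) (at z) h = mollify K (\<lambda>z. frechet_derivative \<phi> (at z) h) z"
  unfolding frechet_derivative_eqI[OF mollify_has_derivative[OF K \<phi>]]
  by (rule mollify_conv_integral[OF K smooth_continuous_on[OF smooth_frechet_derivative[OF \<phi> h]], symmetric])

lemma iter_deriv_mollify: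
  assumes K: "continuous_on UNIV K" and \<phi>: "smooth \<phi>" and bs: "set bs \<subseteq> Basis"
  shows "iter_deriv bs (mollify K \<phi>) = mollify K (iter_deriv bs \<phi>)"
  using bs
proof (induction bs)
  case (Cons b bs)
  then have bs: "set bs \<subseteq> Basis" and b: "b \<in> Basis" by auto
  show ?case
    unfolding iter_deriv.simps Cons.IH[OF bs]
    by (rule ext) (rule frechet_derivative_mollify[OF K smooth_iter_deriv[OF \<phi> bs] b])
qed simp

lemma smooth_mollify:
  assumes K: "continuous_on UNIV K" and \<phi>: "smooth \<phi>"
  shows "smooth (mollify K \<phi>)"
  unfolding smooth_def
proof (intro allI impI)
  fix bs :: "(real \<times> (real^3)) list" assume bs: "set bs \<subseteq> Basis"
  show "iter_deriv bs (mollify K \<phi>) differentiable_on UNIV"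
    unfolding iter_deriv_mollify[OF K \<phi> bs] differentiable_on_def
    using mollify_has_derivative[OF K smooth_iter_deriv[OF \<phi> bs]] differentiableI by blast
qed

lemma mollify_test_spacetime_in:
  assumes K: "continuous_on UNIV K" and \<phi>: "\<phi> \<in> test_spacetime_in a b"
  shows "mollify K \<phi> \<in> test_spacetime_in a b"
  unfolding test_spacetime_in_def
proof (intro CollectI conjI allI impI)
  show "smooth (mollify K \<phi>)" by (intro smooth_mollify K test_spacetime_in_smooth[OF \<phi>])
  have "\<phi> (t, x + (2 * pi) *\<^sub>R ivec k + y) = \<phi> (t, x + y)" for t x k y
    using test_spacetime_in_periodic[OF \<phi>, of t "x + y" k] by (simp add: ac_simps)
  then show "mollify K \<phi> (t, x + (2 * pi) *\<^sub>R ivec k) = mollify K \<phi> (t, x)" for t x k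
    by (simp add: mollify_def)
  show "mollify K \<phi> (t, x) = 0" if "t \<notin> {a..b}" for t x
    using test_spacetime_in_zero[OF \<phi> that] by (simp add: mollify_def)
qed

lemma mollify_add:
  assumes "continuous_on UNIV K" "continuous_on UNIV L" "continuous_on UNIV \<phi>"
  shows "mollify (\<lambda>y. K y + L y) \<phi> = (\<lambda>z. mollify K \<phi> z + mollify L \<phi> z)"
proof
  fix z
  have "set_integrable lborel cube (\<lambda>y. \<phi> (z + (0, y)) * K y)" "set_integrable lborel cube (\<lambda>y. \<phi> (z + (0, y)) * L y)"
    by (rule set_integrable_cube[OF continuous_on_mollify_integrand], rule assms, rule assms)+
  from set_integral_add(2)[OF this]
  show "mollify (\<lambda>y. K y + L y) \<phi> z = mollify K \<phi> z + mollify L \<phi> z"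
    by (simp add: mollify_def distrib_left)
qed

lemma mollify_cmult: "mollify (\<lambda>y. c * K y) \<phi> = (\<lambda>z. c * mollify K \<phi> z)"
proof
  fix z
  have "\<phi> (z + (0, y)) * (c * K y) = c * (\<phi> (z + (0, y)) * K y)" for y by (rule mult.left_commute)
  then show "mollify (\<lambda>y. c * K y) \<phi> z = c * mollify K \<phi> z"
    unfolding mollify_def by (simp only: set_integral_mult_right)
qed

text \<open>Mollification with a single wave separates the variables: substituting \<open>y - x\<close> for \<open>y\<close> moves the dependence on \<open>x\<close>
into the wave.\<close>

lemma mollify_wave:
  assumes \<phi>: "\<phi> \<in> test_spacetime_in a b"
  shows "mollify (wave k) \<phi> (t, x) = mollify (wave k) \<phi> (t, 0) * wave (- k) x"
proof -
  have sm: "smooth \<phi>" using \<phi> by (rule test_spacetime_in_smooth)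
  have c: "continuous_on UNIV (\<lambda>y. \<phi> (t, y) * wave k y)"
    by (intro continuous_on_mult continuous_on_compose2[OF smooth_continuous_on[OF sm]] continuous_intros) auto
  have "wave k (y + x) * wave (- k) x = wave k y" for y
    using wave_add_freq[of k "-k" x] by (simp add: wave_add_point)
  then have "mollify (wave k) \<phi> (t, x) = (LINT y:cube|lborel. (\<phi> (t, y + x) * wave k (y + x)) * wave (- k) x)"
    unfolding mollify_def by (simp add: add.commute[of _ x] mult.assoc)
  also have "\<dots> = (LINT y:cube|lborel. \<phi> (t, y + x) * wave k (y + x)) * wave (- k) x"
    by simp
  also have "(LINT y:cube|lborel. \<phi> (t, y + x) * wave k (y + x)) = (LINT y:cube|lborel. \<phi> (t, y) * wave k y)"
    by (rule integral_cube_translate[OF _ c]) (simp add: periodic_def test_spacetime_in_periodic[OF \<phi>])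
  finally show ?thesis by (simp add: mollify_def)
qed

section \<open>Trigonometric kernels, and density of separated test functions\<close>

inductive trig_poly :: "(real^3 \<Rightarrow> complex) \<Rightarrow> bool" where
  wave: "trig_poly (wave k)"
| add: "trig_poly f \<Longrightarrow> trig_poly g \<Longrightarrow> trig_poly (\<lambda>x. f x + g x)"
| cmult: "trig_poly f \<Longrightarrow> trig_poly (\<lambda>x. c * f x)"

lemma trig_poly_continuous: "trig_poly f \<Longrightarrow> continuous_on UNIV f"
  by (induction rule: trig_poly.induct) (auto intro!: continuous_intros continuous_on_wave[of _ "\<lambda>x. x"])

lemma trig_poly_const: "trig_poly (\<lambda>x. c)"
  using trig_poly.cmult[OF trig_poly.wave[of 0], of c] by simp

lemma trig_poly_mult:
  assumes f: "trig_poly f" and g: "trig_poly g" shows "trig_poly (\<lambda>x. f x * g x)"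
  using f
proof induction
  case (wave k)
  show ?case using g
  proof induction
    case (wave l) then show ?case using trig_poly.wave[of "k + l"] by (simp add: wave_add_freq[abs_def])
  next
    case (add f g) then show ?case using trig_poly.add by (simp add: distrib_left)
  next
    case (cmult f c) then show ?case using trig_poly.cmult[of "\<lambda>x. wave k x * f x" c] by (simp add: mult.left_commute)
  qed
next
  case (add f g) then show ?case using trig_poly.add by (simp add: distrib_right)
next
  case (cmult f c) then show ?case using trig_poly.cmult by (simp add: mult.assoc)
qed

lemma trig_poly_power: "trig_poly f \<Longrightarrow> trig_poly (\<lambda>x. f x ^ n)"
  by (induction n) (auto intro: trig_poly_const trig_poly_mult)

lemma trig_poly_sum: "(\<And>i. i \<in> I \<Longrightarrow> trig_poly (f i)) \<Longrightarrow> trig_poly (\<lambda>x. \<Sum>i\<in>I. f i x)"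
  by (induction I rule: infinite_finite_induct) (auto intro: trig_poly_const trig_poly.add)

text \<open>A trigonometric polynomial with values in \<open>[0,1]\<close> that equals \<open>1\<close> at the points of the lattice and nowhere
else; its powers, once normalised, concentrate at the lattice.\<close>

definition peak :: "real^3 \<Rightarrow> real" where
  "peak y = (3 + (\<Sum>j\<in>UNIV. cos (y $ j))) / 6"

lemma trig_poly_peak: "trig_poly (\<lambda>y. of_real (peak y))"
proof -
  have "ivec (axis j 1) \<bullet> y = y $ j" for j y
    by (simp add: ivec_def inner_vec_def axis_def if_distrib if_distribR cong: if_cong)
  then have "(wave (axis j 1) y + wave (- axis j 1) y) / 2 = of_real (cos (y $ j))" for j y
    by (simp add: wave_def complex_eq_iff)
  then have "complex_of_real (peak y) = (1/6) * (3 + (\<Sum>j\<in>UNIV. (1/2) * (wave (axis j 1) y + wave (- axis j 1) y)))" for y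
    by (simp add: peak_def)
  moreover have "trig_poly (\<lambda>y. (1/6) * (3 + (\<Sum>j\<in>UNIV. (1/2) * (wave (axis j 1) y + wave (- axis j 1) y))))"
    by (intro trig_poly.cmult trig_poly.add trig_poly_const trig_poly_sum trig_poly.wave)
  ultimately show ?thesis by presburger
qed

lemma continuous_on_peak: "continuous_on A peak"
  unfolding peak_def[abs_def] by (intro continuous_intros) auto

lemma peak_bounds: "0 \<le> peak y" "peak y \<le> 1"
proof -
  have "\<bar>a\<bar> \<le> 1 \<Longrightarrow> \<bar>b\<bar> \<le> 1 \<Longrightarrow> \<bar>c\<bar> \<le> 1 \<Longrightarrow> 0 \<le> (3 + (a + b + c)) / 6 \<and> (3 + (a + b + c)) / 6 \<le> 1"
    for a b c :: real by (auto simp: abs_le_iff)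
  from this[OF abs_cos_le_one abs_cos_le_one abs_cos_le_one]
  show "0 \<le> peak y" "peak y \<le> 1" unfolding peak_def sum_3 by blast+
qed

lemma peak_less_1:
  assumes "\<And>k. y \<noteq> (2 * pi) *\<^sub>R ivec k" shows "peak y < 1"
proof (rule ccontr)
  assume 1: "\<not> peak y < 1"
  have "a \<le> 1 \<Longrightarrow> b \<le> 1 \<Longrightarrow> c \<le> 1 \<Longrightarrow> \<not> (3 + (a + b + c)) / 6 < 1 \<Longrightarrow> a = 1 \<and> b = 1 \<and> c = 1"
    for a b c :: real by (simp add: not_less)
  from this[OF cos_le_one cos_le_one cos_le_one 1[unfolded peak_def sum_3]]
  have "cos (y $ 1) = 1 \<and> cos (y $ 2) = 1 \<and> cos (y $ 3) = 1" .
  then have "\<forall>j. \<exists>n::int. y $ j = n * 2 * pi" by (simp add: forall_3 cos_one_2pi_int)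
  from choice[OF this] obtain n :: "3 \<Rightarrow> int" where "\<forall>j. y $ j = of_int (n j) * 2 * pi" ..
  then have "y = (2 * pi) *\<^sub>R ivec (\<chi> j. n j)" by (simp add: vec_eq_iff ivec_def)
  then show False using assms by blast
qed

definition far :: "real \<Rightarrow> (real^3) set" where
  "far \<delta> = {y \<in> cube. \<forall>k. \<delta> \<le> dist y ((2 * pi) *\<^sub>R ivec k)}"

lemma compact_far: "compact (far \<delta>)"
proof -
  have "far \<delta> = cube \<inter> (\<Inter>k. {y. \<delta> \<le> dist y ((2 * pi) *\<^sub>R ivec k)})"
    by (auto simp: far_def)
  then show ?thesis
    by (auto intro!: compact_Int_closed closed_INT closed_Collect_le continuous_intros)
qed

lemma integrable_on_cube_real:
  fixes f :: "real^3 \<Rightarrow> real"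
  assumes "continuous_on UNIV f" "compact S" shows "set_integrable lborel S f"
  unfolding set_integrable_def by (rule borel_integrable_compact) (auto intro: assms continuous_on_subset)

text \<open>On \<open>far \<delta>\<close> the function \<open>peak\<close> is at most some \<open>r < 1\<close>, while on a small cube \<open>W\<close> at the origin it is at least
some \<open>r' > r\<close>. Therefore \<open>peak y ^ n\<close> has integral at least \<open>measure W * r' ^ n\<close>, and the share of \<open>far \<delta>\<close> in it
decays like \<open>(r / r') ^ n\<close>.\<close>

lemma kernel_exists:
  assumes \<delta>: "\<delta> > 0" and e: "e > 0"
  shows "\<exists>\<kappa>. trig_poly (\<lambda>y. of_real (\<kappa> y)) \<and> continuous_on UNIV \<kappa> \<and> (\<forall>y. 0 \<le> \<kappa> y) \<and>
     (LINT y:cube|lborel. \<kappa> y) = 1 \<and> (LINT y:far \<delta>|lborel. \<kappa> y) \<le> e"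
proof -
  define V where "V = measure lborel cube"
  obtain r where r: "0 \<le> r" "r < 1" "\<And>y. y \<in> far \<delta> \<Longrightarrow> peak y \<le> r"
  proof (cases "far \<delta> = {}")
    case True then show ?thesis using that[of 0] by simp
  next
    case False
    obtain y where y: "y \<in> far \<delta>" "\<And>x. x \<in> far \<delta> \<Longrightarrow> peak x \<le> peak y"
      using continuous_attains_sup[OF compact_far False continuous_on_peak] by blast
    have "y \<noteq> (2 * pi) *\<^sub>R ivec k" for k using y(1) \<delta> by (auto simp: far_def dest!: spec[of _ k])
    then show ?thesis using that[of "peak y"] y peak_less_1 peak_bounds by blast
  qed
  \<comment> \<open>Any number strictly between \<open>r\<close> and \<open>1\<close> works.\<close>
  define r' where "r' = (1 + r) / 2"
  have r': "r < r'" "r' < 1" "0 < r'" using r by (auto simp: r'_def)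
  have "peak 0 = 1" by (simp add: peak_def)
  moreover have "continuous (at 0) peak" using continuous_on_peak[of UNIV] by (simp add: continuous_on_eq_continuous_at)
  ultimately obtain \<eta> where \<eta>: "\<eta> > 0" "\<And>y. dist y 0 < \<eta> \<Longrightarrow> dist (peak y) 1 < 1 - r'"
    unfolding continuous_at_eps_delta using r' by (metis diff_gt_0_iff_gt)
  \<comment> \<open>The \<open>l\<^sup>1\<close> norm on \<open>W\<close> is at most \<open>3 s\<close>, which is less than \<open>\<eta>\<close>.\<close>
  define s where "s = min (\<eta> / 4) 1"
  define W where "W = cbox (0::real^3) (\<chi> i. s)"
  have s: "0 < s" "s \<le> 1" using \<eta> by (auto simp: s_def)
  have W: "W \<subseteq> cube" "\<And>y. y \<in> W \<Longrightarrow> r' \<le> peak y"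
  proof -
    show "W \<subseteq> cube" using s pi_gt3 by (fastforce simp: W_def cube_def mem_box_cart intro: order_trans)
    fix y assume y: "y \<in> W"
    have "norm y \<le> (\<Sum>i\<in>UNIV. \<bar>y $ i\<bar>)" by (rule norm_le_l1_cart)
    also have "\<dots> \<le> (\<Sum>i\<in>(UNIV::3 set). s)" using y by (intro sum_mono) (auto simp: W_def mem_box_cart)
    also have "\<dots> < \<eta>" using \<eta> by (simp add: s_def)
    finally have "dist y 0 < \<eta>" by simp
    from \<eta>(2)[OF this] show "r' \<le> peak y" by (auto simp: dist_real_def)
  qed
  define m where "m = measure lborel W"
  have m: "m > 0"
    using s by (simp add: m_def W_def content_cbox_cart interval_eq_empty_cart not_less)
  define I where "I n = (LINT y:cube|lborel. peak y ^ n)" for n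
  have cont: "continuous_on UNIV (\<lambda>y. peak y ^ n)" for n by (intro continuous_intros continuous_on_peak)
  have const: "(LINT y:S|lborel. (c::real)) = measure lborel S * c" if "compact S" for S :: "(real^3) set" and c
    using that emeasure_compact_finite[OF that] by (simp add: set_lebesgue_integral_def)
  have Ige: "m * r' ^ n \<le> I n" for n
  proof -
    have "compact W" by (simp add: W_def)
    have "m * r' ^ n = (LINT y:W|lborel. r' ^ n)" using const[of W] by (simp add: m_def W_def)
    also have "\<dots> \<le> (LINT y:W|lborel. peak y ^ n)"
      using W(2) r' by (intro set_integral_mono integrable_on_cube_real cont) (auto simp: W_def intro!: power_mono)
    also have "\<dots> \<le> I n"
      unfolding I_def set_lebesgue_integral_def
    proof (rule integral_mono)
      show "integrable lborel (\<lambda>y. indicat_real W y *\<^sub>R peak y ^ n)" "integrable lborel (\<lambda>y. indicat_real cube y *\<^sub>R peak y ^ n)"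
        using integrable_on_cube_real[OF cont] \<open>compact W\<close> compact_cube by (auto simp: set_integrable_def)
    qed (use W(1) peak_bounds in \<open>auto simp: indicator_def\<close>)
    finally show ?thesis .
  qed
  have Ipos: "I n > 0" for n using Ige[of n] m r' by (smt (verit) mult_pos_pos zero_less_power)
  have far_le: "(LINT y:far \<delta>|lborel. peak y ^ n) \<le> V * r ^ n" for n
  proof -
    have "(LINT y:far \<delta>|lborel. peak y ^ n) \<le> (LINT y:far \<delta>|lborel. r ^ n)"
      using r peak_bounds by (intro set_integral_mono integrable_on_cube_real cont compact_far) (auto intro!: power_mono)
    also have "\<dots> = measure lborel (far \<delta>) * r ^ n" by (rule const[OF compact_far])
    also have "\<dots> \<le> V * r ^ n"
      unfolding V_def using r emeasure_cube_finite compact_far[of \<delta>]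
      by (intro mult_right_mono measure_mono_fmeasurable) (auto simp: far_def fmeasurable_def compact_imp_closed)
    finally show ?thesis .
  qed
  have "(\<lambda>n. (V / m) * (r / r') ^ n) \<longlonglongrightarrow> (V / m) * 0"
    using r r' by (intro tendsto_intros LIMSEQ_realpow_zero) auto
  then have "\<forall>\<^sub>F n in sequentially. (V / m) * (r / r') ^ n < e"
    using e by (intro order_tendstoD(2)) auto
  then obtain n where n: "(V / m) * (r / r') ^ n < e" by (auto simp: eventually_sequentially)
  have "(LINT y:far \<delta>|lborel. peak y ^ n) / I n \<le> (V * r ^ n) / (m * r' ^ n)"
    using far_le[of n] Ige[of n] m r' r by (intro frac_le) (auto simp: V_def)
  also have "\<dots> = (V / m) * (r / r') ^ n" by (simp add: power_divide)
  finally have *: "(LINT y:far \<delta>|lborel. peak y ^ n) / I n \<le> e" using n by simp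
  define \<kappa> where "\<kappa> y = peak y ^ n / I n" for y
  have "trig_poly (\<lambda>y. of_real (1 / I n) * of_real (peak y) ^ n)"
    by (intro trig_poly.cmult trig_poly_power trig_poly_peak)
  then have "trig_poly (\<lambda>y. of_real (\<kappa> y))" by (simp add: \<kappa>_def)
  moreover have "continuous_on UNIV \<kappa>"
    unfolding \<kappa>_def[abs_def] using Ipos[of n] by (intro continuous_intros cont) auto
  moreover have "0 \<le> \<kappa> y" for y using peak_bounds[of y] Ipos[of n] by (simp add: \<kappa>_def)
  moreover have "(LINT y:cube|lborel. \<kappa> y) = 1" using Ipos[of n] by (simp add: \<kappa>_def I_def)
  moreover have "(LINT y:far \<delta>|lborel. \<kappa> y) \<le> e" using * by (simp add: \<kappa>_def)
  ultimately show ?thesis by blast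
qed

text \<open>Near the lattice the translates of \<open>\<phi>\<close> differ from \<open>\<phi>\<close> by less than \<open>e\<close>; far from it the kernel has small mass.\<close>

lemma mollify_approx:
  assumes \<phi>: "\<phi> \<in> test_spacetime_in a b" and B: "\<And>z. norm (\<phi> z) \<le> B"
    and e0: "0 \<le> e" and near: "\<And>t x y k. dist y ((2 * pi) *\<^sub>R ivec k) < \<delta> \<Longrightarrow> norm (\<phi> (t, x + y) - \<phi> (t, x)) < e"
    and \<kappa>: "continuous_on UNIV \<kappa>" "\<And>y. 0 \<le> \<kappa> y"
     "(LINT y:cube|lborel. \<kappa> y) = 1" "(LINT y:far \<delta>|lborel. \<kappa> y) \<le> e'"
  shows "norm (mollify (\<lambda>y. of_real (\<kappa> y)) \<phi> z - \<phi> z) \<le> e + 2 * B * e'"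
proof -
  obtain t x where z: "z = (t, x)" by (cases z)
  have sm: "continuous_on UNIV \<phi>" by (intro smooth_continuous_on test_spacetime_in_smooth[OF \<phi>])
  have ck: "continuous_on UNIV (\<lambda>y. complex_of_real (\<kappa> y))" by (intro continuous_intros \<kappa>)
  have ci: "continuous_on UNIV (\<lambda>y. \<phi> (z + (0, y)) * of_real (\<kappa> y))"
    by (rule continuous_on_mollify_integrand[OF ck sm])
  have cd: "continuous_on UNIV (\<lambda>y. \<phi> (z + (0, y)) * of_real (\<kappa> y) - \<phi> z * of_real (\<kappa> y))"
    by (intro continuous_on_diff ci continuous_on_mult continuous_on_const ck)
  have i1: "set_integrable lborel cube (\<lambda>y. \<phi> (z + (0, y)) * of_real (\<kappa> y))"
    and i2: "set_integrable lborel cube (\<lambda>y. \<phi> z * of_real (\<kappa> y))"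
    and i3: "set_integrable lborel cube (\<lambda>y. \<phi> (z + (0, y)) * of_real (\<kappa> y) - \<phi> z * of_real (\<kappa> y))"
    by (intro set_integrable_cube continuous_on_subset[OF ci] continuous_on_subset[OF cd] subset_UNIV
       continuous_on_mult continuous_on_const continuous_on_subset[OF ck])+
  have j: "set_integrable lborel cube \<kappa>" "set_integrable lborel (far \<delta>) \<kappa>"
    by (intro integrable_on_cube_real \<kappa>(1) compact_cube compact_far)+
  have B0: "0 \<le> B" using B norm_ge_zero order_trans by blast
  have sl: "(LINT y:cube|lborel. complex_of_real (\<kappa> y)) = of_real (LINT y:cube|lborel. \<kappa> y)"
    by (rule set_integral_complex_of_real)
  have "(LINT y:cube|lborel. \<phi> z * of_real (\<kappa> y)) = \<phi> z * (LINT y:cube|lborel. complex_of_real (\<kappa> y))"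
    by (rule set_integral_mult_right)
  then have "mollify (\<lambda>y. of_real (\<kappa> y)) \<phi> z - \<phi> z =
     (LINT y:cube|lborel. \<phi> (z + (0, y)) * of_real (\<kappa> y)) - (LINT y:cube|lborel. \<phi> z * of_real (\<kappa> y))"
    by (simp only: sl \<kappa>(3) mollify_def of_real_1 mult_1_right)
  also have "\<dots> = (LINT y:cube|lborel. \<phi> (z + (0, y)) * of_real (\<kappa> y) - \<phi> z * of_real (\<kappa> y))"
    by (rule set_integral_diff(2)[OF i1 i2, symmetric])
  also have "norm \<dots> \<le> (LINT y:cube|lborel. norm (\<phi> (z + (0, y)) * of_real (\<kappa> y) - \<phi> z * of_real (\<kappa> y)))"
    by (rule set_integral_norm_bound[OF i3])
  also have "\<dots> \<le> (LINT y|lborel. e * (indicator cube y *\<^sub>R \<kappa> y) + 2 * B * (indicator (far \<delta>) y *\<^sub>R \<kappa> y))"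
    unfolding set_lebesgue_integral_def
  proof (rule integral_mono)
    show "integrable lborel (\<lambda>y. indicat_real cube y *\<^sub>R norm (\<phi> (z + (0, y)) * of_real (\<kappa> y) - \<phi> z * of_real (\<kappa> y)))"
      using integrable_norm[OF i3[unfolded set_integrable_def]] by simp
    show "integrable lborel (\<lambda>y. e * (indicat_real cube y *\<^sub>R \<kappa> y) + 2 * B * (indicat_real (far \<delta>) y *\<^sub>R \<kappa> y))"
      by (intro Bochner_Integration.integrable_add integrable_mult_right j[unfolded set_integrable_def])
    fix y
    show "indicat_real cube y *\<^sub>R norm (\<phi> (z + (0, y)) * of_real (\<kappa> y) - \<phi> z * of_real (\<kappa> y)) \<le>
      e * (indicat_real cube y *\<^sub>R \<kappa> y) + 2 * B * (indicat_real (far \<delta>) y *\<^sub>R \<kappa> y)"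
    proof (cases "y \<in> cube")
      case False
      then show ?thesis by (simp add: far_def)
    next
      case True
      have eq: "norm (\<phi> (z + (0, y)) * of_real (\<kappa> y) - \<phi> z * of_real (\<kappa> y)) = norm (\<phi> (t, x + y) - \<phi> (t, x)) * \<kappa> y"
        using \<kappa>(2)[of y] by (simp add: z norm_mult flip: left_diff_distrib)
      show ?thesis
      proof (cases "y \<in> far \<delta>")
        case True
        have "norm (\<phi> (t, x + y) - \<phi> (t, x)) \<le> e + 2 * B"
          using norm_triangle_ineq4[of "\<phi> (t, x + y)" "\<phi> (t, x)"] B[of "(t, x + y)"] B[of "(t, x)"] e0 by simp
        from mult_right_mono[OF this \<kappa>(2)[of y]] show ?thesis
          using True \<open>y \<in> cube\<close> by (simp add: eq distrib_right)
      next
        case False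
        then obtain k where "dist y ((2 * pi) *\<^sub>R ivec k) < \<delta>" using True by (auto simp: far_def not_le)
        from mult_right_mono[OF less_imp_le[OF near[OF this, of t x]] \<kappa>(2)[of y]] show ?thesis
          using True False by (simp add: eq)
      qed
    qed
  qed
  also have "\<dots> = e * (LINT y:cube|lborel. \<kappa> y) + 2 * B * (LINT y:far \<delta>|lborel. \<kappa> y)"
    unfolding set_lebesgue_integral_def
    using j[unfolded set_integrable_def]
    by (subst Bochner_Integration.integral_add) (auto intro!: integrable_mult_right)
  also have "\<dots> \<le> e + 2 * B * e'"
    using \<kappa> B0 by (simp add: mult_left_mono)
  finally show ?thesis .
qed

lemma CN_norm_nonneg:
  assumes "\<And>bs z. set bs \<subseteq> Basis \<Longrightarrow> length bs \<le> N \<Longrightarrow> norm (iter_deriv bs f z) \<le> e"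
  shows "0 \<le> CN_norm N f"
proof -
  let ?S = "(\<lambda>(bs, x). norm (iter_deriv bs f x)) ` ({bs. set bs \<subseteq> Basis \<and> length bs \<le> N} \<times> UNIV)"
  have "norm (f undefined) \<in> ?S" by (rule image_eqI[of _ _ "([], undefined)"]) auto
  moreover have "bdd_above ?S" by (auto intro!: bdd_aboveI[of _ e] assms)
  ultimately have "norm (f undefined) \<le> CN_norm N f" unfolding CN_norm_def by (rule cSup_upper)
  then show ?thesis using norm_ge_zero order_trans by blast
qed

text \<open>Mollification commutes with derivatives, so approximating finitely many derivatives uniformly with
the same kernel approximates the function in \<open>C\<^sup>N\<close>.\<close>

lemma mollify_approx_iter_deriv:
  assumes \<phi>: "\<phi> \<in> test_spacetime_in a b" and e: "e > 0"
  shows "\<exists>K. trig_poly K \<and> (\<forall>M\<le>N. \<bar>CN_norm M (\<lambda>z. mollify K \<phi> z - \<phi> z)\<bar> \<le> e)"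
proof -
  define BS where "BS = {bs :: (real \<times> (real^3)) list. set bs \<subseteq> Basis \<and> length bs \<le> N}"
  have fin: "finite BS" unfolding BS_def by (intro finite_lists_length_le) auto
  have d: "iter_deriv bs \<phi> \<in> test_spacetime_in a b" if "bs \<in> BS" for bs
    using that test_spacetime_in_iter_deriv[OF \<phi>] by (auto simp: BS_def)
  have "\<forall>\<^sub>F \<delta> in at_right 0. \<forall>bs\<in>BS. \<forall>t x y k. dist y ((2 * pi) *\<^sub>R ivec k) < \<delta> \<longrightarrow> norm (iter_deriv bs \<phi> (t, x + y) - iter_deriv bs \<phi> (t, x)) < e / 2"
    using fin e by (intro eventually_ball_finite ballI test_spacetime_in_uniform[OF d]) auto
  moreover have "\<forall>\<^sub>F \<delta> in at_right 0. (0::real) < \<delta>" by (rule eventually_at_right_less)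
  ultimately have "\<forall>\<^sub>F \<delta> in at_right 0. 0 < \<delta> \<and> (\<forall>bs\<in>BS. \<forall>t x y k. dist y ((2 * pi) *\<^sub>R ivec k) < \<delta> \<longrightarrow> norm (iter_deriv bs \<phi> (t, x + y) - iter_deriv bs \<phi> (t, x)) < e / 2)"
    by eventually_elim blast
  from eventually_happens'[OF trivial_limit_at_right_real this] obtain \<delta> where \<delta>: "0 < \<delta>"
    and near': "\<forall>bs\<in>BS. \<forall>t x y k. dist y ((2 * pi) *\<^sub>R ivec k) < \<delta> \<longrightarrow> norm (iter_deriv bs \<phi> (t, x + y) - iter_deriv bs \<phi> (t, x)) < e / 2"
    by (elim exE conjE)
  have near: "norm (iter_deriv bs \<phi> (t, x + y) - iter_deriv bs \<phi> (t, x)) < e / 2"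
    if "bs \<in> BS" "dist y ((2 * pi) *\<^sub>R ivec k) < \<delta>" for bs t x y k
    using near'[rule_format, OF that] .
  have "\<exists>B. \<forall>bs\<in>BS. \<forall>z. norm (iter_deriv bs \<phi> z) \<le> B bs"
    by (rule bchoice) (intro ballI test_spacetime_in_bounded[OF d])
  then obtain B' where B'': "\<forall>bs\<in>BS. \<forall>z. norm (iter_deriv bs \<phi> z) \<le> B' bs" ..
  have B': "norm (iter_deriv bs \<phi> z) \<le> B' bs" if "bs \<in> BS" for bs z using B'' that by blast
  define B where "B = 1 + (\<Sum>bs\<in>BS. B' bs)"
  have B'0: "0 \<le> B' bs" if "bs \<in> BS" for bs using B'[OF that] norm_ge_zero order_trans by blast
  have B: "norm (iter_deriv bs \<phi> z) \<le> B" if "bs \<in> BS" for bs z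
  proof -
    have "B' bs \<le> (\<Sum>bs\<in>BS. B' bs)" by (rule member_le_sum) (use that B'0 fin in auto)
    then show ?thesis using B'[OF that, of z] by (simp add: B_def)
  qed
  have Bpos: "0 < B" using sum_nonneg[of BS B'] B'0 by (auto simp: B_def add_pos_nonneg)
  obtain \<kappa> where \<kappa>: "trig_poly (\<lambda>y. of_real (\<kappa> y))" "continuous_on UNIV \<kappa>" "\<And>y. 0 \<le> \<kappa> y"
     "(LINT y:cube|lborel. \<kappa> y) = 1" "(LINT y:far \<delta>|lborel. \<kappa> y) \<le> e / (4 * B)"
    using kernel_exists[OF \<delta>, of "e / (4 * B)"] e Bpos by auto
  let ?K = "\<lambda>y. complex_of_real (\<kappa> y)"
  have K: "continuous_on UNIV ?K" by (rule trig_poly_continuous[OF \<kappa>(1)])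
  have sm: "smooth \<phi>" "smooth (mollify ?K \<phi>)" using test_spacetime_in_smooth[OF \<phi>] smooth_mollify[OF K] by auto
  have bd: "norm (iter_deriv bs (\<lambda>z. mollify ?K \<phi> z - \<phi> z) z) \<le> e"
    if bs: "set bs \<subseteq> (Basis :: (real \<times> (real^3)) set)" "length bs \<le> N" for bs z
  proof -
    have BS: "bs \<in> BS" using bs by (simp add: BS_def)
    have "norm (mollify ?K (iter_deriv bs \<phi>) z - iter_deriv bs \<phi> z) \<le> e / 2 + 2 * B * (e / (4 * B))"
      by (rule mollify_approx[OF d[OF BS] B[OF BS] _ near[OF BS] \<kappa>(2-5)]) (use e in auto)
    also have "\<dots> = e" using Bpos by simp
    finally show ?thesis
      by (simp only: iter_deriv_diff[OF sm(2,1) bs(1)] iter_deriv_mollify[OF K sm(1) bs(1)])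
  qed
  have "\<bar>CN_norm M (\<lambda>z. mollify ?K \<phi> z - \<phi> z)\<bar> \<le> e" if "M \<le> N" for M
    using CN_norm_le[of M "\<lambda>z. mollify ?K \<phi> z - \<phi> z" e] CN_norm_nonneg[of M "\<lambda>z. mollify ?K \<phi> z - \<phi> z" e] bd that
    by (simp add: order_trans)
  then show ?thesis using \<kappa>(1) by blast
qed

lemma distr_spacetime_diff:
  assumes u: "u \<in> distr_spacetime" and "\<phi> \<in> test_spacetime" "\<psi> \<in> test_spacetime"
  shows "u (\<lambda>z. \<phi> z - \<psi> z) = u \<phi> - u \<psi>"
proof -
  obtain a b where \<psi>: "0 < a" "\<psi> \<in> test_spacetime_in a b" using assms(3) by (auto simp: test_spacetime_def)
  have "(\<lambda>z. (-1) * \<psi> z) \<in> test_spacetime"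
    unfolding test_spacetime_def using test_spacetime_in_cmult[OF \<psi>(2), of "-1"] \<psi>(1) by blast
  then have "u (\<lambda>z. \<phi> z + (-1) * \<psi> z) = u \<phi> + u (\<lambda>z. (-1) * \<psi> z)"
    using assms by (simp only: distr_spacetime_def linear_functional_on_def mem_Collect_eq)
  also have "u (\<lambda>z. (-1) * \<psi> z) = (-1) * u \<psi>"
    using assms by (simp only: distr_spacetime_def linear_functional_on_def mem_Collect_eq)
  finally show ?thesis by simp
qed

text \<open>By \<open>mollify_wave\<close> the two distributions agree on mollifications with trigonometric polynomials, and these
approximate every test function in the norms with respect to which both are continuous.\<close>

lemma distr_spacetime_eqI:
  assumes u: "u \<in> distr_spacetime" and v: "v \<in> distr_spacetime"
    and eq: "\<And>\<psi> k. \<psi> \<in> test_time \<Longrightarrow> u (\<lambda>(t, x). \<psi> t * wave k x) = v (\<lambda>(t, x). \<psi> t * wave k x)"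
  shows "u = v"
proof
  fix \<phi>
  show "u \<phi> = v \<phi>"
  proof (cases "\<phi> \<in> test_spacetime")
    case False
    then show ?thesis using u v by (auto simp: distr_spacetime_def linear_functional_on_def)
  next
    case True
    then obtain a b where a: "0 < a" and \<phi>: "\<phi> \<in> test_spacetime_in a b" by (auto simp: test_spacetime_def)
    have sub: "\<psi> \<in> test_spacetime" if "\<psi> \<in> test_spacetime_in a b" for \<psi>
      using a that unfolding test_spacetime_def by blast
    have lin: "linear_functional_on test_spacetime u" "linear_functional_on test_spacetime v"
      using u v by (auto simp: distr_spacetime_def)
    have add_u: "u (\<lambda>z. f z + g z) = u f + u g" and add_v: "v (\<lambda>z. f z + g z) = v f + v g"
      if "f \<in> test_spacetime_in a b" "g \<in> test_spacetime_in a b" for f g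
      using lin sub[OF that(1)] sub[OF that(2)] unfolding linear_functional_on_def by blast+
    have cm_u: "u (\<lambda>z. c * f z) = c * u f" and cm_v: "v (\<lambda>z. c * f z) = c * v f"
      if "f \<in> test_spacetime_in a b" for f c
      using lin sub[OF that(1)] unfolding linear_functional_on_def by blast+
    have agree: "u (mollify K \<phi>) = v (mollify K \<phi>)" if "trig_poly K" for K
      using that
    proof induction
      case (wave k)
      define \<psi> where "\<psi> t = mollify (wave k) \<phi> (t, 0)" for t
      have m: "mollify (wave k) \<phi> \<in> test_spacetime_in a b"
        by (intro mollify_test_spacetime_in \<phi> trig_poly_continuous trig_poly.wave)
      have "smooth \<psi>" unfolding \<psi>_def[abs_def] by (intro smooth_Pair test_spacetime_in_smooth[OF m])
      moreover have "\<psi> t = 0" if "t \<notin> {a..b}" for t unfolding \<psi>_def by (rule test_spacetime_in_zero[OF m that])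
      ultimately have "\<psi> \<in> test_time" unfolding test_time_def using a by blast
      moreover have "mollify (wave k) \<phi> = (\<lambda>(t, x). \<psi> t * wave (- k) x)"
      proof
        fix z :: "real \<times> (real^3)"
        obtain t x where "z = (t, x)" by (cases z)
        then show "mollify (wave k) \<phi> z = (case z of (t, x) \<Rightarrow> \<psi> t * wave (- k) x)"
          using mollify_wave[OF \<phi>, of k t x] by (simp only: \<psi>_def prod.case)
      qed
      ultimately show ?case using eq by simp
    next
      case (add f g)
      have "mollify f \<phi> \<in> test_spacetime_in a b" "mollify g \<phi> \<in> test_spacetime_in a b"
        by (intro mollify_test_spacetime_in \<phi> trig_poly_continuous add)+
      moreover have "mollify (\<lambda>y. f y + g y) \<phi> = (\<lambda>z. mollify f \<phi> z + mollify g \<phi> z)"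
        by (intro mollify_add trig_poly_continuous add smooth_continuous_on test_spacetime_in_smooth[OF \<phi>])
      ultimately show ?case using add.IH add_u add_v by (simp only:)
    next
      case (cmult f c)
      have "mollify f \<phi> \<in> test_spacetime_in a b"
        by (intro mollify_test_spacetime_in \<phi> trig_poly_continuous cmult)
      then show ?case using cmult.IH cm_u cm_v by (simp only: mollify_cmult)
    qed
    obtain C N C' N' where C: "\<And>\<psi>. \<psi> \<in> test_spacetime_in a b \<Longrightarrow> norm (u \<psi>) \<le> C * CN_norm N \<psi>"
      and C': "\<And>\<psi>. \<psi> \<in> test_spacetime_in a b \<Longrightarrow> norm (v \<psi>) \<le> C' * CN_norm N' \<psi>"
      using u v a unfolding distr_spacetime_def mem_Collect_eq by metis
    have small: "norm (u \<phi> - v \<phi>) \<le> e" if e: "e > 0" for e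
    proof -
      have c: "0 < \<bar>C\<bar> + \<bar>C'\<bar> + 1" by simp
      obtain K where K: "trig_poly K"
        and CN: "\<And>M. M \<le> max N N' \<Longrightarrow> \<bar>CN_norm M (\<lambda>z. mollify K \<phi> z - \<phi> z)\<bar> \<le> e / (\<bar>C\<bar> + \<bar>C'\<bar> + 1)"
        using mollify_approx_iter_deriv[OF \<phi>, of "e / (\<bar>C\<bar> + \<bar>C'\<bar> + 1)" "max N N'"] e c by (metis divide_pos_pos)
      let ?m = "mollify K \<phi>"
      have m: "?m \<in> test_spacetime_in a b" by (intro mollify_test_spacetime_in \<phi> trig_poly_continuous K)
      have d: "(\<lambda>z. ?m z - \<phi> z) \<in> test_spacetime_in a b" by (rule test_spacetime_in_diff[OF m \<phi>])
      have "u \<phi> - v \<phi> = v (\<lambda>z. ?m z - \<phi> z) - u (\<lambda>z. ?m z - \<phi> z)"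
        unfolding distr_spacetime_diff[OF u sub[OF m] sub[OF \<phi>]] distr_spacetime_diff[OF v sub[OF m] sub[OF \<phi>]]
        using agree[OF K] by simp
      also have "norm \<dots> \<le> norm (v (\<lambda>z. ?m z - \<phi> z)) + norm (u (\<lambda>z. ?m z - \<phi> z))"
        by (rule norm_triangle_ineq4)
      also have "\<dots> \<le> \<bar>C'\<bar> * (e / (\<bar>C\<bar> + \<bar>C'\<bar> + 1)) + \<bar>C\<bar> * (e / (\<bar>C\<bar> + \<bar>C'\<bar> + 1))"
      proof (rule add_mono)
        have "norm (v (\<lambda>z. ?m z - \<phi> z)) \<le> \<bar>C' * CN_norm N' (\<lambda>z. ?m z - \<phi> z)\<bar>"
          using C'[OF d] by linarith
        also have "\<dots> \<le> \<bar>C'\<bar> * (e / (\<bar>C\<bar> + \<bar>C'\<bar> + 1))"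
          unfolding abs_mult using CN[of N'] by (intro mult_left_mono) auto
        finally show "norm (v (\<lambda>z. ?m z - \<phi> z)) \<le> \<bar>C'\<bar> * (e / (\<bar>C\<bar> + \<bar>C'\<bar> + 1))" .
        have "norm (u (\<lambda>z. ?m z - \<phi> z)) \<le> \<bar>C * CN_norm N (\<lambda>z. ?m z - \<phi> z)\<bar>"
          using C[OF d] by linarith
        also have "\<dots> \<le> \<bar>C\<bar> * (e / (\<bar>C\<bar> + \<bar>C'\<bar> + 1))"
          unfolding abs_mult using CN[of N] by (intro mult_left_mono) auto
        finally show "norm (u (\<lambda>z. ?m z - \<phi> z)) \<le> \<bar>C\<bar> * (e / (\<bar>C\<bar> + \<bar>C'\<bar> + 1))" .
      qed
      also have "\<dots> = (\<bar>C'\<bar> + \<bar>C\<bar>) * (e / (\<bar>C\<bar> + \<bar>C'\<bar> + 1))" by (simp only: distrib_right)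
      also have "\<dots> \<le> (\<bar>C\<bar> + \<bar>C'\<bar> + 1) * (e / (\<bar>C\<bar> + \<bar>C'\<bar> + 1))" using c e by (intro mult_right_mono) auto
      also have "\<dots> = e" using c by simp
      finally show ?thesis .
    qed
    then have "norm (u \<phi> - v \<phi>) \<le> 0" by (rule field_le_epsilon) simp
    then show ?thesis by simp
  qed
qed

section \<open>Distributions with prescribed coefficients\<close>

text \<open>Time for the solution spaces. Their norms are blind to null sets, so the time \<open>0\<close> is harmless.\<close>

definition halfline :: "real measure" where "halfline = restrict_space lborel {0..}"

lemma space_halfline [simp]: "space halfline = {0..}" by (simp add: halfline_def space_restrict_space)

lemma sigma_finite_halfline: "sigma_finite_measure halfline"
  unfolding halfline_def by (rule sigma_finite_measure_restrict_space) (auto intro: sigma_finite_lborel)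

lemma nn_integral_halfline: "(\<integral>\<^sup>+t. f t \<partial>halfline) = (\<integral>\<^sup>+t\<in>{0..}. f t \<partial>lborel)"
  unfolding halfline_def by (subst nn_integral_restrict_space) auto

lemma integral_halfline: "(\<integral>t. f t \<partial>halfline) = (LINT t:{0..}|lborel. (f t :: 'a::{banach,second_countable_topology}))"
  unfolding halfline_def set_lebesgue_integral_def by (subst integral_restrict_space) auto

lemma AE_halfline: "(AE t in halfline. P t) \<longleftrightarrow> (AE t in lborel. 0 \<le> t \<longrightarrow> P t)"
  unfolding halfline_def by (subst AE_restrict_space_iff) auto

lemma AE_halfline': "(AE t in halfline. P t) \<longleftrightarrow> (AE t in lborel. 0 < t \<longrightarrow> P t)"
proof -
  have "AE t in lborel. t \<noteq> (0::real)" by (rule AE_lborel_singleton)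
  then have "(AE t in lborel. 0 \<le> t \<longrightarrow> P t) \<longleftrightarrow> (AE t in lborel. 0 < t \<longrightarrow> P t)"
    by (auto elim: eventually_elim2)
  then show ?thesis by (simp add: AE_halfline)
qed

lemma measurable_halfline [measurable (raw)]: "f \<in> borel_measurable borel \<Longrightarrow> f \<in> borel_measurable halfline"
  unfolding halfline_def by (rule measurable_restrict_space1) simp

lemma integral_halfline': "(\<integral>t. f t \<partial>halfline) = (LINT t:{0<..}|lborel. (f t :: 'a::{banach,second_countable_topology}))"
  if [measurable]: "f \<in> borel_measurable borel"
proof -
  have "AE t in lborel. t \<noteq> (0::real)" by (rule AE_lborel_singleton)
  then have "(\<integral>t. indicator {0..} t *\<^sub>R f t \<partial>lborel) = (\<integral>t. indicator {0<..} t *\<^sub>R f t \<partial>lborel)"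
    by (intro integral_cong_AE, measurable) (auto elim!: eventually_mono simp: indicator_def)
  then show ?thesis unfolding integral_halfline set_lebesgue_integral_def .
qed

text \<open>The distribution \<open>\<Sum>k. c k t * wave k x\<close>; outside the test functions it vanishes, as functionals do by
convention.\<close>

definition distr_of_coeffs :: "(int^3 \<Rightarrow> real \<Rightarrow> complex) \<Rightarrow> (real \<times> (real^3)) functional" where
  "distr_of_coeffs c \<phi> = (if \<phi> \<in> test_spacetime then \<Sum>\<^sub>\<infinity>k. \<integral>t. c k t * pairing k (\<lambda>x. \<phi> (t, x)) \<partial>halfline else 0)"

lemma continuous_on_slice:
  assumes "continuous_on UNIV \<phi>" shows "continuous_on A (\<lambda>x. \<phi> (t, x))"
  by (rule continuous_on_compose2[OF assms]) (auto intro!: continuous_intros)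

lemma pairing_measurable:
  fixes \<phi> :: "real \<times> (real^3) \<Rightarrow> complex"
  assumes c: "continuous_on UNIV \<phi>" shows "(\<lambda>t. pairing k (\<lambda>x. \<phi> (t, x))) \<in> borel_measurable borel"
proof -
  have "\<phi> \<in> borel_measurable (borel \<Otimes>\<^sub>M borel)"
    unfolding borel_prod by (rule borel_measurable_continuous_onI[OF c])
  then have [measurable]: "\<phi> \<in> borel_measurable (borel \<Otimes>\<^sub>M lborel)"
    by (simp cong: measurable_cong_sets)
  show ?thesis unfolding pairing_def set_lebesgue_integral_def
    by (rule sigma_finite_measure.borel_measurable_lebesgue_integral[OF sigma_finite_lborel]) measurable
qed

context
  fixes c :: "int^3 \<Rightarrow> real \<Rightarrow> complex"
  assumes meas [measurable]: "\<And>k. c k \<in> borel_measurable borel"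
    and fin: "(nsum (\<lambda>k. (\<integral>\<^sup>+t. ennreal (norm (c k t)) \<partial>halfline))) < \<infinity>"
begin

lemma coeff_integrable: "integrable halfline (c k)"
  unfolding integrable_iff_bounded
proof
  have "(\<integral>\<^sup>+t. ennreal (norm (c k t)) \<partial>halfline) \<le> (nsum (\<lambda>k. (\<integral>\<^sup>+t. ennreal (norm (c k t)) \<partial>halfline)))"
    by (rule nn_integral_ge_point) simp
  then show "(\<integral>\<^sup>+t. ennreal (norm (c k t)) \<partial>halfline) < \<infinity>" using fin by order
qed measurable

lemma distr_of_coeffs_term_fin:
  assumes [measurable]: "\<And>k. g k \<in> borel_measurable borel" and B: "\<And>k t. norm (g k t :: complex) \<le> B"
  shows "(nsum (\<lambda>k. (\<integral>\<^sup>+t. ennreal (norm (c k t * g k t)) \<partial>halfline))) \<le>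
     ennreal B * (nsum (\<lambda>k. (\<integral>\<^sup>+t. ennreal (norm (c k t)) \<partial>halfline)))"
proof -
  have B0: "0 \<le> B" using B[of 0 0] norm_ge_zero order_trans by blast
  have "(nsum (\<lambda>k. (\<integral>\<^sup>+t. ennreal (norm (c k t * g k t)) \<partial>halfline))) \<le>
    (nsum (\<lambda>k. (\<integral>\<^sup>+t. ennreal B * ennreal (norm (c k t)) \<partial>halfline)))"
    using mult_left_mono[OF B norm_ge_zero] B0
    by (intro nn_integral_mono) (auto simp: norm_mult mult.commute[of B] simp flip: ennreal_mult' intro!: ennreal_leI)
  also have "\<dots> = ennreal B * (nsum (\<lambda>k. (\<integral>\<^sup>+t. ennreal (norm (c k t)) \<partial>halfline)))"
    by (simp add: nn_integral_cmult)
  finally show ?thesis .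
qed

lemma slice_bound:
  assumes "\<phi> \<in> test_spacetime_in a b" shows "norm (pairing k (\<lambda>x. \<phi> (t, x))) \<le> (2 * pi) ^ 3 * CN_norm 0 \<phi>"
  by (intro norm_pairing_le CN_norm_0_ge[OF assms] continuous_on_slice smooth_continuous_on test_spacetime_in_smooth[OF assms])

text \<open>The coefficients are summable in \<open>L\<^sup>1\<close>, so a uniform bound on \<open>\<phi>\<close> controls the whole series: the distribution
has order \<open>0\<close>.\<close>

lemma distr_of_coeffs_summable:
  assumes \<phi>: "\<phi> \<in> test_spacetime_in a b"
  shows "(\<lambda>k. \<integral>t. c k t * pairing k (\<lambda>x. \<phi> (t, x)) \<partial>halfline) summable_on UNIV"
    and "integrable halfline (\<lambda>t. c k t * pairing k (\<lambda>x. \<phi> (t, x)))"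
    and "norm (\<Sum>\<^sub>\<infinity>k. \<integral>t. c k t * pairing k (\<lambda>x. \<phi> (t, x)) \<partial>halfline) \<le>
      enn2real (nsum (\<lambda>k. (\<integral>\<^sup>+t. ennreal (norm (c k t)) \<partial>halfline))) * ((2 * pi) ^ 3 * CN_norm 0 \<phi>)"
proof -
  let ?S = "\<integral>\<^sup>+k. (\<integral>\<^sup>+t. ennreal (norm (c k t)) \<partial>halfline) \<partial>count_space UNIV"
  have [measurable]: "(\<lambda>t. pairing k (\<lambda>x. \<phi> (t, x))) \<in> borel_measurable borel" for k
    by (intro pairing_measurable smooth_continuous_on test_spacetime_in_smooth[OF \<phi>])
  note le = distr_of_coeffs_term_fin[of "\<lambda>k t. pairing k (\<lambda>x. \<phi> (t, x))", OF _ slice_bound[OF \<phi>]]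
  have B0: "0 \<le> (2 * pi) ^ 3 * CN_norm 0 \<phi>" using slice_bound[OF \<phi>, of 0 0] norm_ge_zero order_trans by blast
  have fin': "(nsum (\<lambda>k. (\<integral>\<^sup>+t. ennreal (norm (c k t * pairing k (\<lambda>x. \<phi> (t, x)))) \<partial>halfline))) < \<infinity>"
    by (rule le_less_trans[OF le]) (use fin in \<open>auto simp: ennreal_mult_less_top\<close>)
  show s: "(\<lambda>k. \<integral>t. c k t * pairing k (\<lambda>x. \<phi> (t, x)) \<partial>halfline) summable_on UNIV"
    by (rule summable_integrals[OF sigma_finite_halfline _ fin']) measurable
  show "integrable halfline (\<lambda>t. c k t * pairing k (\<lambda>x. \<phi> (t, x)))"
    unfolding integrable_iff_bounded
  proof
    have "(\<integral>\<^sup>+t. ennreal (norm (c k t * pairing k (\<lambda>x. \<phi> (t, x)))) \<partial>halfline) \<le>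
      (nsum (\<lambda>k. (\<integral>\<^sup>+t. ennreal (norm (c k t * pairing k (\<lambda>x. \<phi> (t, x)))) \<partial>halfline)))"
      by (rule nn_integral_ge_point[where x=k]) simp
    then show "(\<integral>\<^sup>+t. ennreal (norm (c k t * pairing k (\<lambda>x. \<phi> (t, x)))) \<partial>halfline) < \<infinity>" using fin' by order
  qed measurable
  have "ennreal (norm (\<Sum>\<^sub>\<infinity>k. \<integral>t. c k t * pairing k (\<lambda>x. \<phi> (t, x)) \<partial>halfline)) \<le>
      (nsum (\<lambda>k. ennreal (norm (\<integral>t. c k t * pairing k (\<lambda>x. \<phi> (t, x)) \<partial>halfline))))"
    unfolding infsum_conv_integral
    using s unfolding summable_iff_nn_integral
    by (intro integral_norm_bound_ennreal) (simp add: integrable_iff_bounded)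
  also have "\<dots> \<le> (nsum (\<lambda>k. (\<integral>\<^sup>+t. ennreal (norm (c k t * pairing k (\<lambda>x. \<phi> (t, x)))) \<partial>halfline)))"
  proof (rule nn_integral_mono)
    fix k
    show "ennreal (norm (\<integral>t. c k t * pairing k (\<lambda>x. \<phi> (t, x)) \<partial>halfline)) \<le> (\<integral>\<^sup>+t. ennreal (norm (c k t * pairing k (\<lambda>x. \<phi> (t, x)))) \<partial>halfline)"
      by (cases "integrable halfline (\<lambda>t. c k t * pairing k (\<lambda>x. \<phi> (t, x)))")
        (auto intro: integral_norm_bound_ennreal simp: not_integrable_integral_eq)
  qed
  also have "\<dots> \<le> ennreal ((2 * pi) ^ 3 * CN_norm 0 \<phi>) * ?S"
    by (rule le) measurable
  also have "\<dots> = ennreal (enn2real ?S * ((2 * pi) ^ 3 * CN_norm 0 \<phi>))"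
    using fin B0 by (subst ennreal_mult) (auto simp: mult.commute less_top)
  finally show "norm (\<Sum>\<^sub>\<infinity>k. \<integral>t. c k t * pairing k (\<lambda>x. \<phi> (t, x)) \<partial>halfline) \<le> enn2real ?S * ((2 * pi) ^ 3 * CN_norm 0 \<phi>)"
    using B0 by (subst (asm) ennreal_le_iff) auto
qed

lemma test_spacetime_common_support:
  assumes "\<phi> \<in> test_spacetime" "\<psi> \<in> test_spacetime"
  obtains a b where "0 < a" "\<phi> \<in> test_spacetime_in a b" "\<psi> \<in> test_spacetime_in a b"
proof -
  obtain a b a' b' where *: "0 < a" "\<phi> \<in> test_spacetime_in a b" "0 < a'" "\<psi> \<in> test_spacetime_in a' b'"
    using assms by (auto simp: test_spacetime_def)
  have mono: "\<eta> \<in> test_spacetime_in (min a a') (max b b')"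
    if \<eta>: "\<eta> \<in> test_spacetime_in c d" and "min a a' \<le> c" "d \<le> max b b'" for \<eta> c d
  proof -
    have "\<eta> (t, x) = 0" if "t \<notin> {min a a'..max b b'}" for t x
      by (rule test_spacetime_in_zero[OF \<eta>]) (use that \<open>min a a' \<le> c\<close> \<open>d \<le> max b b'\<close> in auto)
    then show ?thesis using \<eta> unfolding test_spacetime_in_def by blast
  qed
  have "\<phi> \<in> test_spacetime_in (min a a') (max b b')" "\<psi> \<in> test_spacetime_in (min a a') (max b b')"
    by (rule mono[OF *(2)], simp, simp, rule mono[OF *(4)], simp, simp)
  then show ?thesis using that[of "min a a'"] * by auto
qed

lemma distr_of_coeffs_distr: "distr_of_coeffs c \<in> distr_spacetime"
proof -
  have in_ts: "\<phi> \<in> test_spacetime" if "0 < a" "\<phi> \<in> test_spacetime_in a b" for \<phi> a b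
    using that by (auto simp: test_spacetime_def)
  have add: "distr_of_coeffs c (\<lambda>z. \<phi> z + \<psi> z) = distr_of_coeffs c \<phi> + distr_of_coeffs c \<psi>" if \<phi>\<psi>: "\<phi> \<in> test_spacetime" "\<psi> \<in> test_spacetime" for \<phi> \<psi>
  proof -
    obtain a b where a: "0 < a" and \<phi>: "\<phi> \<in> test_spacetime_in a b" and \<psi>: "\<psi> \<in> test_spacetime_in a b"
      using test_spacetime_common_support[OF \<phi>\<psi>] by blast
    note sum = in_ts[OF a test_spacetime_in_add[OF \<phi> \<psi>]]
    have "pairing k (\<lambda>x. \<phi> (t, x) + \<psi> (t, x)) = pairing k (\<lambda>x. \<phi> (t, x)) + pairing k (\<lambda>x. \<psi> (t, x))" for k t
      by (intro pairing_add continuous_on_slice smooth_continuous_on test_spacetime_in_smooth[OF \<phi>] test_spacetime_in_smooth[OF \<psi>])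
    then have "(\<integral>t. c k t * pairing k (\<lambda>x. \<phi> (t, x) + \<psi> (t, x)) \<partial>halfline) =
       (\<integral>t. c k t * pairing k (\<lambda>x. \<phi> (t, x)) \<partial>halfline) + (\<integral>t. c k t * pairing k (\<lambda>x. \<psi> (t, x)) \<partial>halfline)" for k
      by (simp add: distrib_left Bochner_Integration.integral_add[OF distr_of_coeffs_summable(2)[OF \<phi>] distr_of_coeffs_summable(2)[OF \<psi>]])
    then show ?thesis using \<phi>\<psi> sum
      by (simp add: distr_of_coeffs_def infsum_add[OF distr_of_coeffs_summable(1)[OF \<phi>] distr_of_coeffs_summable(1)[OF \<psi>]])
  qed
  have cm: "distr_of_coeffs c (\<lambda>z. d * \<phi> z) = d * distr_of_coeffs c \<phi>" if "\<phi> \<in> test_spacetime" for \<phi> d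
  proof -
    obtain a b where a: "0 < a" and \<phi>: "\<phi> \<in> test_spacetime_in a b" using \<open>\<phi> \<in> test_spacetime\<close> by (auto simp: test_spacetime_def)
    have "(\<integral>t. c k t * pairing k (\<lambda>x. d * \<phi> (t, x)) \<partial>halfline) = d * (\<integral>t. c k t * pairing k (\<lambda>x. \<phi> (t, x)) \<partial>halfline)" for k
      unfolding pairing_cmult mult.left_commute[of "c k _" d] by (rule integral_mult_right_zero)
    then show ?thesis using that in_ts[OF a test_spacetime_in_cmult[OF \<phi>, of d]]
      by (simp add: distr_of_coeffs_def infsum_cmult_right')
  qed
  have bound: "\<exists>C N. \<forall>\<phi>\<in>test_spacetime_in a b. norm (distr_of_coeffs c \<phi>) \<le> C * CN_norm N \<phi>" if "0 < a" for a b
    using distr_of_coeffs_summable(3)[of _ a b] in_ts[OF that, of _ b]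
    by (intro exI[of _ "enn2real (nsum (\<lambda>k. (\<integral>\<^sup>+t. ennreal (norm (c k t)) \<partial>halfline))) * (2 * pi) ^ 3"] exI[of _ 0])
      (auto simp: distr_of_coeffs_def mult.assoc)
  show ?thesis
    unfolding distr_spacetime_def linear_functional_on_def
    using add cm bound by (auto simp: distr_of_coeffs_def)
qed

lemma distr_of_coeffs_represents: "represents (c k) (time_coeff_distr (distr_of_coeffs c) k)"
  unfolding represents_def
proof (intro conjI allI impI ballI)
  show "c k \<in> borel_measurable lborel" by measurable
  show "set_integrable lborel {a..b} (c k)" if "0 < a" for a b
  proof -
    have "set_integrable lborel {0..} (c k)"
      using coeff_integrable[of k] unfolding halfline_def set_integrable_def
      by (subst (asm) integrable_restrict_space) auto
    then show ?thesis by (rule set_integrable_subset) (use that in auto)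
  qed
  fix \<psi> assume \<psi>: "\<psi> \<in> test_time"
  have [measurable]: "\<psi> \<in> borel_measurable borel" using \<psi> smooth_measurable by (auto simp: test_time_def)
  have "distr_of_coeffs c (\<lambda>(t, x). \<psi> t * wave (- k) x) = (\<Sum>\<^sub>\<infinity>l. \<integral>t. c l t * pairing l (\<lambda>x. \<psi> t * wave (- k) x) \<partial>halfline)"
    using tensor_test_spacetime[OF \<psi>] by (simp add: distr_of_coeffs_def)
  also have "\<dots> = (\<integral>t. c k t * pairing k (\<lambda>x. \<psi> t * wave (- k) x) \<partial>halfline)"
    by (rule infsum_single) (simp add: pairing_cmult pairing_wave)
  also have "\<dots> = (\<integral>t. (2 * pi) ^ 3 * (c k t * \<psi> t) \<partial>halfline)"
    by (simp add: pairing_cmult pairing_wave mult_ac)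
  also have "\<dots> = (2 * pi) ^ 3 * (LINT t:{0<..}|lborel. c k t * \<psi> t)"
    by (subst integral_mult_right_zero, subst integral_halfline') auto
  finally show "time_coeff_distr (distr_of_coeffs c) k \<psi> = (LINT t:{0<..}|lborel. c k t * \<psi> t)"
    by (simp add: time_coeff_distr_def)
qed

end

lemma time_coeff_represents:
  assumes "represents g (time_coeff_distr f k)"
  shows "represents (time_coeff f k) (time_coeff_distr f k)"
  unfolding time_coeff_def using someI[of "\<lambda>g. represents g (time_coeff_distr f k)", OF assms] .

lemma time_coeff_AE:
  assumes "represents g (time_coeff_distr f k)"
  shows "AE t in halfline. time_coeff f k t = g t"
  unfolding AE_halfline' using represents_unique[OF time_coeff_represents[OF assms] assms] by simp

lemma represents_zero:
  assumes "\<And>\<psi>. \<psi> \<in> test_time \<Longrightarrow> S \<psi> = 0" shows "represents (\<lambda>t. 0) S"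
  using assms by (auto simp: represents_def set_lebesgue_integral_def set_integrable_def)

lemma calY_represents:
  assumes "v \<in> calY" shows "represents (time_coeff (v $ i) k) (time_coeff_distr (v $ i) k)"
proof (cases "k = 0")
  case True
  then show ?thesis using assms
    by (intro time_coeff_represents[OF represents_zero]) (auto simp: calY_def calXm1_def)
next
  case False
  then obtain g where "represents g (time_coeff_distr (v $ i) k)"
    using assms unfolding calY_def calXm1_def regular_coeffs_def by blast
  then show ?thesis by (rule time_coeff_represents)
qed

lemma calY_measurable:
  assumes "v \<in> calY" shows "time_coeff (v $ i) k \<in> borel_measurable borel"
  using calY_represents[OF assms] by (auto simp: represents_def)

lemma calY_mean_zero:
  assumes "v \<in> calY" shows "AE t in halfline. time_coeff (v $ i) 0 t = 0"
  using assms by (intro time_coeff_AE represents_zero) (auto simp: calY_def calXm1_def)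

lemma time_coeff_diff_AE:
  assumes "v \<in> calY" "w \<in> calY"
  shows "AE t in halfline. time_coeff ((v - w) $ i) k t = time_coeff (v $ i) k t - time_coeff (w $ i) k t"
proof (rule time_coeff_AE)
  have "time_coeff_distr ((v - w) $ i) k = (\<lambda>\<psi>. time_coeff_distr (v $ i) k \<psi> - time_coeff_distr (w $ i) k \<psi>)"
    by (simp add: fun_eq_iff time_coeff_distr_def diff_divide_distrib)
  then show "represents (\<lambda>t. time_coeff (v $ i) k t - time_coeff (w $ i) k t) (time_coeff_distr ((v - w) $ i) k)"
    using represents_diff[OF calY_represents[OF assms(1)] calY_represents[OF assms(2)]] by simp
qed

lemma time_coeff_diff_measurable:
  assumes "v \<in> calY" "w \<in> calY"
  shows "time_coeff ((v - w) $ i) k \<in> borel_measurable borel"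
proof -
  have "time_coeff_distr ((v - w) $ i) k = (\<lambda>\<psi>. time_coeff_distr (v $ i) k \<psi> - time_coeff_distr (w $ i) k \<psi>)"
    by (simp add: fun_eq_iff time_coeff_distr_def diff_divide_distrib)
  then have "represents (time_coeff ((v - w) $ i) k) (time_coeff_distr ((v - w) $ i) k)"
    using time_coeff_represents[of "\<lambda>t. time_coeff (v $ i) k t - time_coeff (w $ i) k t" "(v - w) $ i" k]
      represents_diff[OF calY_represents[OF assms(1)] calY_represents[OF assms(2)]] by simp
  then show ?thesis by (simp add: represents_def)
qed

text \<open>Elements of \<open>calY\<close> are distributions; this turns uniqueness of coefficients into uniqueness of solutions.\<close>

lemma calY_eqI:
  assumes v: "v \<in> calY" and w: "w \<in> calY"
    and eq: "\<And>i k. AE t in halfline. time_coeff (v $ i) k t = time_coeff (w $ i) k t"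
  shows "v = w"
proof -
  have "v $ i = w $ i" for i
  proof (rule distr_spacetime_eqI)
    show "v $ i \<in> distr_spacetime" "w $ i \<in> distr_spacetime" using v w by (auto simp: calY_def calXm1_def)
    fix \<psi> k assume \<psi>: "\<psi> \<in> test_time"
    have [measurable]: "\<psi> \<in> borel_measurable borel" using \<psi> smooth_measurable by (auto simp: test_time_def)
    have [measurable]: "time_coeff (v $ i) k \<in> borel_measurable borel" "time_coeff (w $ i) k \<in> borel_measurable borel" for k
      using calY_measurable v w by auto
    have "AE t in lborel. 0 < t \<longrightarrow> time_coeff (v $ i) (- k) t = time_coeff (w $ i) (- k) t"
      using eq[of i "-k"] by (simp add: AE_halfline')
    then have "(LINT t:{0<..}|lborel. time_coeff (v $ i) (- k) t * \<psi> t) = (LINT t:{0<..}|lborel. time_coeff (w $ i) (- k) t * \<psi> t)"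
      unfolding set_lebesgue_integral_def
      by (intro integral_cong_AE) (auto elim!: eventually_mono simp: indicator_def)
    then have "time_coeff_distr (v $ i) (- k) \<psi> = time_coeff_distr (w $ i) (- k) \<psi>"
      using calY_represents[OF v, of i "-k"] calY_represents[OF w, of i "-k"] \<psi> by (simp add: represents_def)
    then show "(v $ i) (\<lambda>(t, x). \<psi> t * wave k x) = (w $ i) (\<lambda>(t, x). \<psi> t * wave k x)"
      by (simp add: time_coeff_distr_def)
  qed
  then show ?thesis by (simp add: vec_eq_iff)
qed

section \<open>The norm of the solution space in Fourier variables\<close>

lemma fst_halfline [measurable]: "fst \<in> borel_measurable (halfline \<Otimes>\<^sub>M N)"
  using measurable_compose[OF measurable_fst measurable_halfline[of "\<lambda>x. x"], of N] by simp

lemma snd_halfline [measurable]: "snd \<in> borel_measurable (N \<Otimes>\<^sub>M halfline)"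
  using measurable_compose[OF measurable_snd measurable_halfline[of "\<lambda>x. x"], of N] by simp

lemma norm_ivec_ge_1: "k \<noteq> 0 \<Longrightarrow> 1 \<le> norm (ivec k)"
proof -
  assume "k \<noteq> 0"
  then obtain j where "k $ j \<noteq> 0" by (auto simp: vec_eq_iff)
  then have "1 \<le> \<bar>ivec k $ j\<bar>" by (simp add: ivec_def)
  also have "\<dots> \<le> norm (ivec k)" by (rule component_le_norm_cart)
  finally show ?thesis .
qed

text \<open>The norms of \<open>\<X>\<^sup>-\<^sup>1\<close>, \<open>\<X>\<^sup>1\<close> and \<open>\<Y>\<close> as functions of the moduli of the coefficients. The mode \<open>k = 0\<close> has weight \<open>0\<close>
in both (\<open>1 / 0 = 0\<close>), so the sums may run over all frequencies.\<close>

definition xm1_norm :: "(int^3 \<Rightarrow> real \<Rightarrow> ennreal) \<Rightarrow> ennreal" where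
  "xm1_norm f = (nsum (\<lambda>k. esssup halfline (\<lambda>t. ennreal (1 / norm (ivec k)) * f k t)))"

definition x1_norm :: "(int^3 \<Rightarrow> real \<Rightarrow> ennreal) \<Rightarrow> ennreal" where
  "x1_norm f = (nsum (\<lambda>k. (\<integral>\<^sup>+t. ennreal (norm (ivec k)) * f k t \<partial>halfline)))"

definition y_norm :: "(int^3 \<Rightarrow> real \<Rightarrow> ennreal) \<Rightarrow> ennreal" where
  "y_norm f = xm1_norm f + x1_norm f"

lemma y_norm_mono_AE:
  assumes [measurable]: "\<And>k. f k \<in> borel_measurable halfline"
    and le: "\<And>k. AE t in halfline. f k t \<le> g k t"
  shows "y_norm f \<le> y_norm g"
proof -
  have "xm1_norm f \<le> xm1_norm g" unfolding xm1_norm_def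
  proof (rule nn_integral_mono, rule esssup_AE_mono)
    show "AE t in halfline. ennreal (1 / norm (ivec k)) * f k t \<le> ennreal (1 / norm (ivec k)) * g k t" for k
      using le[of k] by eventually_elim (rule mult_left_mono, auto)
  qed measurable
  moreover have "x1_norm f \<le> x1_norm g" unfolding x1_norm_def
  proof (rule nn_integral_mono, rule nn_integral_mono_AE)
    show "AE t in halfline. ennreal (norm (ivec k)) * f k t \<le> ennreal (norm (ivec k)) * g k t" for k
      using le[of k] by eventually_elim (rule mult_left_mono, auto)
  qed
  ultimately show ?thesis unfolding y_norm_def by (rule add_mono)
qed

lemma y_norm_cong_AE:
  assumes "\<And>k. f k \<in> borel_measurable halfline" "\<And>k. g k \<in> borel_measurable halfline"
    and eq: "\<And>k. AE t in halfline. f k t = g k t"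
  shows "y_norm f = y_norm g"
proof (rule antisym)
  have "AE t in halfline. f k t \<le> g k t" "AE t in halfline. g k t \<le> f k t" for k
    using eq[of k] by (auto elim!: eventually_mono)
  then show "y_norm f \<le> y_norm g" "y_norm g \<le> y_norm f" using assms(1,2) by (auto intro!: y_norm_mono_AE)
qed

text \<open>Countable subadditivity takes the place of completeness: it bounds the limit of a telescoping
sequence.\<close>

lemma y_norm_suminf:
  fixes f :: "nat \<Rightarrow> int^3 \<Rightarrow> real \<Rightarrow> ennreal"
  assumes [measurable]: "\<And>n k. f n k \<in> borel_measurable halfline"
  shows "y_norm (\<lambda>k t. \<Sum>n. f n k t) \<le> (\<Sum>n. y_norm (f n))"
proof -
  have "xm1_norm (\<lambda>k t. \<Sum>n. f n k t) \<le> (nsum (\<lambda>k. (\<Sum>n. esssup halfline (\<lambda>t. ennreal (1 / norm (ivec k)) * f n k t))))"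
    unfolding xm1_norm_def
  proof (rule nn_integral_mono, rule esssup_I)
    fix k
    have "AE t in halfline. \<forall>n. ennreal (1 / norm (ivec k)) * f n k t \<le> esssup halfline (\<lambda>t. ennreal (1 / norm (ivec k)) * f n k t)"
      by (subst AE_all_countable) (intro allI esssup_AE)
    then show "AE t in halfline. ennreal (1 / norm (ivec k)) * (\<Sum>n. f n k t) \<le> (\<Sum>n. esssup halfline (\<lambda>t. ennreal (1 / norm (ivec k)) * f n k t))"
      by eventually_elim (auto simp flip: ennreal_suminf_cmult intro!: suminf_le)
  qed measurable
  also have "\<dots> = (\<Sum>n. xm1_norm (f n))" unfolding xm1_norm_def by (rule nn_integral_suminf) simp
  finally have 1: "xm1_norm (\<lambda>k t. \<Sum>n. f n k t) \<le> (\<Sum>n. xm1_norm (f n))" .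
  have "x1_norm (\<lambda>k t. \<Sum>n. f n k t) = (\<Sum>n. x1_norm (f n))"
    unfolding x1_norm_def by (simp add: nn_integral_suminf flip: ennreal_suminf_cmult)
  then show ?thesis unfolding y_norm_def using 1 by (subst suminf_add[symmetric]) (auto intro: add_mono)
qed

lemma y_norm_add:
  assumes [measurable]: "\<And>k. f k \<in> borel_measurable halfline" "\<And>k. g k \<in> borel_measurable halfline"
  shows "y_norm (\<lambda>k t. f k t + g k t) \<le> y_norm f + y_norm g"
proof -
  have "xm1_norm (\<lambda>k t. f k t + g k t) \<le> (nsum (\<lambda>k. esssup halfline (\<lambda>t. ennreal (1 / norm (ivec k)) * f k t) + esssup halfline (\<lambda>t. ennreal (1 / norm (ivec k)) * g k t)))"
    unfolding xm1_norm_def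
  proof (rule nn_integral_mono, rule esssup_I)
    fix k
    show "AE t in halfline. ennreal (1 / norm (ivec k)) * (f k t + g k t) \<le> esssup halfline (\<lambda>t. ennreal (1 / norm (ivec k)) * f k t) + esssup halfline (\<lambda>t. ennreal (1 / norm (ivec k)) * g k t)"
      using esssup_AE[of "\<lambda>t. ennreal (1 / norm (ivec k)) * f k t" halfline] esssup_AE[of "\<lambda>t. ennreal (1 / norm (ivec k)) * g k t" halfline]
      by eventually_elim (auto simp: distrib_left intro!: add_mono)
  qed measurable
  also have "\<dots> = xm1_norm f + xm1_norm g" unfolding xm1_norm_def by (rule nn_integral_add) auto
  finally have 1: "xm1_norm (\<lambda>k t. f k t + g k t) \<le> xm1_norm f + xm1_norm g" .
  have "x1_norm (\<lambda>k t. f k t + g k t) = x1_norm f + x1_norm g"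
    unfolding x1_norm_def by (simp add: distrib_left nn_integral_add)
  then show ?thesis unfolding y_norm_def using add_right_mono[OF 1, of "x1_norm f + x1_norm g"] by (simp add: ac_simps)
qed

lemma nn_integral_le_y_norm:
  assumes [measurable]: "\<And>k. f k \<in> borel_measurable halfline" and 0: "AE t in halfline. f 0 t = 0"
  shows "(nsum (\<lambda>k. (\<integral>\<^sup>+t. f k t \<partial>halfline))) \<le> y_norm f"
proof -
  have "(nsum (\<lambda>k. (\<integral>\<^sup>+t. f k t \<partial>halfline))) \<le> x1_norm f"
    unfolding x1_norm_def
  proof (rule nn_integral_mono, rule nn_integral_mono_AE)
    fix k
    show "AE t in halfline. f k t \<le> ennreal (norm (ivec k)) * f k t"
    proof (cases "k = 0")
      case True then show ?thesis using 0 by (auto elim!: eventually_mono)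
    next
      case False
      then have "1 \<le> ennreal (norm (ivec k))" using norm_ivec_ge_1 by simp
      then show ?thesis using mult_right_mono[of 1 "ennreal (norm (ivec k))"] by (intro AE_I2) auto
    qed
  qed
  then show ?thesis by (simp add: y_norm_def add_increasing)
qed

lemma y_norm_AE_finite:
  assumes [measurable]: "\<And>k. f k \<in> borel_measurable halfline" and 0: "AE t in halfline. f 0 t = 0" and "y_norm f < \<infinity>"
  shows "AE t in halfline. (nsum (\<lambda>k. f k t)) < \<infinity>"
proof -
  have "(\<integral>\<^sup>+t. (nsum (\<lambda>k. f k t)) \<partial>halfline) \<le> y_norm f"
    using nn_integral_le_y_norm[of f, OF _ 0] by (subst nn_sum_swap) auto
  then have "(\<integral>\<^sup>+t. (nsum (\<lambda>k. f k t)) \<partial>halfline) \<noteq> \<infinity>" using assms(3) by auto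
  then have "AE t in halfline. (nsum (\<lambda>k. f k t)) \<noteq> \<infinity>"
    by (intro nn_integral_PInf_AE borel_measurable_nn_sum) auto
  then show ?thesis by (auto elim!: eventually_mono simp: less_top)
qed

text \<open>The heart of the bilinear estimate. From \<open>1 \<le> |k|/|l| + |l|/|k|\<close>, each product \<open>f\<^sub>k g\<^sub>l\<close> is at most
\<open>(|k| f\<^sub>k) (g\<^sub>l/|l|) + (f\<^sub>k/|k|) (|l| g\<^sub>l)\<close>. In both terms one factor is integrable in time and the other
bounded. The modes \<open>k = 0\<close> have to vanish, as the norms do not see them.\<close>

lemma pair_estimate:
  assumes [measurable]: "\<And>k. f k \<in> borel_measurable halfline" "\<And>k. g k \<in> borel_measurable halfline"
    and f0: "AE t in halfline. f 0 t = 0" and g0: "AE t in halfline. g 0 t = 0"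
  shows "(\<integral>\<^sup>+t. (nsum (\<lambda>k. f k t)) * (nsum (\<lambda>k. g k t)) \<partial>halfline) \<le> y_norm f * y_norm g"
proof -
  define A where "A h t = (nsum (\<lambda>k. ennreal (norm (ivec k)) * h k t))" for h :: "int^3 \<Rightarrow> real \<Rightarrow> ennreal" and t
  define B where "B h t = (nsum (\<lambda>k. ennreal (1 / norm (ivec k)) * h k t))" for h :: "int^3 \<Rightarrow> real \<Rightarrow> ennreal" and t
  have mA: "A h \<in> borel_measurable halfline" if "\<And>k. h k \<in> borel_measurable halfline" for h
    using that unfolding A_def[abs_def] by (intro borel_measurable_nn_sum) auto
  note [measurable] = mA[of f] mA[of g]
  have IA: "(\<integral>\<^sup>+t. A h t \<partial>halfline) = x1_norm h" if "\<And>k. h k \<in> borel_measurable halfline" for h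
    using that unfolding A_def x1_norm_def by (intro nn_sum_swap) auto
  have BX: "AE t in halfline. B h t \<le> xm1_norm h" for h
  proof -
    have "AE t in halfline. \<forall>k. ennreal (1 / norm (ivec k)) * h k t \<le> esssup halfline (\<lambda>t. ennreal (1 / norm (ivec k)) * h k t)"
      by (subst AE_all_countable) (intro allI esssup_AE)
    then show ?thesis by eventually_elim (auto simp: B_def xm1_norm_def intro!: nn_integral_mono)
  qed
  have pt: "f k t * g l t \<le> (ennreal (norm (ivec k)) * f k t) * (ennreal (1 / norm (ivec l)) * g l t) +
      (ennreal (1 / norm (ivec k)) * f k t) * (ennreal (norm (ivec l)) * g l t)" if "f 0 t = 0" "g 0 t = 0" for k l t
  proof (cases "k = 0 \<or> l = 0")
    case True then show ?thesis using that by auto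
  next
    case False
    define x y where "x = norm (ivec k)" and "y = norm (ivec l)"
    have xy: "0 < x" "0 < y" using False by (auto simp: x_def y_def)
    have "1 \<le> x * (1 / y) + (1 / x) * y"
    proof (cases "x \<le> y")
      case True
      then have "1 \<le> (1 / x) * y" using xy by (simp add: field_simps)
      then show ?thesis using xy by (simp add: add_increasing)
    next
      case False
      then have "1 \<le> x * (1 / y)" using xy by (simp add: field_simps)
      then show ?thesis using xy by (simp add: add_increasing2)
    qed
    then have "ennreal 1 \<le> ennreal (x * (1 / y) + (1 / x) * y)" by (rule ennreal_leI)
    also have "\<dots> = ennreal x * ennreal (1 / y) + ennreal (1 / x) * ennreal y"
      using xy by (simp add: ennreal_plus ennreal_mult flip: ennreal_mult)
    finally have "1 * (f k t * g l t) \<le> (ennreal x * ennreal (1 / y) + ennreal (1 / x) * ennreal y) * (f k t * g l t)"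
      by (intro mult_right_mono) auto
    then show ?thesis by (simp add: x_def y_def algebra_simps)
  qed
  have "AE t in halfline. (nsum (\<lambda>k. f k t)) * (nsum (\<lambda>k. g k t)) \<le> A f t * xm1_norm g + xm1_norm f * A g t"
    using BX[of f] BX[of g] f0 g0
  proof eventually_elim
    case (elim t)
    have "(nsum (\<lambda>k. f k t)) * (nsum (\<lambda>l. g l t)) =
      (nsum (\<lambda>k. (nsum (\<lambda>l. f k t * g l t))))"
      by (simp add: nn_integral_cmult nn_integral_multc)
    also have "\<dots> \<le> (nsum (\<lambda>k. (nsum (\<lambda>l. (ennreal (norm (ivec k)) * f k t) * (ennreal (1 / norm (ivec l)) * g l t) +
      (ennreal (1 / norm (ivec k)) * f k t) * (ennreal (norm (ivec l)) * g l t)))))"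
      using pt elim by (intro nn_integral_mono) auto
    also have "\<dots> = A f t * B g t + B f t * A g t"
      unfolding A_def B_def by (simp add: nn_integral_add nn_integral_cmult nn_integral_multc)
    also have "\<dots> \<le> A f t * xm1_norm g + xm1_norm f * A g t"
      using elim by (intro add_mono mult_left_mono mult_right_mono) auto
    finally show ?case .
  qed
  then have "(\<integral>\<^sup>+t. (nsum (\<lambda>k. f k t)) * (nsum (\<lambda>k. g k t)) \<partial>halfline)
     \<le> (\<integral>\<^sup>+t. A f t * xm1_norm g + xm1_norm f * A g t \<partial>halfline)" by (rule nn_integral_mono_AE)
  also have "\<dots> = x1_norm f * xm1_norm g + xm1_norm f * x1_norm g"
    by (simp add: nn_integral_add nn_integral_cmult nn_integral_multc IA)
  also have "\<dots> \<le> y_norm f * y_norm g"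
    unfolding y_norm_def by (simp add: distrib_left distrib_right add_increasing add_increasing2 ac_simps)
  finally show ?thesis .
qed

text \<open>Zero for \<open>s > t\<close>, so that Duhamel integrals extend over the whole half-line and do not have \<open>t\<close> in
their domain of integration.\<close>

definition heat_kernel :: "real \<Rightarrow> int^3 \<Rightarrow> real \<Rightarrow> real \<Rightarrow> real" where
  "heat_kernel \<mu> k t s = (if s \<le> t then exp (- \<mu> * (t - s) * (norm (ivec k))\<^sup>2) else 0)"

lemma heat_kernel_nonneg: "0 \<le> heat_kernel \<mu> k t s" by (simp add: heat_kernel_def)

lemma heat_kernel_le_1: "0 < \<mu> \<Longrightarrow> heat_kernel \<mu> k t s \<le> 1"
  by (simp add: heat_kernel_def)

lemma heat_kernel_measurable [measurable]: "(\<lambda>(t, s). heat_kernel \<mu> k t s) \<in> borel_measurable (borel \<Otimes>\<^sub>M borel)"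
  unfolding heat_kernel_def by measurable

lemma nn_integral_heat_kernel:
  assumes "0 < \<mu>" "k \<noteq> 0" "0 \<le> s"
  shows "(\<integral>\<^sup>+t. ennreal (heat_kernel \<mu> k t s) \<partial>halfline) = ennreal (1 / (\<mu> * (norm (ivec k))\<^sup>2))"
proof -
  define c where "c = \<mu> * (norm (ivec k))\<^sup>2"
  have c: "c > 0" using assms by (simp add: c_def)
  have "(\<integral>\<^sup>+t. ennreal (heat_kernel \<mu> k t s) \<partial>halfline) = (\<integral>\<^sup>+t. ennreal (exp (- c * (t - s))) * indicator {s..} t \<partial>lborel)"
    unfolding nn_integral_halfline using assms(3)
    by (intro nn_integral_cong) (auto simp: heat_kernel_def c_def indicator_def mult_ac)
  also have "\<dots> = ennreal (0 - (- exp (- c * (s - s)) / c))"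
  proof (rule nn_integral_FTC_atLeast[where F="\<lambda>t. - exp (- c * (t - s)) / c"])
    show "((\<lambda>t. - exp (- c * (t - s)) / c) has_real_derivative exp (- c * (t - s))) (at t)" for t
      using c by (auto intro!: derivative_eq_intros)
    have "((\<lambda>t. - exp (- c * (t - s)) / c) \<longlongrightarrow> - 0 / c) at_top"
    proof (intro tendsto_intros filterlim_compose[OF exp_at_bot])
      show "filterlim (\<lambda>t. - c * (t - s)) at_bot at_top"
        using filterlim_tendsto_add_at_top[OF tendsto_const[of "-s"] filterlim_ident] c
        by (intro filterlim_tendsto_neg_mult_at_bot[OF tendsto_const]) auto
    qed (use c in auto)
    then show "((\<lambda>t. - exp (- c * (t - s)) / c) \<longlongrightarrow> 0) at_top" by simp
  qed (use c in auto)
  finally show ?thesis by (simp add: c_def)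
qed

definition initial_norm :: "(int^3 \<Rightarrow> ennreal) \<Rightarrow> ennreal" where
  "initial_norm c = (nsum (\<lambda>k. ennreal (1 / norm (ivec k)) * c k))"

lemma ennreal_mult_inverse_le_1: "ennreal (1 / x) * ennreal x \<le> 1"
proof (cases "x > 0")
  case True
  then have "ennreal (1 / x) * ennreal x = ennreal (1 / x * x)" by (subst ennreal_mult[symmetric]) auto
  then show ?thesis using True by simp
qed (simp add: ennreal_neg)

lemma esssup_le_bound:
  assumes "f \<in> borel_measurable M" "\<And>t. t \<in> space M \<Longrightarrow> f t \<le> (c::ennreal)" shows "esssup M f \<le> c"
  by (rule esssup_I[OF assms(1)]) (use assms(2) in \<open>auto intro: AE_I2\<close>)

lemma heat_estimate:
  assumes \<mu>: "0 < \<mu>"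
  shows "y_norm (\<lambda>k t. ennreal (heat_kernel \<mu> k t 0) * c k) \<le> ennreal (1 + 1 / \<mu>) * initial_norm c"
proof -
  have "xm1_norm (\<lambda>k t. ennreal (heat_kernel \<mu> k t 0) * c k) \<le> initial_norm c"
    unfolding xm1_norm_def initial_norm_def
  proof (rule nn_integral_mono, rule esssup_le_bound)
    fix k t
    have "ennreal (heat_kernel \<mu> k t 0) * c k \<le> 1 * c k"
      using heat_kernel_le_1[OF \<mu>] by (intro mult_right_mono) auto
    then show "ennreal (1 / norm (ivec k)) * (ennreal (heat_kernel \<mu> k t 0) * c k) \<le> ennreal (1 / norm (ivec k)) * c k"
      by (intro mult_left_mono) auto
  qed measurable
  moreover have "x1_norm (\<lambda>k t. ennreal (heat_kernel \<mu> k t 0) * c k) \<le> ennreal (1 / \<mu>) * initial_norm c"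
    unfolding x1_norm_def initial_norm_def nn_integral_cmult[OF borel_measurable_count_space, symmetric]
  proof (rule nn_integral_mono)
    fix k
    show "(\<integral>\<^sup>+t. ennreal (norm (ivec k)) * (ennreal (heat_kernel \<mu> k t 0) * c k) \<partial>halfline) \<le> ennreal (1 / \<mu>) * (ennreal (1 / norm (ivec k)) * c k)"
    proof (cases "k = 0")
      case False
      have "(\<integral>\<^sup>+t. ennreal (norm (ivec k)) * (ennreal (heat_kernel \<mu> k t 0) * c k) \<partial>halfline) =
        ennreal (norm (ivec k)) * (ennreal (1 / (\<mu> * (norm (ivec k))\<^sup>2)) * c k)"
        by (simp add: nn_integral_cmult nn_integral_multc nn_integral_heat_kernel[OF \<mu> False])
      also have "\<dots> = ennreal (norm (ivec k) * (1 / (\<mu> * (norm (ivec k))\<^sup>2))) * c k"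
        using \<mu> by (simp only: ennreal_mult' norm_ge_zero mult.assoc ennreal_mult'')
      also have "norm (ivec k) * (1 / (\<mu> * (norm (ivec k))\<^sup>2)) = (1 / \<mu>) * (1 / norm (ivec k))"
        using False by (simp add: power2_eq_square)
      also have "ennreal ((1 / \<mu>) * (1 / norm (ivec k))) * c k = ennreal (1 / \<mu>) * (ennreal (1 / norm (ivec k)) * c k)"
        using \<mu> by (subst ennreal_mult) (auto simp: mult.assoc)
      finally show ?thesis by simp
    qed simp
  qed
  ultimately have "y_norm (\<lambda>k t. ennreal (heat_kernel \<mu> k t 0) * c k) \<le> initial_norm c + ennreal (1 / \<mu>) * initial_norm c"
    unfolding y_norm_def by (rule add_mono)
  also have "\<dots> = ennreal (1 + 1 / \<mu>) * initial_norm c"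
    using \<mu> by (simp add: ennreal_plus distrib_right)
  finally show ?thesis .
qed

text \<open>A right-hand side with one derivative, \<open>|k| h\<^sub>k\<close>, suffices for both norms: dividing by \<open>|k|\<close> removes the
derivative, and with the weight \<open>|k|\<close> the two powers of \<open>|k|\<close> are absorbed by the time integral of the
heat kernel.\<close>

lemma duhamel_estimate:
  assumes \<mu>: "0 < \<mu>" and [measurable]: "\<And>k. h k \<in> borel_measurable halfline"
  shows "y_norm (\<lambda>k t. \<integral>\<^sup>+s. ennreal (heat_kernel \<mu> k t s) * (ennreal (norm (ivec k)) * h k s) \<partial>halfline) \<le>
     ennreal (1 + 1 / \<mu>) * (nsum (\<lambda>k. (\<integral>\<^sup>+s. h k s \<partial>halfline)))"
proof -
  interpret sigma_finite_measure halfline by (rule sigma_finite_halfline)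
  interpret P: pair_sigma_finite halfline halfline ..
  have Wm: "(\<lambda>t. \<integral>\<^sup>+s. ennreal (heat_kernel \<mu> k t s) * (ennreal (norm (ivec k)) * h k s) \<partial>halfline) \<in> borel_measurable halfline" for k
    by measurable
  have "xm1_norm (\<lambda>k t. \<integral>\<^sup>+s. ennreal (heat_kernel \<mu> k t s) * (ennreal (norm (ivec k)) * h k s) \<partial>halfline) \<le> (nsum (\<lambda>k. (\<integral>\<^sup>+s. h k s \<partial>halfline)))"
    unfolding xm1_norm_def
  proof (rule nn_integral_mono, rule esssup_le_bound)
    fix k t
    have "ennreal (1 / norm (ivec k)) * (\<integral>\<^sup>+s. ennreal (heat_kernel \<mu> k t s) * (ennreal (norm (ivec k)) * h k s) \<partial>halfline) \<le>
      ennreal (1 / norm (ivec k)) * (\<integral>\<^sup>+s. 1 * (ennreal (norm (ivec k)) * h k s) \<partial>halfline)"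
      using heat_kernel_le_1[OF \<mu>] by (intro mult_left_mono nn_integral_mono mult_right_mono) auto
    also have "\<dots> = (ennreal (1 / norm (ivec k)) * ennreal (norm (ivec k))) * (\<integral>\<^sup>+s. h k s \<partial>halfline)"
      by (simp add: nn_integral_cmult mult.assoc)
    also have "\<dots> \<le> 1 * (\<integral>\<^sup>+s. h k s \<partial>halfline)"
      by (intro mult_right_mono ennreal_mult_inverse_le_1) auto
    finally show "ennreal (1 / norm (ivec k)) * (\<integral>\<^sup>+s. ennreal (heat_kernel \<mu> k t s) * (ennreal (norm (ivec k)) * h k s) \<partial>halfline) \<le> (\<integral>\<^sup>+s. h k s \<partial>halfline)"
      by simp
  qed measurable
  moreover have "x1_norm (\<lambda>k t. \<integral>\<^sup>+s. ennreal (heat_kernel \<mu> k t s) * (ennreal (norm (ivec k)) * h k s) \<partial>halfline) \<le> ennreal (1 / \<mu>) * (nsum (\<lambda>k. (\<integral>\<^sup>+s. h k s \<partial>halfline)))"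
    unfolding x1_norm_def nn_integral_cmult[OF borel_measurable_count_space, symmetric]
  proof (rule nn_integral_mono)
    fix k
    show "(\<integral>\<^sup>+t. ennreal (norm (ivec k)) * (\<integral>\<^sup>+s. ennreal (heat_kernel \<mu> k t s) * (ennreal (norm (ivec k)) * h k s) \<partial>halfline) \<partial>halfline) \<le> ennreal (1 / \<mu>) * (\<integral>\<^sup>+s. h k s \<partial>halfline)"
    proof (cases "k = 0")
      case False
      have "(\<integral>\<^sup>+t. (\<integral>\<^sup>+s. ennreal (heat_kernel \<mu> k t s) * (ennreal (norm (ivec k)) * h k s) \<partial>halfline) \<partial>halfline) =
        (\<integral>\<^sup>+s. (\<integral>\<^sup>+t. ennreal (heat_kernel \<mu> k t s) * (ennreal (norm (ivec k)) * h k s) \<partial>halfline) \<partial>halfline)"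
        by (rule P.Fubini') measurable
      also have "\<dots> = (\<integral>\<^sup>+s. ennreal (1 / (\<mu> * (norm (ivec k))\<^sup>2)) * (ennreal (norm (ivec k)) * h k s) \<partial>halfline)"
        by (intro nn_integral_cong) (simp add: nn_integral_multc nn_integral_heat_kernel[OF \<mu> False])
      finally have "(\<integral>\<^sup>+t. ennreal (norm (ivec k)) * (\<integral>\<^sup>+s. ennreal (heat_kernel \<mu> k t s) * (ennreal (norm (ivec k)) * h k s) \<partial>halfline) \<partial>halfline) =
        ennreal (norm (ivec k)) * (ennreal (1 / (\<mu> * (norm (ivec k))\<^sup>2)) * (ennreal (norm (ivec k)) * (\<integral>\<^sup>+s. h k s \<partial>halfline)))"
        using Wm by (simp add: nn_integral_cmult)
      also have "\<dots> = ennreal (norm (ivec k) * (1 / (\<mu> * (norm (ivec k))\<^sup>2)) * norm (ivec k)) * (\<integral>\<^sup>+s. h k s \<partial>halfline)"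
        using \<mu> by (simp only: ennreal_mult' norm_ge_zero mult.assoc ennreal_mult'')
      also have "norm (ivec k) * (1 / (\<mu> * (norm (ivec k))\<^sup>2)) * norm (ivec k) = 1 / \<mu>"
        using False by (simp add: power2_eq_square)
      finally show ?thesis by simp
    qed simp
  qed
  ultimately have "y_norm (\<lambda>k t. \<integral>\<^sup>+s. ennreal (heat_kernel \<mu> k t s) * (ennreal (norm (ivec k)) * h k s) \<partial>halfline) \<le>
     (nsum (\<lambda>k. (\<integral>\<^sup>+s. h k s \<partial>halfline))) + ennreal (1 / \<mu>) * (nsum (\<lambda>k. (\<integral>\<^sup>+s. h k s \<partial>halfline)))"
    unfolding y_norm_def by (rule add_mono)
  also have "\<dots> = ennreal (1 + 1 / \<mu>) * (nsum (\<lambda>k. (\<integral>\<^sup>+s. h k s \<partial>halfline)))"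
    using \<mu> by (simp add: ennreal_plus distrib_right)
  finally show ?thesis .
qed

section \<open>The bilinear estimate\<close>

type_synonym coeffs = "3 \<Rightarrow> int^3 \<Rightarrow> real \<Rightarrow> complex"

abbreviation coeffs_diff :: "coeffs \<Rightarrow> coeffs \<Rightarrow> coeffs" (infixl "\<ominus>" 65) where
  "a \<ominus> b \<equiv> \<lambda>i k t. a i k t - b i k t"

definition mag :: "coeffs \<Rightarrow> int^3 \<Rightarrow> real \<Rightarrow> real" where
  "mag a k t = norm (\<chi> i. a i k t)"

definition coeffs_norm :: "coeffs \<Rightarrow> ennreal" where
  "coeffs_norm a = y_norm (\<lambda>k t. ennreal (mag a k t))"

text \<open>If \<open>f\<close> and \<open>g\<close> are summable, these are the Fourier coefficients of a product.\<close>

definition conv :: "(int^3 \<Rightarrow> complex) \<Rightarrow> (int^3 \<Rightarrow> complex) \<Rightarrow> int^3 \<Rightarrow> complex" where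
  "conv f g k = (\<Sum>\<^sub>\<infinity>l. f l * g (k - l))"

definition div_row :: "int^3 \<Rightarrow> (3 \<Rightarrow> 3 \<Rightarrow> complex) \<Rightarrow> 3 \<Rightarrow> complex" where
  "div_row k G i = (\<Sum>j\<in>UNIV. \<i> * of_real (ivec k $ j) * G i j)"

text \<open>The \<open>k\<close>-th Fourier coefficient of the Leray projection of the divergence of a matrix field with
coefficients \<open>G\<close>, in the order in which the operators are composed in \<open>leray\<close>.\<close>

definition proj_div :: "int^3 \<Rightarrow> (3 \<Rightarrow> 3 \<Rightarrow> complex) \<Rightarrow> 3 \<Rightarrow> complex" where
  "proj_div k G i = div_row k G i - \<i> * of_real (ivec k $ i) *
     (of_real (if k = 0 then 0 else - 1 / (norm (ivec k))\<^sup>2) * (\<Sum>j\<in>UNIV. \<i> * of_real (ivec k $ j) * div_row k G j))"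

definition nonlin :: "coeffs \<Rightarrow> int^3 \<Rightarrow> real \<Rightarrow> 3 \<Rightarrow> complex" where
  "nonlin a k s i = proj_div k (\<lambda>i j. conv (\<lambda>l. a i l s) (\<lambda>l. a j l s) k) i"

text \<open>The right-hand side of the mild formulation in Fourier variables.\<close>

definition Phi :: "real \<Rightarrow> (3 \<Rightarrow> int^3 \<Rightarrow> complex) \<Rightarrow> coeffs \<Rightarrow> coeffs" where
  "Phi \<mu> c a i k t = of_real (heat_kernel \<mu> k t 0) * c i k - (\<integral>s. of_real (heat_kernel \<mu> k t s) * nonlin a k s i \<partial>halfline)"

definition coeffs_ok :: "coeffs \<Rightarrow> bool" where
  "coeffs_ok a \<longleftrightarrow> (\<forall>i k. a i k \<in> borel_measurable borel) \<and> (AE t in halfline. \<forall>i. a i 0 t = 0) \<and> coeffs_norm a < \<infinity>"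

lemma norm_component_le_mag: "norm (a i k t) \<le> mag a k t"
  using Finite_Cartesian_Product.norm_nth_le[of "\<chi> i. a i k t" i] by (simp add: mag_def)

lemma mag_le_sum: "mag a k t \<le> (\<Sum>i\<in>UNIV. norm (a i k t))"
  unfolding mag_def norm_vec_def using L2_set_le_sum[of UNIV "\<lambda>i. norm ((\<chi> i. a i k t) $ i)"] by simp

lemma mag_nonneg [simp]: "0 \<le> mag a k t" by (simp add: mag_def)

lemma mag_measurable [measurable]:
  "(\<And>i. a i k \<in> borel_measurable M) \<Longrightarrow> mag a k \<in> borel_measurable M"
  unfolding mag_def[abs_def] norm_vec_def L2_set_def by (simp, measurable)

lemma mag_eq_0: "(\<And>i. a i k t = 0) \<Longrightarrow> mag a k t = 0"
  using mag_le_sum[of a k t] mag_nonneg[of a k t] by simp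

lemma mag_triangle: "mag (\<lambda>i k t. a i k t + b i k t) k t \<le> mag a k t + mag b k t"
  using norm_triangle_ineq[of "\<chi> i. a i k t" "\<chi> i. b i k t"] by (simp add: mag_def plus_vec_def)

lemma mag_triangle_diff: "mag (a \<ominus> b) k t \<le> mag a k t + mag b k t"
  using norm_triangle_ineq4[of "\<chi> i. a i k t" "\<chi> i. b i k t"] by (simp add: mag_def minus_vec_def)

lemma coeffs_norm_cong_AE:
  assumes "\<And>i k. a i k \<in> borel_measurable borel" "\<And>i k. b i k \<in> borel_measurable borel"
    and eq: "\<And>i k. AE t in halfline. a i k t = b i k t"
  shows "coeffs_norm a = coeffs_norm b"
  unfolding coeffs_norm_def
proof (rule y_norm_cong_AE)
  show "AE t in halfline. ennreal (mag a k t) = ennreal (mag b k t)" for k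
  proof -
    have "AE t in halfline. \<forall>i. a i k t = b i k t" using eq[of _ k] by (subst AE_all_countable) blast
    then show ?thesis by eventually_elim (simp add: mag_def)
  qed
qed (use assms in measurable)

lemma coeffs_norm_diff_le:
  assumes [measurable]: "\<And>i k. a i k \<in> borel_measurable borel" "\<And>i k. b i k \<in> borel_measurable borel"
  shows "coeffs_norm (a \<ominus> b) \<le> coeffs_norm a + coeffs_norm b"
proof -
  have "coeffs_norm (a \<ominus> b) \<le> y_norm (\<lambda>k t. ennreal (mag a k t) + ennreal (mag b k t))"
    unfolding coeffs_norm_def
    by (rule y_norm_mono_AE, measurable)
       (auto intro!: AE_I2 ennreal_leI mag_triangle_diff simp flip: ennreal_plus)
  also have "\<dots> \<le> coeffs_norm a + coeffs_norm b" unfolding coeffs_norm_def by (rule y_norm_add) measurable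
  finally show ?thesis .
qed

lemma coeffs_ok_diff:
  assumes a: "coeffs_ok a" and b: "coeffs_ok b" shows "coeffs_ok (a \<ominus> b)"
proof -
  have "coeffs_norm (a \<ominus> b) \<le> coeffs_norm a + coeffs_norm b"
    by (rule coeffs_norm_diff_le) (use a b in \<open>auto simp: coeffs_ok_def\<close>)
  also have "\<dots> < \<infinity>" using a b by (auto simp: coeffs_ok_def)
  finally have 1: "coeffs_norm (a \<ominus> b) < \<infinity>" .
  have "AE t in halfline. \<forall>i. a i 0 t = 0" "AE t in halfline. \<forall>i. b i 0 t = 0" using a b by (auto simp: coeffs_ok_def)
  then have "AE t in halfline. \<forall>i. a i 0 t - b i 0 t = 0" by eventually_elim auto
  moreover have "(\<lambda>t. a i k t - b i k t) \<in> borel_measurable borel" for i k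
    using a b by (intro borel_measurable_diff) (auto simp: coeffs_ok_def)
  ultimately show ?thesis using 1 by (simp add: coeffs_ok_def)
qed

lemma coeffs_ok_zero: "coeffs_ok (\<lambda>i k t. 0)" and coeffs_norm_zero [simp]: "coeffs_norm (\<lambda>i k t. 0) = 0"
proof -
  have "mag (\<lambda>i k t. 0) k t = 0" for k t by (rule mag_eq_0) simp
  moreover have "esssup halfline (\<lambda>t. 0::ennreal) = 0" using esssup_le_bound[of "\<lambda>t. 0" halfline "0::ennreal"] by simp
  ultimately show "coeffs_norm (\<lambda>i k t. 0) = 0" by (simp add: coeffs_norm_def y_norm_def xm1_norm_def x1_norm_def)
  then show "coeffs_ok (\<lambda>i k t. 0)" by (simp add: coeffs_ok_def)
qed

lemma coeffs_ok_summable: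
  assumes "coeffs_ok a"
  shows "AE t in halfline. (nsum (\<lambda>k. ennreal (mag a k t))) < \<infinity>"
proof (rule y_norm_AE_finite)
  show "(\<lambda>t. ennreal (mag a k t)) \<in> borel_measurable halfline" for k using assms
    by (auto simp: coeffs_ok_def intro!: measurable_compose[OF _ measurable_ennreal] mag_measurable measurable_halfline)
  show "AE t in halfline. ennreal (mag a 0 t) = 0"
    using assms by (auto simp: coeffs_ok_def mag_eq_0 elim!: eventually_mono)
  show "y_norm (\<lambda>k t. ennreal (mag a k t)) < \<infinity>" using assms by (simp add: coeffs_ok_def coeffs_norm_def)
qed

text \<open>Convolution of sequences with values in \<open>[0,\<infinity>]\<close>, used for bounds.\<close>

definition nconv :: "(int^3 \<Rightarrow> ennreal) \<Rightarrow> (int^3 \<Rightarrow> ennreal) \<Rightarrow> int^3 \<Rightarrow> ennreal" where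
  "nconv f g k = nsum (\<lambda>l. f l * g (k - l))"

lemma nsum_shift:
  fixes g :: "int^3 \<Rightarrow> ennreal"
  shows "nsum (\<lambda>k. g (k - l)) = nsum g"
proof (rule nn_integral_bij_count_space)
  show "bij_betw (\<lambda>k. k - l) UNIV (UNIV :: (int^3) set)"
    by (rule bij_betwI[of _ _ _ "\<lambda>k. k + l"]) auto
qed

lemma nsum_nconv: "nsum (nconv f g) = nsum f * nsum g"
proof -
  have "nsum (nconv f g) = nsum (\<lambda>l. nsum (\<lambda>k. f l * g (k - l)))"
    unfolding nconv_def by (rule nn_sum_swap) simp
  also have "\<dots> = nsum f * nsum g"
    by (simp add: nn_integral_cmult nsum_shift nn_integral_multc)
  finally show ?thesis .
qed

lemma nconv_le: "nconv f g k \<le> nsum f * nsum g"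
proof -
  have "nconv f g k \<le> nsum (nconv f g)" by (rule nn_integral_ge_point) simp
  then show ?thesis by (simp add: nsum_nconv)
qed

lemma nconv_mono: "(\<And>l. f l \<le> f' l) \<Longrightarrow> (\<And>l. g l \<le> g' l) \<Longrightarrow> nconv f g k \<le> nconv f' g' k"
  unfolding nconv_def by (intro nn_integral_mono mult_mono) auto

lemma conv_summable:
  fixes f g :: "int^3 \<Rightarrow> complex"
  assumes "nsum (\<lambda>l. ennreal (norm (f l))) < \<infinity>" "nsum (\<lambda>l. ennreal (norm (g l))) < \<infinity>"
  shows "(\<lambda>l. f l * g (k - l)) summable_on UNIV"
proof -
  have "nsum (\<lambda>l. ennreal (norm (f l * g (k - l)))) = nconv (\<lambda>l. ennreal (norm (f l))) (\<lambda>l. ennreal (norm (g l))) k"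
    by (simp add: nconv_def norm_mult ennreal_mult)
  also have "\<dots> < \<infinity>" by (rule le_less_trans[OF nconv_le]) (use assms in \<open>simp add: ennreal_mult_less_top\<close>)
  finally show ?thesis by (simp add: summable_iff_nn_integral)
qed

lemma norm_infsum_le:
  fixes f :: "'a::countable \<Rightarrow> complex"
  shows "ennreal (norm (\<Sum>\<^sub>\<infinity>k. f k)) \<le> (nsum (\<lambda>k. ennreal (norm (f k))))"
  unfolding infsum_conv_integral
  by (cases "integrable (count_space UNIV) f") (auto intro: integral_norm_bound_ennreal simp: not_integrable_integral_eq)

lemma infsum_difference:
  fixes f g :: "'a::countable \<Rightarrow> complex"
  assumes "f summable_on UNIV" "g summable_on UNIV"
  shows "(\<Sum>\<^sub>\<infinity>k. f k - g k) = (\<Sum>\<^sub>\<infinity>k. f k) - (\<Sum>\<^sub>\<infinity>k. g k)"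
  using assms unfolding infsum_conv_integral summable_iff_nn_integral
  by (intro Bochner_Integration.integral_diff) (auto simp: integrable_iff_bounded)

lemma conv_diff:
  assumes f: "nsum (\<lambda>l. ennreal (norm (f l))) < \<infinity>" and g: "nsum (\<lambda>l. ennreal (norm (g l))) < \<infinity>"
    and f': "nsum (\<lambda>l. ennreal (norm (f' l))) < \<infinity>" and g': "nsum (\<lambda>l. ennreal (norm (g' l))) < \<infinity>"
  shows "ennreal (norm (conv f g k - conv f' g' k)) \<le>
    nconv (\<lambda>l. ennreal (norm (f l - f' l))) (\<lambda>l. ennreal (norm (g l))) k + nconv (\<lambda>l. ennreal (norm (f' l))) (\<lambda>l. ennreal (norm (g l - g' l))) k"
proof -
  have "conv f g k - conv f' g' k = (\<Sum>\<^sub>\<infinity>l. f l * g (k - l) - f' l * g' (k - l))"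
    unfolding conv_def by (rule infsum_difference[symmetric]) (intro conv_summable f g f' g')+
  also have "ennreal (norm \<dots>) \<le> nsum (\<lambda>l. ennreal (norm (f l * g (k - l) - f' l * g' (k - l))))"
    by (rule norm_infsum_le)
  also have "\<dots> \<le> nsum (\<lambda>l. ennreal (norm (f l - f' l)) * ennreal (norm (g (k - l))) + ennreal (norm (f' l)) * ennreal (norm (g (k - l) - g' (k - l))))"
  proof (rule nn_integral_mono)
    fix l
    have "f l * g (k - l) - f' l * g' (k - l) = (f l - f' l) * g (k - l) + f' l * (g (k - l) - g' (k - l))"
      by (simp add: algebra_simps)
    then have "norm (f l * g (k - l) - f' l * g' (k - l)) \<le> norm (f l - f' l) * norm (g (k - l)) + norm (f' l) * norm (g (k - l) - g' (k - l))"
      using norm_triangle_ineq[of "(f l - f' l) * g (k - l)" "f' l * (g (k - l) - g' (k - l))"] by (simp add: norm_mult)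
    then show "ennreal (norm (f l * g (k - l) - f' l * g' (k - l))) \<le> ennreal (norm (f l - f' l)) * ennreal (norm (g (k - l))) + ennreal (norm (f' l)) * ennreal (norm (g (k - l) - g' (k - l)))"
      by (simp flip: ennreal_mult ennreal_plus add: ennreal_leI)
  qed
  also have "\<dots> = nconv (\<lambda>l. ennreal (norm (f l - f' l))) (\<lambda>l. ennreal (norm (g l))) k + nconv (\<lambda>l. ennreal (norm (f' l))) (\<lambda>l. ennreal (norm (g l - g' l))) k"
    unfolding nconv_def by (rule nn_integral_add) auto
  finally show ?thesis .
qed

lemma norm_div_row_le:
  assumes "\<And>i j. norm (G i j) \<le> B"
  shows "norm (div_row k G i) \<le> 3 * norm (ivec k) * B"
proof -
  have "norm (div_row k G i) \<le> (\<Sum>j\<in>UNIV. norm (\<i> * of_real (ivec k $ j) * G i j))"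
    unfolding div_row_def by (rule norm_sum)
  also have "\<dots> \<le> (\<Sum>j\<in>(UNIV::3 set). norm (ivec k) * B)"
    using component_le_norm_cart[of "ivec k"] assms by (intro sum_mono) (auto simp: norm_mult intro!: mult_mono)
  finally show ?thesis by simp
qed

text \<open>Only the order of magnitude \<open>|k|\<close> matters: \<open>3\<close> comes from the rows of the divergence, \<open>9\<close> from the
gradient part.\<close>

lemma norm_proj_div_le:
  assumes "\<And>i j. norm (G i j) \<le> B"
  shows "norm (proj_div k G i) \<le> 12 * norm (ivec k) * B"
proof (cases "k = 0")
  case True then show ?thesis by (simp add: proj_div_def div_row_def)
next
  case False
  have B: "0 \<le> B" using assms[of 0 0] norm_ge_zero order_trans by blast
  let ?n = "norm (ivec k)"
  have n: "0 < ?n" using False by simp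
  have "norm (\<Sum>j\<in>UNIV. \<i> * of_real (ivec k $ j) * div_row k G j) \<le> (\<Sum>j\<in>UNIV. norm (\<i> * of_real (ivec k $ j) * div_row k G j))"
    by (rule norm_sum)
  also have "\<dots> \<le> (\<Sum>j\<in>(UNIV::3 set). ?n * (3 * ?n * B))"
    using component_le_norm_cart[of "ivec k"] norm_div_row_le[of G B, OF assms] by (intro sum_mono) (auto simp: norm_mult intro!: mult_mono)
  finally have 1: "norm (\<Sum>j\<in>UNIV. \<i> * of_real (ivec k $ j) * div_row k G j) \<le> 9 * ?n\<^sup>2 * B" by (simp add: power2_eq_square)
  have "norm (\<i> * of_real (ivec k $ i) * (of_real (if k = 0 then 0 else - 1 / ?n\<^sup>2) * (\<Sum>j\<in>UNIV. \<i> * of_real (ivec k $ j) * div_row k G j)))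
     = \<bar>ivec k $ i\<bar> * ((1 / ?n\<^sup>2) * norm (\<Sum>j\<in>UNIV. \<i> * of_real (ivec k $ j) * div_row k G j))"
    using False by (simp add: norm_mult norm_divide norm_power)
  also have "\<dots> \<le> ?n * ((1 / ?n\<^sup>2) * (9 * ?n\<^sup>2 * B))"
    using component_le_norm_cart[of "ivec k" i] by (intro mult_mono mult_left_mono 1) auto
  also have "\<dots> = 9 * ?n * B" using n by simp
  finally have 2: "norm (\<i> * of_real (ivec k $ i) * (of_real (if k = 0 then 0 else - 1 / ?n\<^sup>2) * (\<Sum>j\<in>UNIV. \<i> * of_real (ivec k $ j) * div_row k G j))) \<le> 9 * ?n * B" .
  have "norm (proj_div k G i) \<le> norm (div_row k G i) + norm (\<i> * of_real (ivec k $ i) * (of_real (if k = 0 then 0 else - 1 / ?n\<^sup>2) * (\<Sum>j\<in>UNIV. \<i> * of_real (ivec k $ j) * div_row k G j)))"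
    unfolding proj_div_def by (rule norm_triangle_ineq4)
  also have "\<dots> \<le> 3 * ?n * B + 9 * ?n * B" by (intro add_mono norm_div_row_le assms 2)
  also have "\<dots> = 12 * ?n * B" by simp
  finally show ?thesis .
qed

lemma div_row_diff: "div_row k (\<lambda>i j. G i j - H i j) i = div_row k G i - div_row k H i"
  by (simp add: div_row_def right_diff_distrib sum_subtractf)

lemma proj_div_diff: "proj_div k (\<lambda>i j. G i j - H i j) i = proj_div k G i - proj_div k H i"
proof -
  have "(\<Sum>j\<in>UNIV. \<i> * of_real (ivec k $ j) * (div_row k G j - div_row k H j)) =
    (\<Sum>j\<in>UNIV. \<i> * of_real (ivec k $ j) * div_row k G j) - (\<Sum>j\<in>UNIV. \<i> * of_real (ivec k $ j) * div_row k H j)"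
    by (simp add: right_diff_distrib sum_subtractf)
  then show ?thesis unfolding proj_div_def div_row_diff by (simp only: right_diff_distrib) simp
qed

text \<open>From \<open>a\<^sub>i a\<^sub>j - b\<^sub>i b\<^sub>j = (a\<^sub>i - b\<^sub>i) a\<^sub>j + b\<^sub>i (a\<^sub>j - b\<^sub>j)\<close>.\<close>

definition bilinear_bound :: "coeffs \<Rightarrow> coeffs \<Rightarrow> int^3 \<Rightarrow> real \<Rightarrow> ennreal" where
  "bilinear_bound a b k s = nconv (\<lambda>l. ennreal (mag (a \<ominus> b) l s)) (\<lambda>l. ennreal (mag a l s)) k +
     nconv (\<lambda>l. ennreal (mag b l s)) (\<lambda>l. ennreal (mag (a \<ominus> b) l s)) k"

lemma nonlin_diff:
  assumes a: "nsum (\<lambda>l. ennreal (mag a l s)) < \<infinity>" and b: "nsum (\<lambda>l. ennreal (mag b l s)) < \<infinity>"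
  shows "ennreal (norm (nonlin a k s i - nonlin b k s i)) \<le> ennreal (12 * norm (ivec k)) * bilinear_bound a b k s"
proof -
  let ?d = "\<lambda>i k t. a i k t - b i k t"
  have comp: "nsum (\<lambda>l. ennreal (norm (e i l s))) < \<infinity>" if "nsum (\<lambda>l. ennreal (mag e l s)) < \<infinity>" for e :: coeffs and i
    using that by (rule le_less_trans[rotated]) (intro nn_integral_mono ennreal_leI norm_component_le_mag)
  have "nsum (\<lambda>l. ennreal (mag ?d l s)) \<le> nsum (\<lambda>l. ennreal (mag a l s) + ennreal (mag b l s))"
    by (intro nn_integral_mono) (auto intro!: ennreal_leI mag_triangle_diff simp flip: ennreal_plus)
  also have "\<dots> < \<infinity>" using a b by (subst nn_integral_add) auto
  finally have d: "nsum (\<lambda>l. ennreal (mag ?d l s)) < \<infinity>" .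
  have "bilinear_bound a b k s \<le> nsum (\<lambda>l. ennreal (mag ?d l s)) * nsum (\<lambda>l. ennreal (mag a l s)) + nsum (\<lambda>l. ennreal (mag b l s)) * nsum (\<lambda>l. ennreal (mag ?d l s))"
    unfolding bilinear_bound_def by (intro add_mono nconv_le)
  also have "\<dots> < \<infinity>" using a b d by (simp add: ennreal_mult_less_top)
  finally have fin: "bilinear_bound a b k s < \<infinity>" .
  define B where "B = enn2real (bilinear_bound a b k s)"
  have HB: "bilinear_bound a b k s = ennreal B" using fin by (simp add: B_def)
  have "norm (conv (\<lambda>l. a i l s) (\<lambda>l. a j l s) k - conv (\<lambda>l. b i l s) (\<lambda>l. b j l s) k) \<le> B" for i j
  proof -
    have "ennreal (norm (conv (\<lambda>l. a i l s) (\<lambda>l. a j l s) k - conv (\<lambda>l. b i l s) (\<lambda>l. b j l s) k)) \<le>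
       nconv (\<lambda>l. ennreal (norm (a i l s - b i l s))) (\<lambda>l. ennreal (norm (a j l s))) k +
       nconv (\<lambda>l. ennreal (norm (b i l s))) (\<lambda>l. ennreal (norm (a j l s - b j l s))) k"
      by (rule conv_diff) (intro comp a b)+
    also have "\<dots> \<le> bilinear_bound a b k s"
      unfolding bilinear_bound_def
      by (intro add_mono nconv_mono ennreal_leI norm_component_le_mag norm_component_le_mag[of ?d])
    finally show ?thesis unfolding HB by (subst (asm) ennreal_le_iff) (auto simp: B_def)
  qed
  then have "norm (nonlin a k s i - nonlin b k s i) \<le> 12 * norm (ivec k) * B"
    unfolding nonlin_def proj_div_diff[symmetric] by (rule norm_proj_div_le)
  then show ?thesis unfolding HB by (simp add: B_def ennreal_leI flip: ennreal_mult)
qed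

lemma nonlin_zero: "nonlin (\<lambda>i k t. 0) k s i = 0"
  by (simp add: nonlin_def conv_def proj_div_def div_row_def)

lemma Phi_zero_mode: "(\<And>i. c i 0 = 0) \<Longrightarrow> Phi \<mu> c a i 0 t = 0"
  by (simp add: Phi_def nonlin_def proj_div_def div_row_def)

lemma nonlin_measurable [measurable]:
  assumes [measurable]: "\<And>i k. a i k \<in> borel_measurable M"
  shows "(\<lambda>s. nonlin a k s i) \<in> borel_measurable M"
proof -
  have [measurable]: "(\<lambda>s. conv (\<lambda>l. a i l s) (\<lambda>l. a j l s) k) \<in> borel_measurable M" for i j
    unfolding conv_def by (rule borel_measurable_infsum) measurable
  show ?thesis unfolding nonlin_def proj_div_def div_row_def by measurable
qed

lemma Phi_measurable:
  assumes [measurable]: "\<And>i k. a i k \<in> borel_measurable borel"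
  shows "Phi \<mu> c a i k \<in> borel_measurable borel"
proof -
  interpret sigma_finite_measure halfline by (rule sigma_finite_halfline)
  have [measurable]: "(\<lambda>s. nonlin a k s i) \<in> borel_measurable borel" for k i by (rule nonlin_measurable) measurable
  have "(\<lambda>t. \<integral>s. of_real (heat_kernel \<mu> k t s) * nonlin a k s i \<partial>halfline) \<in> borel_measurable borel"
    by (rule borel_measurable_lebesgue_integral) measurable
  then show ?thesis unfolding Phi_def[abs_def] by measurable
qed

lemma bilinear_bound_measurable [measurable]:
  assumes [measurable]: "\<And>i k. a i k \<in> borel_measurable M" "\<And>i k. b i k \<in> borel_measurable M"
  shows "bilinear_bound a b k \<in> borel_measurable M"
  unfolding bilinear_bound_def[abs_def] nconv_def
  by (intro borel_measurable_add borel_measurable_nn_sum) measurable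

lemma nsum_bilinear_bound:
  assumes a: "coeffs_ok a" and b: "coeffs_ok b"
  shows "nsum (\<lambda>k. \<integral>\<^sup>+s. bilinear_bound a b k s \<partial>halfline) \<le> (coeffs_norm a + coeffs_norm b) * coeffs_norm (a \<ominus> b)"
proof -
  let ?d = "\<lambda>i k t. a i k t - b i k t"
  have d: "coeffs_ok ?d" by (rule coeffs_ok_diff[OF a b])
  have [measurable]: "a i k \<in> borel_measurable borel" "b i k \<in> borel_measurable borel" for i k
    using a b by (auto simp: coeffs_ok_def)
  have Z: "AE t in halfline. ennreal (mag e 0 t) = 0" if "coeffs_ok e" for e
    using that by (auto simp: coeffs_ok_def mag_eq_0 elim!: eventually_mono)
  let ?S = "\<lambda>e s. nsum (\<lambda>l. ennreal (mag e l s))"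
  have m: "?S e \<in> borel_measurable halfline" if [measurable]: "\<And>i k. e i k \<in> borel_measurable borel" for e
    by (rule borel_measurable_nn_sum) measurable
  have [measurable]: "?S a \<in> borel_measurable halfline" "?S b \<in> borel_measurable halfline" "?S ?d \<in> borel_measurable halfline"
    by (rule m; measurable)+
  have "nsum (\<lambda>k. \<integral>\<^sup>+s. bilinear_bound a b k s \<partial>halfline) = (\<integral>\<^sup>+s. nsum (\<lambda>k. bilinear_bound a b k s) \<partial>halfline)"
    by (rule nn_sum_swap[symmetric]) measurable
  also have "\<dots> = (\<integral>\<^sup>+s. ?S ?d s * ?S a s + ?S b s * ?S ?d s \<partial>halfline)"
    unfolding bilinear_bound_def by (simp add: nn_integral_add nsum_nconv)
  also have "\<dots> = (\<integral>\<^sup>+s. ?S ?d s * ?S a s \<partial>halfline) + (\<integral>\<^sup>+s. ?S b s * ?S ?d s \<partial>halfline)"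
    by (rule nn_integral_add) measurable
  also have "\<dots> \<le> coeffs_norm ?d * coeffs_norm a + coeffs_norm b * coeffs_norm ?d"
    unfolding coeffs_norm_def by (intro add_mono pair_estimate Z a b d) measurable
  also have "\<dots> = (coeffs_norm a + coeffs_norm b) * coeffs_norm ?d" by (simp add: distrib_right mult.commute)
  finally show ?thesis .
qed

lemma nonlin_integrable:
  assumes a: "coeffs_ok a"
  shows "integrable halfline (\<lambda>s. nonlin a k s i)"
    and "nsum (\<lambda>k. \<integral>\<^sup>+s. ennreal (1 / norm (ivec k)) * ennreal (norm (nonlin a k s i)) \<partial>halfline) < \<infinity>"
proof -
  let ?z = "\<lambda>i k t. 0 :: complex"
  have [measurable]: "a i k \<in> borel_measurable borel" for i k using a by (auto simp: coeffs_ok_def)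
  have [measurable]: "(\<lambda>s. nonlin a k s i) \<in> borel_measurable borel" for k i by (rule nonlin_measurable) measurable
  have AE: "AE s in halfline. ennreal (norm (nonlin a k s i)) \<le> ennreal (12 * norm (ivec k)) * bilinear_bound a ?z k s" for k
    using coeffs_ok_summable[OF a] coeffs_ok_summable[OF coeffs_ok_zero]
    by eventually_elim (use nonlin_diff[of a _ ?z k i] in \<open>simp add: nonlin_zero\<close>)
  have H: "nsum (\<lambda>k. \<integral>\<^sup>+s. bilinear_bound a ?z k s \<partial>halfline) < \<infinity>"
    by (rule le_less_trans[OF nsum_bilinear_bound[OF a coeffs_ok_zero]]) (use a in \<open>simp add: coeffs_ok_def ennreal_mult_less_top\<close>)
  have Hk: "(\<integral>\<^sup>+s. bilinear_bound a ?z k s \<partial>halfline) < \<infinity>"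
    by (rule le_less_trans[OF _ H], rule nn_integral_ge_point) simp
  show "integrable halfline (\<lambda>s. nonlin a k s i)"
    unfolding integrable_iff_bounded
  proof
    have "(\<integral>\<^sup>+s. ennreal (norm (nonlin a k s i)) \<partial>halfline) \<le> (\<integral>\<^sup>+s. ennreal (12 * norm (ivec k)) * bilinear_bound a ?z k s \<partial>halfline)"
      by (rule nn_integral_mono_AE[OF AE])
    also have "\<dots> = ennreal (12 * norm (ivec k)) * (\<integral>\<^sup>+s. bilinear_bound a ?z k s \<partial>halfline)"
      by (rule nn_integral_cmult) measurable
    also have "\<dots> < \<infinity>" using Hk by (simp add: ennreal_mult_less_top)
    finally show "(\<integral>\<^sup>+s. ennreal (norm (nonlin a k s i)) \<partial>halfline) < \<infinity>" .
  qed measurable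
  have "nsum (\<lambda>k. \<integral>\<^sup>+s. ennreal (1 / norm (ivec k)) * ennreal (norm (nonlin a k s i)) \<partial>halfline) \<le>
    nsum (\<lambda>k. 12 * (\<integral>\<^sup>+s. bilinear_bound a ?z k s \<partial>halfline))"
  proof (rule nn_integral_mono)
    fix k
    have "(\<integral>\<^sup>+s. ennreal (1 / norm (ivec k)) * ennreal (norm (nonlin a k s i)) \<partial>halfline) \<le> (\<integral>\<^sup>+s. 12 * bilinear_bound a ?z k s \<partial>halfline)"
    proof (rule nn_integral_mono_AE)
      show "AE s in halfline. ennreal (1 / norm (ivec k)) * ennreal (norm (nonlin a k s i)) \<le> 12 * bilinear_bound a ?z k s"
        using AE[of k]
      proof eventually_elim
        case (elim s)
        have "ennreal (1 / norm (ivec k)) * ennreal (norm (nonlin a k s i)) \<le> ennreal (1 / norm (ivec k)) * (ennreal (12 * norm (ivec k)) * bilinear_bound a ?z k s)"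
          by (intro mult_left_mono elim) simp
        also have "\<dots> = 12 * ((ennreal (1 / norm (ivec k)) * ennreal (norm (ivec k))) * bilinear_bound a ?z k s)"
          by (simp add: ennreal_mult mult_ac)
        also have "\<dots> \<le> 12 * (1 * bilinear_bound a ?z k s)"
          by (intro mult_left_mono mult_right_mono ennreal_mult_inverse_le_1) auto
        finally show ?case by simp
      qed
    qed
    also have "\<dots> = 12 * (\<integral>\<^sup>+s. bilinear_bound a ?z k s \<partial>halfline)" by (rule nn_integral_cmult) measurable
    finally show "(\<integral>\<^sup>+s. ennreal (1 / norm (ivec k)) * ennreal (norm (nonlin a k s i)) \<partial>halfline) \<le> 12 * (\<integral>\<^sup>+s. bilinear_bound a ?z k s \<partial>halfline)" .
  qed
  also have "\<dots> = 12 * nsum (\<lambda>k. \<integral>\<^sup>+s. bilinear_bound a ?z k s \<partial>halfline)" by (rule nn_integral_cmult) simp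
  also have "\<dots> < \<infinity>" using H by (simp add: ennreal_mult_less_top)
  finally show "nsum (\<lambda>k. \<integral>\<^sup>+s. ennreal (1 / norm (ivec k)) * ennreal (norm (nonlin a k s i)) \<partial>halfline) < \<infinity>" .
qed

definition cmag :: "(3 \<Rightarrow> int^3 \<Rightarrow> complex) \<Rightarrow> int^3 \<Rightarrow> real" where
  "cmag c k = norm (\<chi> i. c i k)"

text \<open>\<open>36\<close> is \<open>12\<close> for each of the three components.\<close>

lemma Phi_diff:
  assumes \<mu>: "0 < \<mu>" and a: "coeffs_ok a" and b: "coeffs_ok b"
  shows "coeffs_norm (Phi \<mu> c a \<ominus> Phi \<mu> c' b) \<le>
     ennreal (1 + 1 / \<mu>) * (initial_norm (\<lambda>k. ennreal (cmag (\<lambda>i k. c i k - c' i k) k)) +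
       36 * ((coeffs_norm a + coeffs_norm b) * coeffs_norm (a \<ominus> b)))"
proof -
  have [measurable]: "a i k \<in> borel_measurable borel" "b i k \<in> borel_measurable borel" for i k
    using a b by (auto simp: coeffs_ok_def)
  have [measurable]: "(\<lambda>s. nonlin a k s i) \<in> borel_measurable borel" "(\<lambda>s. nonlin b k s i) \<in> borel_measurable borel" for k i
    by (rule nonlin_measurable; measurable)+
  have [measurable]: "Phi \<mu> c a i k \<in> borel_measurable borel" "Phi \<mu> c' b i k \<in> borel_measurable borel" for i k
    by (rule Phi_measurable; measurable)+
  have ki: "integrable halfline (\<lambda>s. of_real (heat_kernel \<mu> k t s) * nonlin e k s i)" if "coeffs_ok e" for e k t i
  proof (rule Bochner_Integration.integrable_bound[OF nonlin_integrable(1)[OF that, of k i]])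
    have [measurable]: "e i k \<in> borel_measurable borel" for i k using that by (auto simp: coeffs_ok_def)
    have [measurable]: "(\<lambda>s. nonlin e k s i) \<in> borel_measurable borel" by (rule nonlin_measurable) measurable
    show "(\<lambda>s. of_real (heat_kernel \<mu> k t s) * nonlin e k s i) \<in> borel_measurable halfline" by measurable
    show "AE s in halfline. norm (of_real (heat_kernel \<mu> k t s) * nonlin e k s i) \<le> norm (nonlin e k s i)"
      using heat_kernel_le_1[OF \<mu>] heat_kernel_nonneg[of \<mu>] by (intro AE_I2) (simp add: norm_mult mult_left_le_one_le)
  qed
  have pt: "ennreal (mag (Phi \<mu> c a \<ominus> Phi \<mu> c' b) k t) \<le>
     ennreal (heat_kernel \<mu> k t 0) * ennreal (cmag (\<lambda>i k. c i k - c' i k) k) +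
     (\<integral>\<^sup>+s. ennreal (heat_kernel \<mu> k t s) * (ennreal (norm (ivec k)) * (36 * bilinear_bound a b k s)) \<partial>halfline)" for k t
  proof -
    define I where "I i = (\<integral>s. of_real (heat_kernel \<mu> k t s) * nonlin a k s i \<partial>halfline) - (\<integral>s. of_real (heat_kernel \<mu> k t s) * nonlin b k s i \<partial>halfline)" for i
    let ?W = "\<integral>\<^sup>+s. ennreal (heat_kernel \<mu> k t s) * (ennreal (12 * norm (ivec k)) * bilinear_bound a b k s) \<partial>halfline"
    have I: "ennreal (norm (I i)) \<le> ?W" for i
    proof -
      have "I i = (\<integral>s. of_real (heat_kernel \<mu> k t s) * nonlin a k s i - of_real (heat_kernel \<mu> k t s) * nonlin b k s i \<partial>halfline)"
        unfolding I_def by (rule Bochner_Integration.integral_diff[OF ki[OF a] ki[OF b], symmetric])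
      also have "ennreal (norm \<dots>) \<le> (\<integral>\<^sup>+s. ennreal (norm (of_real (heat_kernel \<mu> k t s) * nonlin a k s i - of_real (heat_kernel \<mu> k t s) * nonlin b k s i)) \<partial>halfline)"
        by (intro integral_norm_bound_ennreal Bochner_Integration.integrable_diff ki a b)
      also have "\<dots> \<le> ?W"
      proof (rule nn_integral_mono_AE)
        show "AE s in halfline. ennreal (norm (of_real (heat_kernel \<mu> k t s) * nonlin a k s i - of_real (heat_kernel \<mu> k t s) * nonlin b k s i)) \<le> ennreal (heat_kernel \<mu> k t s) * (ennreal (12 * norm (ivec k)) * bilinear_bound a b k s)"
          using coeffs_ok_summable[OF a] coeffs_ok_summable[OF b]
        proof eventually_elim
          case (elim s)
          have "norm (of_real (heat_kernel \<mu> k t s) * nonlin a k s i - of_real (heat_kernel \<mu> k t s) * nonlin b k s i) = heat_kernel \<mu> k t s * norm (nonlin a k s i - nonlin b k s i)"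
            using heat_kernel_nonneg[of \<mu> k t s] by (simp add: norm_mult flip: right_diff_distrib)
          then have "ennreal (norm (of_real (heat_kernel \<mu> k t s) * nonlin a k s i - of_real (heat_kernel \<mu> k t s) * nonlin b k s i)) = ennreal (heat_kernel \<mu> k t s) * ennreal (norm (nonlin a k s i - nonlin b k s i))"
            using heat_kernel_nonneg[of \<mu> k t s] by (simp add: ennreal_mult)
          also have "\<dots> \<le> ennreal (heat_kernel \<mu> k t s) * (ennreal (12 * norm (ivec k)) * bilinear_bound a b k s)"
            by (intro mult_left_mono nonlin_diff elim) simp
          finally show ?case .
        qed
      qed
      finally show ?thesis .
    qed
    have eq: "(\<chi> i. Phi \<mu> c a i k t - Phi \<mu> c' b i k t) = heat_kernel \<mu> k t 0 *\<^sub>R (\<chi> i. c i k - c' i k) - (\<chi> i. I i)"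
      by (simp only: vec_eq_iff vec_lambda_beta vector_minus_component vector_scaleR_component)
        (simp add: Phi_def I_def algebra_simps scaleR_conv_of_real)
    have "mag (Phi \<mu> c a \<ominus> Phi \<mu> c' b) k t \<le> norm (heat_kernel \<mu> k t 0 *\<^sub>R (\<chi> i. c i k - c' i k)) + norm (\<chi> i. I i)"
      unfolding mag_def eq by (rule norm_triangle_ineq4)
    also have "\<dots> \<le> heat_kernel \<mu> k t 0 * cmag (\<lambda>i k. c i k - c' i k) k + (\<Sum>i\<in>UNIV. norm (I i))"
      using mag_le_sum[of "\<lambda>i k t. I i" k t] heat_kernel_nonneg[of \<mu> k t 0] by (simp add: cmag_def mag_def)
    finally have "ennreal (mag (Phi \<mu> c a \<ominus> Phi \<mu> c' b) k t) \<le> ennreal (heat_kernel \<mu> k t 0 * cmag (\<lambda>i k. c i k - c' i k) k + (\<Sum>i\<in>UNIV. norm (I i)))"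
      by (rule ennreal_leI)
    also have "\<dots> = ennreal (heat_kernel \<mu> k t 0) * ennreal (cmag (\<lambda>i k. c i k - c' i k) k) + (\<Sum>i\<in>UNIV. ennreal (norm (I i)))"
      using heat_kernel_nonneg[of \<mu> k t 0] by (subst ennreal_plus) (auto simp: ennreal_mult cmag_def sum_nonneg)
    also have "(\<Sum>i\<in>UNIV. ennreal (norm (I i))) \<le> (\<Sum>i\<in>(UNIV::3 set). ?W)" by (intro sum_mono I)
    also have "\<dots> = 3 * ?W" by simp
    also have "\<dots> = (\<integral>\<^sup>+s. 3 * (ennreal (heat_kernel \<mu> k t s) * (ennreal (12 * norm (ivec k)) * bilinear_bound a b k s)) \<partial>halfline)"
      by (rule nn_integral_cmult[symmetric]) measurable
    also have "\<dots> = (\<integral>\<^sup>+s. ennreal (heat_kernel \<mu> k t s) * (ennreal (norm (ivec k)) * (36 * bilinear_bound a b k s)) \<partial>halfline)"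
    proof (rule nn_integral_cong)
      fix s
      have "3 * ennreal (12 * norm (ivec k)) = 36 * ennreal (norm (ivec k))"
        by (simp add: ennreal_mult flip: mult.assoc)
      then show "3 * (ennreal (heat_kernel \<mu> k t s) * (ennreal (12 * norm (ivec k)) * bilinear_bound a b k s)) = ennreal (heat_kernel \<mu> k t s) * (ennreal (norm (ivec k)) * (36 * bilinear_bound a b k s))"
        by (metis (no_types, opaque_lifting) mult.commute mult.left_commute)
    qed
    finally show ?thesis by (simp add: add_left_mono)
  qed
  have Wm: "(\<lambda>t. \<integral>\<^sup>+s. ennreal (heat_kernel \<mu> k t s) * (ennreal (norm (ivec k)) * (36 * bilinear_bound a b k s)) \<partial>halfline) \<in> borel_measurable halfline" for k
    by (rule sigma_finite_measure.borel_measurable_nn_integral[OF sigma_finite_halfline]) measurable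
  have "coeffs_norm (Phi \<mu> c a \<ominus> Phi \<mu> c' b) \<le> y_norm (\<lambda>k t. ennreal (heat_kernel \<mu> k t 0) * ennreal (cmag (\<lambda>i k. c i k - c' i k) k) +
     (\<integral>\<^sup>+s. ennreal (heat_kernel \<mu> k t s) * (ennreal (norm (ivec k)) * (36 * bilinear_bound a b k s)) \<partial>halfline))"
    unfolding coeffs_norm_def by (rule y_norm_mono_AE) (measurable, intro AE_I2 pt)
  also have "\<dots> \<le> y_norm (\<lambda>k t. ennreal (heat_kernel \<mu> k t 0) * ennreal (cmag (\<lambda>i k. c i k - c' i k) k)) +
     y_norm (\<lambda>k t. \<integral>\<^sup>+s. ennreal (heat_kernel \<mu> k t s) * (ennreal (norm (ivec k)) * (36 * bilinear_bound a b k s)) \<partial>halfline)"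
    by (rule y_norm_add[OF _ Wm]) measurable
  also have "\<dots> \<le> ennreal (1 + 1 / \<mu>) * initial_norm (\<lambda>k. ennreal (cmag (\<lambda>i k. c i k - c' i k) k)) +
     ennreal (1 + 1 / \<mu>) * nsum (\<lambda>k. \<integral>\<^sup>+s. 36 * bilinear_bound a b k s \<partial>halfline)"
    by (intro add_mono heat_estimate duhamel_estimate \<mu>) measurable
  also have "nsum (\<lambda>k. \<integral>\<^sup>+s. 36 * bilinear_bound a b k s \<partial>halfline) = 36 * nsum (\<lambda>k. \<integral>\<^sup>+s. bilinear_bound a b k s \<partial>halfline)"
    by (simp add: nn_integral_cmult)
  also have "\<dots> \<le> 36 * ((coeffs_norm a + coeffs_norm b) * coeffs_norm (a \<ominus> b))"
    by (intro mult_left_mono nsum_bilinear_bound a b) simp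
  finally show ?thesis by (simp add: distrib_left add_left_mono mult_left_mono)
qed

section \<open>The fixed-point equation\<close>

text \<open>Finiteness of \<open>x\<close> allows its subtraction.\<close>

lemma ennreal_half_absorb:
  fixes x p :: ennreal
  assumes "x \<le> p + ennreal (1 / 2) * x" "x < \<infinity>" shows "x \<le> 2 * p"
proof (cases "p = \<infinity>")
  case True then show ?thesis by (simp add: ennreal_mult_top)
next
  case False
  then obtain r s where x: "x = ennreal r" "0 \<le> r" and p: "p = ennreal s" "0 \<le> s"
    using assms(2) by (cases x; cases p) auto
  have "ennreal (s + 1 / 2 * r) = ennreal s + ennreal (1 / 2 * r)" using x(2) p(2) by (intro ennreal_plus) auto
  moreover have "ennreal (1 / 2 * r) = ennreal (1 / 2) * ennreal r" using x(2) by (intro ennreal_mult) auto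
  ultimately have "ennreal r \<le> ennreal (s + 1 / 2 * r)" using assms(1) unfolding x p by simp
  then have "r \<le> s + 1 / 2 * r" using x(2) p(2) by (subst (asm) ennreal_le_iff) auto
  then have "r \<le> 2 * s" by simp
  then show ?thesis unfolding x p using ennreal_leI[of r "2 * s"] p(2) by (simp add: ennreal_mult)
qed

lemma ennreal_geometric_zero:
  fixes y C :: ennreal
  assumes le: "\<And>m. y \<le> ennreal ((1 / 2) ^ m) * C" and C: "C < \<infinity>" shows "y = 0"
proof -
  obtain c where c: "C = ennreal c" "0 \<le> c" using C by (cases C) auto
  have "y \<le> C" using le[of 0] by simp
  then have "y < \<infinity>" using C by order
  then obtain r where r: "y = ennreal r" "0 \<le> r" by (cases y) auto
  have "r \<le> (1 / 2) ^ m * c" for m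
    using le[of m] r c by (simp flip: ennreal_mult)
  moreover have "(\<lambda>m. (1 / 2) ^ m * c) \<longlonglongrightarrow> 0 * c" by (intro tendsto_intros LIMSEQ_realpow_zero) auto
  ultimately have "r \<le> 0 * c" by (intro LIMSEQ_le_const) auto
  then show ?thesis using r by simp
qed

lemma coeffs_norm_triangle:
  assumes [measurable]: "\<And>i k. a i k \<in> borel_measurable borel" "\<And>i k. b i k \<in> borel_measurable borel" "\<And>i k. c i k \<in> borel_measurable borel"
  shows "coeffs_norm (a \<ominus> c) \<le> coeffs_norm (a \<ominus> b) + coeffs_norm (b \<ominus> c)"
proof -
  have le: "mag (a \<ominus> c) k t \<le> mag (a \<ominus> b) k t + mag (b \<ominus> c) k t" for k t
    using mag_triangle[of "\<lambda>i k t. a i k t - b i k t" "\<lambda>i k t. b i k t - c i k t" k t] by simp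
  have "coeffs_norm (a \<ominus> c) \<le> y_norm (\<lambda>k t. ennreal (mag (a \<ominus> b) k t) + ennreal (mag (b \<ominus> c) k t))"
    unfolding coeffs_norm_def
    by (rule y_norm_mono_AE, measurable) (auto intro!: AE_I2 ennreal_leI le simp flip: ennreal_plus)
  also have "\<dots> \<le> coeffs_norm (a \<ominus> b) + coeffs_norm (b \<ominus> c)" unfolding coeffs_norm_def by (rule y_norm_add) measurable
  finally show ?thesis .
qed

lemma coeffs_norm_commute: "coeffs_norm (a \<ominus> b) = coeffs_norm (b \<ominus> a)"
proof -
  have "mag (a \<ominus> b) k t = mag (b \<ominus> a) k t" for k t
    unfolding mag_def using norm_minus_commute[of "\<chi> i. a i k t" "\<chi> i. b i k t"] by (simp add: minus_vec_def)
  then show ?thesis by (simp add: coeffs_norm_def)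
qed

lemma coeffs_norm_eq_0_AE:
  assumes [measurable]: "\<And>i k. e i k \<in> borel_measurable borel" and "coeffs_norm e = 0" "k \<noteq> 0"
  shows "AE t in halfline. \<forall>i. e i k t = 0"
proof -
  have "x1_norm (\<lambda>k t. ennreal (mag e k t)) = 0" using assms(2) by (simp add: coeffs_norm_def y_norm_def)
  then have "(\<integral>\<^sup>+t. ennreal (norm (ivec k)) * ennreal (mag e k t) \<partial>halfline) = 0"
    by (simp add: x1_norm_def nn_integral_0_iff_AE AE_count_space)
  then have "AE t in halfline. ennreal (norm (ivec k)) * ennreal (mag e k t) = 0"
    by (subst (asm) nn_integral_0_iff_AE) auto
  then show ?thesis
  proof eventually_elim
    case (elim t)
    then have "mag e k t \<le> 0" using assms(3) by (auto simp: ennreal_eq_0_iff)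
    then show ?case using norm_component_le_mag[of e _ k t] order_trans norm_le_zero_iff by blast
  qed
qed

text \<open>\<open>A\<close> is the constant in \<open>heat_estimate\<close> and \<open>duhamel_estimate\<close>.\<close>

locale viscosity =
  fixes \<mu> :: real and A :: ennreal
  assumes \<mu>: "0 < \<mu>" and A_def: "A = ennreal (1 + 1 / \<mu>)"
begin

abbreviation "ini c \<equiv> initial_norm (\<lambda>k. ennreal (cmag c k))"

definition solves :: "(3 \<Rightarrow> int^3 \<Rightarrow> complex) \<Rightarrow> coeffs \<Rightarrow> bool" where
  "solves c a \<longleftrightarrow> coeffs_ok a \<and> (\<forall>i k. AE t in halfline. a i k t = Phi \<mu> c a i k t)"

lemma A_finite: "A < \<infinity>" by (simp add: A_def)

text \<open>On the ball where the smallness assumption holds, \<open>\<Phi>\<close> is a contraction with factor \<open>1/2\<close>.\<close>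

lemma contraction:
  assumes "coeffs_ok a" "coeffs_ok b" and small: "A * 36 * (coeffs_norm a + coeffs_norm b) \<le> ennreal (1 / 2)"
  shows "coeffs_norm (Phi \<mu> c a \<ominus> Phi \<mu> c' b) \<le>
    A * ini (\<lambda>i k. c i k - c' i k) + ennreal (1 / 2) * coeffs_norm (a \<ominus> b)"
proof -
  have "coeffs_norm (Phi \<mu> c a \<ominus> Phi \<mu> c' b) \<le>
    A * ini (\<lambda>i k. c i k - c' i k) + A * 36 * (coeffs_norm a + coeffs_norm b) * coeffs_norm (a \<ominus> b)"
    using Phi_diff[OF \<mu> assms(1,2), of c c', folded A_def] by (simp only: distrib_left[of A] mult.assoc)
  also have "\<dots> \<le> A * ini (\<lambda>i k. c i k - c' i k) + ennreal (1 / 2) * coeffs_norm (a \<ominus> b)"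
    by (intro add_left_mono mult_right_mono small) simp
  finally show ?thesis .
qed

text \<open>The difference of two solutions is the difference of their images under \<open>\<Phi>\<close>; the part with the factor \<open>1/2\<close> is
absorbed on the left.\<close>

lemma stability:
  assumes a: "solves c a" and b: "solves c' b" and small: "A * 36 * (coeffs_norm a + coeffs_norm b) \<le> ennreal (1 / 2)"
  shows "coeffs_norm (a \<ominus> b) \<le> 2 * (A * ini (\<lambda>i k. c i k - c' i k))"
proof (rule ennreal_half_absorb)
  have ok: "coeffs_ok a" "coeffs_ok b" using a b by (auto simp: solves_def)
  have [measurable]: "a i k \<in> borel_measurable borel" "b i k \<in> borel_measurable borel" for i k
    using ok by (auto simp: coeffs_ok_def)
  have [measurable]: "Phi \<mu> c a i k \<in> borel_measurable borel" "Phi \<mu> c' b i k \<in> borel_measurable borel" for i k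
    by (rule Phi_measurable; measurable)+
  show "coeffs_norm (a \<ominus> b) < \<infinity>" using coeffs_ok_diff[OF ok] by (simp add: coeffs_ok_def)
  have "coeffs_norm (a \<ominus> b) = coeffs_norm (Phi \<mu> c a \<ominus> Phi \<mu> c' b)"
  proof (rule coeffs_norm_cong_AE)
    fix i k
    have "AE t in halfline. a i k t = Phi \<mu> c a i k t" "AE t in halfline. b i k t = Phi \<mu> c' b i k t"
      using a b by (auto simp: solves_def)
    then show "AE t in halfline. a i k t - b i k t = Phi \<mu> c a i k t - Phi \<mu> c' b i k t"
      by eventually_elim simp
  qed measurable
  also have "\<dots> \<le> A * ini (\<lambda>i k. c i k - c' i k) + ennreal (1 / 2) * coeffs_norm (a \<ominus> b)"
    by (rule contraction[OF ok small])
  finally show "coeffs_norm (a \<ominus> b) \<le> A * ini (\<lambda>i k. c i k - c' i k) + ennreal (1 / 2) * coeffs_norm (a \<ominus> b)" .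
qed

lemma uniqueness:
  assumes a: "solves c a" and b: "solves c b" and small: "A * 36 * (coeffs_norm a + coeffs_norm b) \<le> ennreal (1 / 2)"
  shows "AE t in halfline. a i k t = b i k t"
proof -
  have ok: "coeffs_ok a" "coeffs_ok b" using a b by (auto simp: solves_def)
  have [measurable]: "a i k \<in> borel_measurable borel" "b i k \<in> borel_measurable borel" for i k
    using ok by (auto simp: coeffs_ok_def)
  have "ini (\<lambda>i k. c i k - c i k) = 0"
    by (simp add: initial_norm_def cmag_def mag_eq_0[of "\<lambda>i k t. 0", unfolded mag_def])
  then have "coeffs_norm (a \<ominus> b) \<le> 0"
    using stability[OF a b small] by simp
  then have Z: "coeffs_norm (a \<ominus> b) = 0" by simp
  have "AE t in halfline. \<forall>i. a i k t - b i k t = 0"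
  proof (cases "k = 0")
    case True
    then show ?thesis using coeffs_ok_diff[OF ok] by (simp add: coeffs_ok_def)
  next
    case False
    then show ?thesis using coeffs_norm_eq_0_AE[of "\<lambda>i k t. a i k t - b i k t" k] Z by simp
  qed
  then show ?thesis by (auto elim!: eventually_mono)
qed

text \<open>Under the smallness assumption \<open>\<Phi>\<close> maps the ball of radius \<open>2 * (A * ini c)\<close> into itself and halves
distances there, so that the iterates of \<open>0\<close> converge geometrically.\<close>

context
  fixes c :: "3 \<Rightarrow> int^3 \<Rightarrow> complex"
  assumes c0: "\<And>i. c i 0 = 0" and cfin: "ini c < \<infinity>"
    and small: "A * 36 * (2 * (A * ini c) + 2 * (A * ini c)) \<le> ennreal (1 / 2)"
begin

primrec picard :: "nat \<Rightarrow> coeffs" where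
  "picard 0 = (\<lambda>i k t. 0)"
| "picard (Suc n) = Phi \<mu> c (picard n)"

definition picard_step :: "nat \<Rightarrow> coeffs" where
  "picard_step n = (picard (Suc n) \<ominus> picard n)"

definition picard_limit :: coeffs where
  "picard_limit i k t = lim (\<lambda>n. picard n i k t)"

lemma Phi_zero: "Phi \<mu> (\<lambda>i k. 0) (\<lambda>i k t. 0) i k t = 0"
  by (simp add: Phi_def nonlin_zero)

lemma small': "x \<le> 2 * (A * ini c) \<Longrightarrow> y \<le> 2 * (A * ini c) \<Longrightarrow> A * 36 * (x + y) \<le> ennreal (1 / 2)"
  by (rule order_trans[OF mult_left_mono[OF add_mono] small]) auto

lemma Phi_bound:
  assumes a: "coeffs_ok a" and le: "coeffs_norm a \<le> 2 * (A * ini c)"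
  shows "coeffs_norm (Phi \<mu> c a) \<le> 2 * (A * ini c)"
proof -
  have "coeffs_norm (\<lambda>i k t. Phi \<mu> c a i k t - Phi \<mu> (\<lambda>i k. 0) (\<lambda>i k t. 0) i k t) \<le>
    A * ini (\<lambda>i k. c i k - 0) + ennreal (1 / 2) * coeffs_norm (\<lambda>i k t. a i k t - 0)"
    by (rule contraction[OF a coeffs_ok_zero]) (rule small'[OF le], simp)
  then have "coeffs_norm (Phi \<mu> c a) \<le> A * ini c + ennreal (1 / 2) * coeffs_norm a" by (simp add: Phi_zero)
  also have "\<dots> \<le> A * ini c + ennreal (1 / 2) * (2 * (A * ini c))"
    by (intro add_left_mono mult_left_mono le) simp
  also have "ennreal (1 / 2) * (2 * (A * ini c)) = A * ini c"
  proof -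
    have "ennreal (1 / 2) * 2 = ennreal (1 / 2 * 2)" by (subst ennreal_mult) auto
    then have "ennreal (1 / 2) * 2 = 1" by simp
    then show ?thesis by (simp flip: mult.assoc)
  qed
  also have "A * ini c + A * ini c = 2 * (A * ini c)" by (simp add: mult_2)
  finally show ?thesis .
qed

lemma picard_props: "coeffs_ok (picard n) \<and> coeffs_norm (picard n) \<le> 2 * (A * ini c) \<and> (\<forall>i t. picard n i 0 t = 0)"
proof (induction n)
  case 0 show ?case by (simp add: coeffs_ok_zero)
next
  case (Suc n)
  have "coeffs_norm (Phi \<mu> c (picard n)) \<le> 2 * (A * ini c)" using Suc by (intro Phi_bound) auto
  moreover have "2 * (A * ini c) < \<infinity>" using A_finite cfin by (simp add: ennreal_mult_less_top)
  moreover have "Phi \<mu> c (picard n) i k \<in> borel_measurable borel" for i k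
    using Suc by (intro Phi_measurable) (auto simp: coeffs_ok_def)
  moreover have "Phi \<mu> c (picard n) i 0 t = 0" for i t using Phi_zero_mode[of c, OF c0] by simp
  ultimately show ?case by (auto simp: coeffs_ok_def intro: le_less_trans)
qed

lemma picard_ok: "coeffs_ok (picard n)" and picard_norm: "coeffs_norm (picard n) \<le> 2 * (A * ini c)" and picard_zero: "picard n i 0 t = 0"
  using picard_props by auto

lemma picard_measurable [measurable]: "picard n i k \<in> borel_measurable borel"
  using picard_ok by (auto simp: coeffs_ok_def)

lemma picard_step_measurable [measurable]: "picard_step n i k \<in> borel_measurable borel"
  unfolding picard_step_def by measurable

lemma half_power: "ennreal ((1 / 2) ^ Suc n) = ennreal (1 / 2) * ennreal ((1 / 2) ^ n)"
  by (subst ennreal_mult[symmetric]) auto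

lemma picard_step_norm: "coeffs_norm (picard_step n) \<le> ennreal ((1 / 2) ^ n) * (A * ini c)"
proof (induction n)
  case 0
  have "coeffs_norm (\<lambda>i k t. Phi \<mu> c (\<lambda>i k t. 0) i k t - Phi \<mu> (\<lambda>i k. 0) (\<lambda>i k t. 0) i k t) \<le>
    A * ini (\<lambda>i k. c i k - 0) + ennreal (1 / 2) * coeffs_norm (\<lambda>i k t. 0 - 0)"
    by (rule contraction[OF coeffs_ok_zero coeffs_ok_zero]) simp
  then show ?case by (simp add: Phi_zero picard_step_def)
next
  case (Suc n)
  have "coeffs_norm (\<lambda>i k t. Phi \<mu> c (picard (Suc n)) i k t - Phi \<mu> c (picard n) i k t) \<le>
    A * ini (\<lambda>i k. c i k - c i k) + ennreal (1 / 2) * coeffs_norm (picard (Suc n) \<ominus> picard n)"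
    by (rule contraction[OF picard_ok picard_ok small'[OF picard_norm picard_norm]])
  also have "ini (\<lambda>i k. c i k - c i k) = 0"
    by (simp add: initial_norm_def cmag_def mag_eq_0[of "\<lambda>i k t. 0", unfolded mag_def])
  finally have "coeffs_norm (picard_step (Suc n)) \<le> ennreal (1 / 2) * coeffs_norm (picard_step n)" by (simp add: picard_step_def)
  also have "\<dots> \<le> ennreal (1 / 2) * (ennreal ((1 / 2) ^ n) * (A * ini c))"
    by (intro mult_left_mono Suc) simp
  also have "\<dots> = ennreal ((1 / 2) ^ Suc n) * (A * ini c)"
    by (simp only: half_power mult.assoc)
  finally show ?case .
qed

lemma picard_step_norm_tail: "(\<Sum>n. coeffs_norm (picard_step (n + m))) \<le> ennreal ((1 / 2) ^ m) * (2 * (A * ini c))"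
proof -
  have "(\<Sum>n. coeffs_norm (picard_step (n + m))) \<le> (\<Sum>n. ennreal ((1 / 2) ^ (n + m)) * (A * ini c))"
    by (intro suminf_le picard_step_norm) auto
  also have "\<dots> = (\<Sum>n. ennreal ((1 / 2) ^ (n + m))) * (A * ini c)" by simp
  also have "(\<Sum>n. ennreal ((1 / 2) ^ (n + m))) = ennreal (2 * (1 / 2) ^ m)"
  proof (rule suminf_ennreal_eq)
    have "(\<lambda>n. (1 / 2) ^ n * (1 / 2 :: real) ^ m) sums (1 / (1 - 1 / 2) * (1 / 2) ^ m)"
      by (intro sums_mult2 geometric_sums) simp
    then show "(\<lambda>n. (1 / 2 :: real) ^ (n + m)) sums (2 * (1 / 2) ^ m)" by (simp add: power_add)
  qed simp
  also have "ennreal (2 * (1 / 2) ^ m) * (A * ini c) = ennreal ((1 / 2) ^ m) * (2 * (A * ini c))"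
    by (simp add: ennreal_mult mult_ac)
  finally show ?thesis .
qed

text \<open>The telescoping series has a finite norm, hence converges absolutely for almost every time and all
frequencies at once.\<close>

lemma picard_step_AE: "AE t in halfline. \<forall>k. (\<Sum>n. ennreal (mag (picard_step n) k t)) < \<infinity>"
proof -
  have "AE t in halfline. nsum (\<lambda>k. \<Sum>n. ennreal (mag (picard_step n) k t)) < \<infinity>"
  proof (rule y_norm_AE_finite)
    show "AE t in halfline. (\<Sum>n. ennreal (mag (picard_step n) 0 t)) = 0"
      by (simp add: mag_eq_0 picard_step_def picard_zero del: picard.simps)
    have "y_norm (\<lambda>k t. \<Sum>n. ennreal (mag (picard_step n) k t)) \<le> (\<Sum>n. coeffs_norm (picard_step n))"
      unfolding coeffs_norm_def by (rule y_norm_suminf) measurable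
    also have "\<dots> \<le> 2 * (A * ini c)" using picard_step_norm_tail[of 0] by simp
    also have "\<dots> < \<infinity>" using A_finite cfin by (simp add: ennreal_mult_less_top)
    finally show "y_norm (\<lambda>k t. \<Sum>n. ennreal (mag (picard_step n) k t)) < \<infinity>" .
  qed measurable
  then show ?thesis
  proof eventually_elim
    case (elim t)
    have "(\<Sum>n. ennreal (mag (picard_step n) k t)) \<le> nsum (\<lambda>k. \<Sum>n. ennreal (mag (picard_step n) k t))" for k
      by (rule nn_integral_ge_point) simp
    then show ?case using elim le_less_trans by blast
  qed
qed

lemma picard_limit_bound:
  assumes fin: "(\<Sum>n. ennreal (mag (picard_step n) k t)) < \<infinity>"
  shows "ennreal (mag (picard_limit \<ominus> picard m) k t) \<le> (\<Sum>n. ennreal (mag (picard_step (n + m)) k t))"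
proof -
  define v where "v n = (\<chi> i. picard_step n i k t)" for n
  define x where "x n = (\<chi> i. picard n i k t)" for n
  have nv: "norm (v n) = mag (picard_step n) k t" for n by (simp add: v_def mag_def)
  have sn: "summable (\<lambda>n. norm (v n))"
    unfolding nv using fin by (intro summable_suminf_not_top) auto
  then have s: "summable v" by (rule summable_norm_cancel)
  have vx: "v n = x (Suc n) - x n" for n by (simp add: v_def x_def picard_step_def vec_eq_iff)
  have x0: "x 0 = 0" by (simp add: x_def vec_eq_iff)
  have sum: "(\<Sum>n<m. v n) = x m" for m unfolding vx sum_lessThan_telescope by (simp add: x0)
  have "(\<lambda>m. x m) \<longlonglongrightarrow> suminf v" using summable_LIMSEQ[OF s] by (simp add: sum)
  then have "(\<lambda>m. x m $ i) \<longlonglongrightarrow> suminf v $ i" for i by (rule tendsto_vec_nth)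
  then have lim: "picard_limit i k t = suminf v $ i" for i unfolding picard_limit_def x_def by (simp add: limI)
  have "(\<chi> i. picard_limit i k t - picard m i k t) = suminf v - x m" by (simp add: vec_eq_iff lim x_def)
  also have "\<dots> = (\<Sum>n. v (n + m))" using suminf_minus_initial_segment[OF s, of m] by (simp add: sum)
  finally have "mag (picard_limit \<ominus> picard m) k t = norm (\<Sum>n. v (n + m))" by (simp add: mag_def)
  also have "\<dots> \<le> (\<Sum>n. norm (v (n + m)))" using sn by (intro summable_norm summable_ignore_initial_segment[where f="\<lambda>n. norm (v n)"])
  finally have "ennreal (mag (picard_limit \<ominus> picard m) k t) \<le> ennreal (\<Sum>n. norm (v (n + m)))" by (rule ennreal_leI)
  also have "\<dots> = (\<Sum>n. ennreal (norm (v (n + m))))" using sn by (intro suminf_ennreal2[symmetric] summable_ignore_initial_segment[where f="\<lambda>n. norm (v n)"]) auto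
  finally show ?thesis by (simp add: nv)
qed

lemma picard_limit_measurable [measurable]: "picard_limit i k \<in> borel_measurable borel"
  unfolding picard_limit_def[abs_def] by (rule borel_measurable_lim_metric) measurable

lemma picard_limit_norm_iter: "coeffs_norm (picard_limit \<ominus> picard m) \<le> ennreal ((1 / 2) ^ m) * (2 * (A * ini c))"
proof -
  have "coeffs_norm (picard_limit \<ominus> picard m) \<le> y_norm (\<lambda>k t. \<Sum>n. ennreal (mag (picard_step (n + m)) k t))"
    unfolding coeffs_norm_def
  proof (rule y_norm_mono_AE)
    show "AE t in halfline. ennreal (mag (picard_limit \<ominus> picard m) k t) \<le> (\<Sum>n. ennreal (mag (picard_step (n + m)) k t))" for k
      using picard_step_AE by eventually_elim (auto intro: picard_limit_bound)
  qed measurable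
  also have "\<dots> \<le> (\<Sum>n. coeffs_norm (picard_step (n + m)))" unfolding coeffs_norm_def by (rule y_norm_suminf) measurable
  also have "\<dots> \<le> ennreal ((1 / 2) ^ m) * (2 * (A * ini c))" by (rule picard_step_norm_tail)
  finally show ?thesis .
qed

lemma picard_limit_zero: "picard_limit i 0 t = 0"
  by (simp add: picard_limit_def picard_zero)

lemma picard_limit_norm: "coeffs_norm picard_limit \<le> 2 * (A * ini c)"
  using picard_limit_norm_iter[of 0] by simp

lemma picard_limit_ok: "coeffs_ok picard_limit"
proof -
  have "2 * (A * ini c) < \<infinity>" using A_finite cfin by (simp add: ennreal_mult_less_top)
  then have "coeffs_norm picard_limit < \<infinity>" using picard_limit_norm by order
  then show ?thesis by (simp add: coeffs_ok_def picard_limit_zero)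
qed

text \<open>Both the distance of the limit to the iterates and that of its image to the next iterates tend
to \<open>0\<close>, so the limit and its image differ by a sequence of norm \<open>0\<close>.\<close>

lemma picard_limit_solves: "solves c picard_limit"
proof -
  have [measurable]: "Phi \<mu> c picard_limit i k \<in> borel_measurable borel" for i k by (rule Phi_measurable) measurable
  have "coeffs_norm (picard_limit \<ominus> Phi \<mu> c picard_limit) = 0"
  proof (rule ennreal_geometric_zero)
    show "2 * (A * ini c) < \<infinity>" using A_finite cfin by (simp add: ennreal_mult_less_top)
    fix m
    let ?C = "2 * (A * ini c)"
    have "coeffs_norm (picard_limit \<ominus> Phi \<mu> c picard_limit) \<le> coeffs_norm (picard_limit \<ominus> picard (Suc m)) + coeffs_norm (picard (Suc m) \<ominus> Phi \<mu> c picard_limit)"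
      by (rule coeffs_norm_triangle) measurable
    also have "\<dots> \<le> ennreal ((1 / 2) ^ Suc m) * ?C + (A * ini (\<lambda>i k. c i k - c i k) + ennreal (1 / 2) * coeffs_norm (picard m \<ominus> picard_limit))"
      unfolding picard.simps(2)
      using contraction[OF picard_ok[of m] picard_limit_ok small'[OF picard_norm picard_limit_norm], of c c] picard_limit_norm_iter[of "Suc m"]
      by (intro add_mono) auto
    also have "ini (\<lambda>i k. c i k - c i k) = 0"
      by (simp add: initial_norm_def cmag_def mag_eq_0[of "\<lambda>i k t. 0", unfolded mag_def])
    also have "ennreal ((1 / 2) ^ Suc m) * ?C + (A * 0 + ennreal (1 / 2) * coeffs_norm (picard m \<ominus> picard_limit))
       \<le> ennreal ((1 / 2) ^ Suc m) * ?C + ennreal (1 / 2) * (ennreal ((1 / 2) ^ m) * ?C)"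
      using picard_limit_norm_iter[of m] by (simp add: coeffs_norm_commute[of "picard m"] add_left_mono mult_left_mono)
    also have "\<dots> = (ennreal ((1 / 2) ^ Suc m) + ennreal ((1 / 2) ^ Suc m)) * ?C"
      by (simp only: half_power distrib_right mult.assoc)
    also have "ennreal ((1 / 2) ^ Suc m) + ennreal ((1 / 2) ^ Suc m) = ennreal ((1 / 2) ^ m)"
      by (simp flip: ennreal_plus)
    finally show "coeffs_norm (picard_limit \<ominus> Phi \<mu> c picard_limit) \<le> ennreal ((1 / 2) ^ m) * ?C" .
  qed
  then have Z: "k \<noteq> 0 \<Longrightarrow> AE t in halfline. \<forall>i. picard_limit i k t - Phi \<mu> c picard_limit i k t = 0" for k
    using coeffs_norm_eq_0_AE[of "\<lambda>i k t. picard_limit i k t - Phi \<mu> c picard_limit i k t" k] by simp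
  have "AE t in halfline. picard_limit i k t = Phi \<mu> c picard_limit i k t" for i k
  proof (cases "k = 0")
    case True then show ?thesis using Phi_zero_mode[of c, OF c0] by (simp add: picard_limit_zero)
  next
    case False from Z[OF this] show ?thesis by eventually_elim simp
  qed
  then show ?thesis using picard_limit_ok by (simp add: solves_def)
qed

end

lemma existence:
  assumes "\<And>i. c i 0 = 0" "ini c < \<infinity>" "A * 36 * (2 * (A * ini c) + 2 * (A * ini c)) \<le> ennreal (1 / 2)"
  obtains a where "solves c a" "\<And>i t. a i 0 t = 0" "coeffs_norm a \<le> 2 * (A * ini c)"
  using picard_limit_solves[OF assms] picard_limit_zero[OF assms] picard_limit_norm[OF assms] by blast

end

section \<open>Mild solutions in Fourier variables\<close>

definition coeffs_of :: "(real \<times> (real^3)) functional^3 \<Rightarrow> coeffs" where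
  "coeffs_of v i k = time_coeff (v $ i) k"

definition initial_coeffs :: "(real^3) functional^3 \<Rightarrow> 3 \<Rightarrow> int^3 \<Rightarrow> complex" where
  "initial_coeffs u i k = fourier_coeff (u $ i) k"

lemma infsum_nonzero_modes:
  fixes f g :: "int^3 \<Rightarrow> ennreal"
  assumes "\<And>k. k \<noteq> 0 \<Longrightarrow> f k = g k" "g 0 = 0"
  shows "infsum f (UNIV - {0}) = (nsum (\<lambda>k. g k))"
proof -
  have "infsum f (UNIV - {0}) = (\<integral>\<^sup>+k. g k \<partial>count_space (UNIV - {0}))"
    by (subst infsum_ennreal_conv_nn_integral) (auto intro!: nn_integral_cong assms(1))
  also have "\<dots> = (nsum (\<lambda>k. g k))"
    by (rule nn_integral_count_space_eq) (auto simp: assms(2))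
  finally show ?thesis .
qed

lemma ennreal_divide_norm: "0 \<le> x \<Longrightarrow> ennreal (x / norm (ivec k)) = ennreal (1 / norm (ivec k)) * ennreal x"
  by (subst ennreal_mult[symmetric]) auto

lemma norm_calXm1_eq: "norm_calXm1 v = xm1_norm (\<lambda>k t. ennreal (mag (coeffs_of v) k t))"
  unfolding norm_calXm1_def xm1_norm_def
proof (rule infsum_nonzero_modes)
  show "esssup halfline (\<lambda>t. ennreal (1 / norm (ivec 0)) * ennreal (mag (coeffs_of v) 0 t)) = 0"
    using esssup_le_bound[of "\<lambda>t. 0" halfline "0::ennreal"] by simp
  have "ennreal (norm (\<chi> i. time_coeff (v $ i) k t) / norm (ivec k)) = ennreal (1 / norm (ivec k)) * ennreal (mag (coeffs_of v) k t)" for k t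
    unfolding mag_def coeffs_of_def by (rule ennreal_divide_norm) simp
  then show "esssup (restrict_space lborel {0..}) (\<lambda>t. ennreal (norm (\<chi> i. time_coeff (v $ i) k t) / norm (ivec k))) =
    esssup halfline (\<lambda>t. ennreal (1 / norm (ivec k)) * ennreal (mag (coeffs_of v) k t))" for k
    unfolding halfline_def by presburger
qed

lemma norm_calX1_eq: "norm_calX1 v = x1_norm (\<lambda>k t. ennreal (mag (coeffs_of v) k t))"
  unfolding norm_calX1_def x1_norm_def nn_integral_halfline[symmetric]
  by (rule infsum_nonzero_modes) (simp_all add: mag_def coeffs_of_def ennreal_mult)

lemma norm_Y_eq: "norm_Y v = coeffs_norm (coeffs_of v)"
  by (simp add: norm_Y_def coeffs_norm_def y_norm_def norm_calXm1_eq norm_calX1_eq)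

lemma norm_Xm1_eq: "norm_Xm1 u = initial_norm (\<lambda>k. ennreal (cmag (initial_coeffs u) k))"
  unfolding norm_Xm1_def initial_norm_def
proof (rule infsum_nonzero_modes)
  show "ennreal (norm (\<chi> i. fourier_coeff (u $ i) k) / norm (ivec k)) = ennreal (1 / norm (ivec k)) * ennreal (cmag (initial_coeffs u) k)" for k
    unfolding cmag_def initial_coeffs_def by (rule ennreal_divide_norm) simp
qed simp

lemma calY_coeffs_ok:
  assumes v: "v \<in> calY" shows "coeffs_ok (coeffs_of v)"
proof -
  have "AE t in halfline. \<forall>i. coeffs_of v i 0 t = 0"
    using calY_mean_zero[OF v] by (subst AE_all_countable) (simp add: coeffs_of_def)
  moreover have "coeffs_norm (coeffs_of v) < \<infinity>"
    using v by (auto simp: norm_Y_eq[symmetric] norm_Y_def calY_def calXm1_def calX1_def)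
  ultimately show ?thesis using calY_measurable[OF v] by (simp add: coeffs_ok_def coeffs_of_def)
qed

lemma fourier_distr_eq: "fourier_distr c \<phi> = (\<Sum>\<^sub>\<infinity>k. c k * pairing k \<phi>)"
  by (simp add: fourier_distr_def pairing_def)

lemma fourier_distr_cmult: "fourier_distr c (\<lambda>x. d * \<phi> x) = d * fourier_distr c \<phi>"
  by (simp add: fourier_distr_eq pairing_cmult mult.left_commute[of _ d] infsum_cmult_right')

lemma fourier_distr_wave: "fourier_distr c (wave (- k)) = complex_of_real ((2 * pi) ^ 3) * c k"
  unfolding fourier_distr_eq
  by (subst infsum_single[where a=k]) (auto simp: pairing_wave)

lemma fourier_coeff_fourier_distr [simp]: "fourier_coeff (fourier_distr c) k = c k"
  by (simp add: fourier_coeff_def fourier_distr_wave)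

lemma fourier_coeff_at_time: "fourier_coeff (at_time v t $ i) k = coeffs_of v i k t"
  by (simp add: at_time_def coeffs_of_def)

lemma frechet_derivative_wave:
  "frechet_derivative (\<lambda>x. c * wave k x) (at x) (axis j 1) = c * (\<i> * of_real (ivec k $ j)) * wave k x"
  using frechet_derivative_eqI[OF has_derivative_mult_right[OF has_derivative_wave]]
  by (simp add: inner_axis mult_ac)

text \<open>On multiples of one wave a derivative of a distribution acts as multiplication by \<open>i k\<^sub>j\<close>. The
hypothesis, homogeneity on these multiples, is reproduced by the conclusion, so that compositions of
operators can be evaluated step by step.\<close>

lemma distr_deriv_wave:
  assumes "\<And>c. u (\<lambda>x. c * wave (- k) x) = c * z"
  shows "distr_deriv j u (\<lambda>x. c * wave (- k) x) = c * (\<i> * of_real (ivec k $ j) * z)"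
  unfolding distr_deriv_def frechet_derivative_wave assms by simp

lemma sum_functional_apply: "(\<Sum>i\<in>I. u i) \<phi> = (\<Sum>i\<in>I. u i \<phi> :: complex)"
  by (induction I rule: infinite_finite_induct) auto

text \<open>The exchange needs only summability of the coefficients and boundedness of \<open>g\<close>; the factor \<open>g\<close> can
therefore be a second Fourier series.\<close>

lemma integral_fourier_series_mult:
  assumes c: "nsum (\<lambda>l. ennreal (norm (c l))) < \<infinity>"
    and [measurable]: "g \<in> borel_measurable borel" and B: "\<And>x. norm (g x) \<le> B"
  shows "(LINT x:cube|lborel. (\<Sum>\<^sub>\<infinity>l. c l * wave l x) * g x) = (\<Sum>\<^sub>\<infinity>l. c l * (LINT x:cube|lborel. wave l x * g x))"
proof -
  define f where "f l x = indicator cube x *\<^sub>R (c l * wave l x * g x)" for l x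
  have [measurable]: "f l \<in> borel_measurable lborel" for l unfolding f_def by measurable
  have "nsum (\<lambda>l. \<integral>\<^sup>+x. ennreal (norm (f l x)) \<partial>lborel) \<le> nsum (\<lambda>l. \<integral>\<^sup>+x. ennreal (norm (c l) * B) * indicator cube x \<partial>lborel)"
    using B by (intro nn_integral_mono) (auto simp: f_def norm_mult indicator_def intro!: ennreal_leI mult_left_mono)
  also have "\<dots> = nsum (\<lambda>l. ennreal (norm (c l)) * (ennreal B * emeasure lborel cube))"
    by (subst nn_integral_cmult_indicator) (auto simp: ennreal_mult' mult.assoc)
  also have "\<dots> = nsum (\<lambda>l. ennreal (norm (c l))) * (ennreal B * emeasure lborel cube)"
    by (rule nn_integral_multc) simp
  also have "\<dots> < \<infinity>" using c emeasure_cube_finite by (simp add: ennreal_mult_less_top)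
  finally have fin: "nsum (\<lambda>l. \<integral>\<^sup>+x. ennreal (norm (f l x)) \<partial>lborel) < \<infinity>" .
  have "(\<Sum>\<^sub>\<infinity>l. f l x) = indicator cube x *\<^sub>R ((\<Sum>\<^sub>\<infinity>l. c l * wave l x) * g x)" for x
    by (simp add: f_def indicator_def infsum_cmult_left')
  then have "(LINT x:cube|lborel. (\<Sum>\<^sub>\<infinity>l. c l * wave l x) * g x) = (\<integral>x. (\<Sum>\<^sub>\<infinity>l. f l x) \<partial>lborel)"
    by (simp add: set_lebesgue_integral_def)
  also have "\<dots> = (\<Sum>\<^sub>\<infinity>l. \<integral>x. f l x \<partial>lborel)"
    by (rule integral_infsum[OF sigma_finite_lborel _ fin]) measurable
  also have "(\<lambda>l. \<integral>x. f l x \<partial>lborel) = (\<lambda>l. c l * (LINT x:cube|lborel. wave l x * g x))"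
  proof
    fix l
    have "(\<integral>x. f l x \<partial>lborel) = (LINT x:cube|lborel. c l * (wave l x * g x))"
      unfolding f_def set_lebesgue_integral_def mult.assoc ..
    also have "\<dots> = c l * (LINT x:cube|lborel. wave l x * g x)" by (rule set_integral_mult_right)
    finally show "(\<integral>x. f l x \<partial>lborel) = c l * (LINT x:cube|lborel. wave l x * g x)" .
  qed
  finally show ?thesis .
qed

lemma distr_mult_wave:
  assumes u: "nsum (\<lambda>l. ennreal (norm (fourier_coeff u l))) < \<infinity>" and w: "nsum (\<lambda>l. ennreal (norm (fourier_coeff w l))) < \<infinity>"
  shows "distr_mult u w (\<lambda>x. d * wave (- k) x) = d * (complex_of_real ((2 * pi) ^ 3) * conv (fourier_coeff u) (fourier_coeff w) k)"
proof -
  have [measurable]: "fourier_series w \<in> borel_measurable borel"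
    unfolding fourier_series_def[abs_def] by (rule borel_measurable_infsum) measurable
  have B: "norm (fourier_series w x) \<le> enn2real (nsum (\<lambda>l. ennreal (norm (fourier_coeff w l))))" for x
  proof -
    have "ennreal (norm (fourier_series w x)) \<le> nsum (\<lambda>l. ennreal (norm (fourier_coeff w l * wave l x)))"
      unfolding fourier_series_def by (rule norm_infsum_le)
    also have "\<dots> = ennreal (enn2real (nsum (\<lambda>l. ennreal (norm (fourier_coeff w l)))))"
      using w by (simp add: norm_mult)
    finally show ?thesis by (subst (asm) ennreal_le_iff) auto
  qed
  have "distr_mult u w (\<lambda>x. d * wave (- k) x) = (LINT x:cube|lborel. d * ((\<Sum>\<^sub>\<infinity>l. fourier_coeff u l * wave l x) * (fourier_series w x * wave (- k) x)))"
    by (simp add: distr_mult_def fourier_series_def[of u] mult_ac)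
  also have "\<dots> = d * (LINT x:cube|lborel. (\<Sum>\<^sub>\<infinity>l. fourier_coeff u l * wave l x) * (fourier_series w x * wave (- k) x))"
    by (rule set_integral_mult_right)
  also have "(LINT x:cube|lborel. (\<Sum>\<^sub>\<infinity>l. fourier_coeff u l * wave l x) * (fourier_series w x * wave (- k) x)) =
     (\<Sum>\<^sub>\<infinity>l. fourier_coeff u l * (LINT x:cube|lborel. wave l x * (fourier_series w x * wave (- k) x)))"
    by (rule integral_fourier_series_mult[OF u]) (use B in \<open>auto simp: norm_mult\<close>)
  also have "(\<lambda>l. LINT x:cube|lborel. wave l x * (fourier_series w x * wave (- k) x)) = (\<lambda>l. (2 * pi) ^ 3 * fourier_coeff w (k - l))"
  proof
    fix l
    have "(LINT x:cube|lborel. wave l x * (fourier_series w x * wave (- k) x)) = (LINT x:cube|lborel. (\<Sum>\<^sub>\<infinity>m. fourier_coeff w m * wave m x) * wave (l - k) x)"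
      using wave_add_freq[of l "- k"] by (simp add: fourier_series_def mult_ac)
    also have "\<dots> = (\<Sum>\<^sub>\<infinity>m. fourier_coeff w m * (LINT x:cube|lborel. wave m x * wave (l - k) x))"
      by (rule integral_fourier_series_mult[OF w, where B=1]) auto
    also have "\<dots> = (2 * pi) ^ 3 * fourier_coeff w (k - l)"
    proof -
      have o: "(LINT x:cube|lborel. wave m x * wave (l - k) x) = (if m = k - l then of_real ((2 * pi) ^ 3) else 0)" for m
      proof -
        have e: "(\<lambda>x. wave m x * wave (l - k) x) = wave (m + (l - k))" by (simp add: wave_add_freq fun_eq_iff)
        show ?thesis unfolding e using integral_wave_cube[of "m + (l - k)"] eq_neg_iff_add_eq_0[of m "l - k"] by simp
      qed
      show ?thesis unfolding o by (subst infsum_single[where a="k - l"]) auto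
    qed
    finally show "(LINT x:cube|lborel. wave l x * (fourier_series w x * wave (- k) x)) = (2 * pi) ^ 3 * fourier_coeff w (k - l)" .
  qed
  also have "(\<Sum>\<^sub>\<infinity>l. fourier_coeff u l * ((2 * pi) ^ 3 * fourier_coeff w (k - l))) = (2 * pi) ^ 3 * conv (fourier_coeff u) (fourier_coeff w) k"
    unfolding conv_def infsum_cmult_right'[symmetric] by (intro infsum_cong) (simp add: mult_ac)
  finally show ?thesis .
qed

lemma fourier_coeff_leray_div:
  assumes w: "\<And>i. nsum (\<lambda>l. ennreal (norm (fourier_coeff (w $ i) l))) < \<infinity>"
  shows "fourier_coeff (leray (div_tensor_square w) $ i) k =
    proj_div k (\<lambda>i j. conv (fourier_coeff (w $ i)) (fourier_coeff (w $ j)) k) i"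
proof -
  define G where "G k = (\<lambda>i j. conv (fourier_coeff (w $ i)) (fourier_coeff (w $ j)) k)" for k
  define P :: complex where "P = of_real ((2 * pi) ^ 3)"
  have P: "P \<noteq> 0" by (simp add: P_def)
  define D where "D i = (\<Sum>j\<in>UNIV. distr_deriv j (distr_mult (w $ i) (w $ j)))" for i
  have D: "D i (\<lambda>x. c * wave (- k) x) = c * (P * div_row k (G k) i)" for i k c
    unfolding D_def sum_functional_apply distr_deriv_wave[OF distr_mult_wave[OF w w]]
    by (simp add: div_row_def G_def P_def sum_distrib_left mult_ac)
  define E where "E = (\<Sum>j\<in>UNIV. distr_deriv j (D j))"
  have E: "E (\<lambda>x. c * wave (- k) x) = c * (P * (\<Sum>j\<in>UNIV. \<i> * of_real (ivec k $ j) * div_row k (G k) j))" for k c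
    unfolding E_def sum_functional_apply distr_deriv_wave[OF D]
    by (simp add: sum_distrib_left mult_ac)
  have fE: "fourier_coeff E k = (\<Sum>j\<in>UNIV. \<i> * of_real (ivec k $ j) * div_row k (G k) j)" for k
    using E[of 1 k] P by (simp add: fourier_coeff_def P_def)
  have L: "inv_laplacian E (\<lambda>x. c * wave (- k) x) = c * (P * (of_real (if k = 0 then 0 else - 1 / (norm (ivec k))\<^sup>2) * fourier_coeff E k))" for k c
    unfolding inv_laplacian_def fourier_multiplier_def fourier_distr_cmult fourier_distr_wave P_def by simp
  have "leray (div_tensor_square w) $ i = D i - distr_deriv i (inv_laplacian E)"
    by (simp add: leray_def div_tensor_square_def D_def E_def)
  then have "(leray (div_tensor_square w) $ i) (\<lambda>x. 1 * wave (- k) x) = P * proj_div k (G k) i"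
    by (simp only: minus_apply D distr_deriv_wave[OF L] fE proj_div_def) (simp add: algebra_simps)
  then show ?thesis using P by (simp add: fourier_coeff_def P_def G_def)
qed

lemma heat_eq: "heat \<mu> \<tau> u \<phi> = (\<Sum>\<^sub>\<infinity>k. of_real (exp (- \<mu> * \<tau> * (norm (ivec k))\<^sup>2)) * fourier_coeff u k * pairing k \<phi>)"
  by (simp add: heat_def fourier_multiplier_def fourier_distr_eq)

text \<open>For almost every time the components have absolutely convergent Fourier series, so the product in
\<open>distr_mult\<close> is the product of continuous functions.\<close>

lemma nonlin_at_time:
  assumes v: "v \<in> calY"
  shows "AE s in halfline. \<forall>i k. fourier_coeff (leray (div_tensor_square (at_time v s)) $ i) k = nonlin (coeffs_of v) k s i"
  using coeffs_ok_summable[OF calY_coeffs_ok[OF v]]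
proof eventually_elim
  case (elim s)
  have "nsum (\<lambda>l. ennreal (norm (fourier_coeff (at_time v s $ i) l))) < \<infinity>" for i
    unfolding fourier_coeff_at_time
    by (rule le_less_trans[OF _ elim]) (intro nn_integral_mono ennreal_leI norm_component_le_mag)
  from fourier_coeff_leray_div[OF this] show ?case
    by (simp add: nonlin_def fourier_coeff_at_time[abs_def])
qed

text \<open>At exceptional times the integrand on the left is an unknown value of total functions. It agrees with a Borel
function almost everywhere, so that it is measurable with respect to the completion and
both integrals coincide.\<close>

lemma duhamel_integral:
  assumes v: "v \<in> calY" and t: "0 < t"
  shows "(LINT s:{0..t}|lebesgue. heat \<mu> (t - s) (leray (div_tensor_square (at_time v s)) $ i) \<phi>) =
    (\<integral>s. (\<Sum>\<^sub>\<infinity>k. of_real (heat_kernel \<mu> k t s) * nonlin (coeffs_of v) k s i * pairing k \<phi>) \<partial>halfline)"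
proof -
  define f where "f s = indicator {0..t} s *\<^sub>R heat \<mu> (t - s) (leray (div_tensor_square (at_time v s)) $ i) \<phi>" for s
  define g where "g s = indicator {0..} s *\<^sub>R (\<Sum>\<^sub>\<infinity>k. of_real (heat_kernel \<mu> k t s) * nonlin (coeffs_of v) k s i * pairing k \<phi>)" for s
  have [measurable]: "coeffs_of v i k \<in> borel_measurable borel" for i k
    using calY_coeffs_ok[OF v] by (simp add: coeffs_ok_def)
  have [measurable]: "(\<lambda>s. nonlin (coeffs_of v) k s i) \<in> borel_measurable borel" for k i by (rule nonlin_measurable) measurable
  have [measurable]: "(\<lambda>s. \<Sum>\<^sub>\<infinity>k. of_real (heat_kernel \<mu> k t s) * nonlin (coeffs_of v) k s i * pairing k \<phi>) \<in> borel_measurable borel"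
    by (rule borel_measurable_infsum) measurable
  have g: "g \<in> borel_measurable lborel" unfolding g_def[abs_def] by measurable
  have "AE s in lborel. 0 \<le> s \<longrightarrow> (\<forall>i k. fourier_coeff (leray (div_tensor_square (at_time v s)) $ i) k = nonlin (coeffs_of v) k s i)"
    using nonlin_at_time[OF v] by (simp add: AE_halfline)
  then have AE: "AE s in lborel. g s = f s"
  proof eventually_elim
    case (elim s)
    show ?case
    proof (cases "0 \<le> s")
      case True
      then have N: "fourier_coeff (leray (div_tensor_square (at_time v s)) $ i) k = nonlin (coeffs_of v) k s i" for k using elim by blast
      show ?thesis using True by (simp add: f_def g_def heat_eq N heat_kernel_def indicator_def)
    qed (simp add: f_def g_def)
  qed
  then have AE': "AE s in lebesgue. g s = f s" by (rule AE_completion)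
  have gl: "g \<in> borel_measurable lebesgue" using g by (rule measurable_completion)
  have "f \<in> borel_measurable lebesgue" by (rule borel_measurable_AE[OF gl AE'])
  then have "(\<integral>s. f s \<partial>lebesgue) = (\<integral>s. g s \<partial>lebesgue)"
    using AE' gl by (intro integral_cong_AE) auto
  also have "\<dots> = (\<integral>s. g s \<partial>lborel)" by (rule integral_completion[OF g])
  finally show ?thesis
    by (simp add: f_def g_def set_lebesgue_integral_def integral_halfline)
qed

text \<open>Test with \<open>wave (- k)\<close>: by orthogonality only the \<open>k\<close>-th mode survives in every term.\<close>

lemma mild_imp_solves:
  assumes \<mu>: "0 < \<mu>" and mild: "mild_solution \<mu> v0 v"
  shows "\<forall>i k. AE t in halfline. coeffs_of v i k t = Phi \<mu> (initial_coeffs v0) (coeffs_of v) i k t"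
proof (intro allI)
  fix i k
  have v: "v \<in> calY" using mild by (simp add: mild_solution_def)
  define P :: complex where "P = of_real ((2 * pi) ^ 3)"
  have P: "P \<noteq> 0" by (simp add: P_def)
  have "AE t in lborel. 0 < t \<longrightarrow> (\<forall>i. \<forall>\<phi>\<in>test_torus.
        (at_time v t $ i) \<phi> = heat \<mu> t (v0 $ i) \<phi> -
          (LINT s:{0..t}|lebesgue. heat \<mu> (t - s) (leray (div_tensor_square (at_time v s)) $ i) \<phi>))"
    using mild by (simp add: mild_solution_def AE_completion_iff)
  then have "AE t in lborel. 0 < t \<longrightarrow> coeffs_of v i k t = Phi \<mu> (initial_coeffs v0) (coeffs_of v) i k t"
  proof (eventually_elim, intro impI)
    fix t :: real
    assume *: "0 < t \<longrightarrow> (\<forall>i. \<forall>\<phi>\<in>test_torus.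
        (at_time v t $ i) \<phi> = heat \<mu> t (v0 $ i) \<phi> -
          (LINT s:{0..t}|lebesgue. heat \<mu> (t - s) (leray (div_tensor_square (at_time v s)) $ i) \<phi>))" and t: "0 < t"
    have eq: "(at_time v t $ i) (wave (- k)) = heat \<mu> t (v0 $ i) (wave (- k)) -
        (\<integral>s. (\<Sum>\<^sub>\<infinity>l. of_real (heat_kernel \<mu> l t s) * nonlin (coeffs_of v) l s i * pairing l (wave (- k))) \<partial>halfline)"
      using * t unfolding duhamel_integral[OF v t] by simp
    have single: "(\<Sum>\<^sub>\<infinity>l. h l * pairing l (wave (- k))) = P * h k" for h :: "int^3 \<Rightarrow> complex"
      using fourier_distr_wave[of h k] by (simp add: fourier_distr_eq P_def)
    have 1: "(at_time v t $ i) (wave (- k)) = P * coeffs_of v i k t"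
      by (simp add: at_time_def fourier_distr_wave coeffs_of_def P_def)
    have 2: "heat \<mu> t (v0 $ i) (wave (- k)) = P * (of_real (heat_kernel \<mu> k t 0) * initial_coeffs v0 i k)"
      unfolding heat_eq single using t by (simp add: heat_kernel_def initial_coeffs_def)
    have "P * coeffs_of v i k t = P * Phi \<mu> (initial_coeffs v0) (coeffs_of v) i k t"
      using eq unfolding 1 2 single by (simp add: Phi_def right_diff_distrib)
    then show "coeffs_of v i k t = Phi \<mu> (initial_coeffs v0) (coeffs_of v) i k t" using P by simp
  qed
  then show "AE t in halfline. coeffs_of v i k t = Phi \<mu> (initial_coeffs v0) (coeffs_of v) i k t"
    by (simp add: AE_halfline')
qed

lemma bounded_summable:
  fixes f g :: "int^3 \<Rightarrow> complex"
  assumes f: "nsum (\<lambda>k. ennreal (norm (f k))) < \<infinity>" and B: "\<And>k. norm (g k) \<le> B"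
  shows "(\<lambda>k. f k * g k) summable_on UNIV"
proof -
  have "nsum (\<lambda>k. ennreal (norm (f k * g k))) \<le> nsum (\<lambda>k. ennreal (norm (f k)) * ennreal B)"
    using B by (intro nn_integral_mono) (auto simp: norm_mult simp flip: ennreal_mult' intro!: ennreal_leI mult_left_mono)
  also have "\<dots> = nsum (\<lambda>k. ennreal (norm (f k))) * ennreal B" by (rule nn_integral_multc) simp
  also have "\<dots> < \<infinity>" using f by (simp add: ennreal_mult_less_top)
  finally show ?thesis by (simp add: summable_iff_nn_integral)
qed

text \<open>For almost every time the heat and Duhamel terms are absolutely summable over \<open>k\<close>, because they have
finite norm in \<open>\<Y>\<close>. For such a time the pairings of the waves with a test function are bounded, which is
enough to exchange sum and integral.\<close>

lemma solves_imp_mild: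
  assumes \<mu>: "0 < \<mu>" and v: "v \<in> calY" and v0: "v0 \<in> Xm1"
    and sol: "\<forall>i k. AE t in halfline. coeffs_of v i k t = Phi \<mu> (initial_coeffs v0) (coeffs_of v) i k t"
  shows "mild_solution \<mu> v0 v"
proof -
  have ok: "coeffs_ok (coeffs_of v)" by (rule calY_coeffs_ok[OF v])
  have [measurable]: "coeffs_of v i k \<in> borel_measurable borel" for i k
    using ok by (simp add: coeffs_ok_def)
  have Nm [measurable]: "(\<lambda>s. nonlin (coeffs_of v) k s i) \<in> borel_measurable borel" for k i by (rule nonlin_measurable) measurable
  have A: "AE t in halfline. \<forall>i k. coeffs_of v i k t = Phi \<mu> (initial_coeffs v0) (coeffs_of v) i k t"
    using sol by (simp add: AE_all_countable)
  have N0: "nonlin (coeffs_of v) 0 s i = 0" for s i by (simp add: nonlin_def proj_div_def div_row_def)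
  have "AE t in halfline. nsum (\<lambda>k. \<integral>\<^sup>+s. ennreal (heat_kernel \<mu> k t s) * ennreal (norm (nonlin (coeffs_of v) k s i)) \<partial>halfline) < \<infinity>" for i
  proof (rule y_norm_AE_finite)
    let ?h = "\<lambda>k s. ennreal (1 / norm (ivec k)) * ennreal (norm (nonlin (coeffs_of v) k s i))"
    have "ennreal (norm (ivec k)) * ?h k s = ennreal (norm (nonlin (coeffs_of v) k s i))" for k s
    proof (cases "k = 0")
      case False
      then have "ennreal (norm (ivec k)) * ennreal (1 / norm (ivec k)) = 1"
        by (subst ennreal_mult[symmetric]) auto
      then show ?thesis by (simp flip: mult.assoc)
    qed (simp add: N0)
    then have "y_norm (\<lambda>k t. \<integral>\<^sup>+s. ennreal (heat_kernel \<mu> k t s) * ennreal (norm (nonlin (coeffs_of v) k s i)) \<partial>halfline) \<le>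
       ennreal (1 + 1 / \<mu>) * nsum (\<lambda>k. \<integral>\<^sup>+s. ?h k s \<partial>halfline)"
      using duhamel_estimate[OF \<mu>, of ?h] by simp
    also have "\<dots> < \<infinity>" using nonlin_integrable(2)[OF ok, of i] by (simp add: ennreal_mult_less_top)
    finally show "y_norm (\<lambda>k t. \<integral>\<^sup>+s. ennreal (heat_kernel \<mu> k t s) * ennreal (norm (nonlin (coeffs_of v) k s i)) \<partial>halfline) < \<infinity>" .
    show "(\<lambda>t. \<integral>\<^sup>+s. ennreal (heat_kernel \<mu> k t s) * ennreal (norm (nonlin (coeffs_of v) k s i)) \<partial>halfline) \<in> borel_measurable halfline" for k
      by (rule sigma_finite_measure.borel_measurable_nn_integral[OF sigma_finite_halfline]) measurable
  qed (simp add: N0)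
  then have B: "AE t in halfline. \<forall>i. nsum (\<lambda>k. \<integral>\<^sup>+s. ennreal (heat_kernel \<mu> k t s) * ennreal (norm (nonlin (coeffs_of v) k s i)) \<partial>halfline) < \<infinity>"
    by (subst AE_all_countable) blast
  have i0: "initial_coeffs v0 i 0 = 0" for i using v0 by (simp add: Xm1_def initial_coeffs_def)
  have C: "AE t in halfline. nsum (\<lambda>k. ennreal (heat_kernel \<mu> k t 0) * ennreal (cmag (initial_coeffs v0) k)) < \<infinity>"
  proof (rule y_norm_AE_finite)
    have "cmag (initial_coeffs v0) 0 = 0" using mag_eq_0[of "\<lambda>i k t. initial_coeffs v0 i k" 0 0] i0 by (simp add: mag_def cmag_def)
    then show "AE t in halfline. ennreal (heat_kernel \<mu> 0 t 0) * ennreal (cmag (initial_coeffs v0) 0) = 0" by simp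
    show "y_norm (\<lambda>k t. ennreal (heat_kernel \<mu> k t 0) * ennreal (cmag (initial_coeffs v0) k)) < \<infinity>"
      by (rule le_less_trans[OF heat_estimate[OF \<mu>]])
        (use v0 in \<open>simp add: norm_Xm1_eq[symmetric] Xm1_def ennreal_mult_less_top\<close>)
  qed measurable
  have "AE t in lborel. 0 < t \<longrightarrow> (\<forall>i. \<forall>\<phi>\<in>test_torus.
        (at_time v t $ i) \<phi> = heat \<mu> t (v0 $ i) \<phi> -
          (LINT s:{0..t}|lebesgue. heat \<mu> (t - s) (leray (div_tensor_square (at_time v s)) $ i) \<phi>))"
    using A[unfolded AE_halfline'] B[unfolded AE_halfline'] C[unfolded AE_halfline']
  proof (eventually_elim, intro impI allI ballI)
    fix t :: real and i :: 3 and \<phi>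
    assume A: "0 < t \<longrightarrow> (\<forall>i k. coeffs_of v i k t = Phi \<mu> (initial_coeffs v0) (coeffs_of v) i k t)"
      and B: "0 < t \<longrightarrow> (\<forall>i. nsum (\<lambda>k. \<integral>\<^sup>+s. ennreal (heat_kernel \<mu> k t s) * ennreal (norm (nonlin (coeffs_of v) k s i)) \<partial>halfline) < \<infinity>)"
      and C: "0 < t \<longrightarrow> nsum (\<lambda>k. ennreal (heat_kernel \<mu> k t 0) * ennreal (cmag (initial_coeffs v0) k)) < \<infinity>"
      and t: "0 < t" and \<phi>: "\<phi> \<in> test_torus"
    have cont: "continuous_on cube \<phi>" using \<phi> by (auto simp: test_torus_def intro: smooth_continuous_on)
    then have "compact (\<phi> ` cube)" by (intro compact_continuous_image) auto
    then obtain M where M: "\<And>x. x \<in> cube \<Longrightarrow> norm (\<phi> x) \<le> M"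
      by (meson bounded_iff compact_imp_bounded image_eqI)
    have pb: "norm (pairing k \<phi>) \<le> (2 * pi) ^ 3 * M" for k by (rule norm_pairing_le[OF M cont])
    let ?F = "\<lambda>k s. of_real (heat_kernel \<mu> k t s) * nonlin (coeffs_of v) k s i * pairing k \<phi>"
    have mF: "?F k \<in> borel_measurable halfline" for k by measurable
    have "nsum (\<lambda>k. \<integral>\<^sup>+s. ennreal (norm (?F k s)) \<partial>halfline) \<le>
       nsum (\<lambda>k. \<integral>\<^sup>+s. (ennreal (heat_kernel \<mu> k t s) * ennreal (norm (nonlin (coeffs_of v) k s i))) * ennreal ((2 * pi) ^ 3 * M) \<partial>halfline)"
      using pb heat_kernel_nonneg[of \<mu>]
      by (intro nn_integral_mono) (auto simp: norm_mult simp flip: ennreal_mult' ennreal_mult intro!: ennreal_leI mult_left_mono)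
    also have "\<dots> = nsum (\<lambda>k. \<integral>\<^sup>+s. ennreal (heat_kernel \<mu> k t s) * ennreal (norm (nonlin (coeffs_of v) k s i)) \<partial>halfline) * ennreal ((2 * pi) ^ 3 * M)"
      by (simp add: nn_integral_multc)
    also have "\<dots> < \<infinity>" using B t by (simp add: ennreal_mult_less_top)
    finally have finF: "nsum (\<lambda>k. \<integral>\<^sup>+s. ennreal (norm (?F k s)) \<partial>halfline) < \<infinity>" .
    have "nsum (\<lambda>k. ennreal (norm (of_real (heat_kernel \<mu> k t 0) * initial_coeffs v0 i k))) \<le> nsum (\<lambda>k. ennreal (heat_kernel \<mu> k t 0) * ennreal (cmag (initial_coeffs v0) k))"
      using heat_kernel_nonneg[of \<mu> _ t 0] norm_component_le_mag[of "\<lambda>i k t. initial_coeffs v0 i k" i _ 0]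
      by (intro nn_integral_mono) (auto simp: norm_mult mag_def cmag_def simp flip: ennreal_mult intro!: ennreal_leI mult_left_mono)
    also have "\<dots> < \<infinity>" using C t by simp
    finally have sH: "(\<lambda>k. of_real (heat_kernel \<mu> k t 0) * initial_coeffs v0 i k * pairing k \<phi>) summable_on UNIV"
      by (rule bounded_summable[OF _ pb])
    have sF: "(\<lambda>k. \<integral>s. ?F k s \<partial>halfline) summable_on UNIV"
      by (rule summable_integrals[OF sigma_finite_halfline mF finF])
    have "(at_time v t $ i) \<phi> = (\<Sum>\<^sub>\<infinity>k. coeffs_of v i k t * pairing k \<phi>)"
      by (simp add: at_time_def fourier_distr_eq coeffs_of_def)
    also have "\<dots> = (\<Sum>\<^sub>\<infinity>k. of_real (heat_kernel \<mu> k t 0) * initial_coeffs v0 i k * pairing k \<phi> - (\<integral>s. ?F k s \<partial>halfline))"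
    proof (rule infsum_cong)
      fix k
      have "coeffs_of v i k t = Phi \<mu> (initial_coeffs v0) (coeffs_of v) i k t" using A t by blast
      then show "coeffs_of v i k t * pairing k \<phi> = of_real (heat_kernel \<mu> k t 0) * initial_coeffs v0 i k * pairing k \<phi> - (\<integral>s. ?F k s \<partial>halfline)"
        by (simp add: Phi_def left_diff_distrib)
    qed
    also have "\<dots> = (\<Sum>\<^sub>\<infinity>k. of_real (heat_kernel \<mu> k t 0) * initial_coeffs v0 i k * pairing k \<phi>) - (\<Sum>\<^sub>\<infinity>k. \<integral>s. ?F k s \<partial>halfline)"
      by (rule infsum_difference[OF sH sF])
    also have "(\<Sum>\<^sub>\<infinity>k. \<integral>s. ?F k s \<partial>halfline) = (\<integral>s. (\<Sum>\<^sub>\<infinity>k. ?F k s) \<partial>halfline)"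
      by (rule integral_infsum[OF sigma_finite_halfline mF finF, symmetric])
    also have "\<dots> = (LINT s:{0..t}|lebesgue. heat \<mu> (t - s) (leray (div_tensor_square (at_time v s)) $ i) \<phi>)"
      by (rule duhamel_integral[OF v t, symmetric])
    also have "(\<Sum>\<^sub>\<infinity>k. of_real (heat_kernel \<mu> k t 0) * initial_coeffs v0 i k * pairing k \<phi>) = heat \<mu> t (v0 $ i) \<phi>"
      using t by (simp add: heat_eq heat_kernel_def initial_coeffs_def)
    finally show "(at_time v t $ i) \<phi> = heat \<mu> t (v0 $ i) \<phi> -
          (LINT s:{0..t}|lebesgue. heat \<mu> (t - s) (leray (div_tensor_square (at_time v s)) $ i) \<phi>)" .
  qed
  then show ?thesis using v by (simp add: mild_solution_def AE_completion)
qed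

lemma Phi_cong_AE:
  assumes [measurable]: "\<And>i k. a i k \<in> borel_measurable borel" "\<And>i k. b i k \<in> borel_measurable borel"
    and eq: "\<And>i k. AE t in halfline. a i k t = b i k t"
  shows "Phi \<mu> c a i k t = Phi \<mu> c b i k t"
proof -
  have [measurable]: "(\<lambda>s. nonlin a k s i) \<in> borel_measurable borel" "(\<lambda>s. nonlin b k s i) \<in> borel_measurable borel"
    by (rule nonlin_measurable; measurable)+
  have "AE s in halfline. \<forall>i k. a i k s = b i k s" using eq by (simp add: AE_all_countable)
  then have "(\<integral>s. of_real (heat_kernel \<mu> k t s) * nonlin a k s i \<partial>halfline) = (\<integral>s. of_real (heat_kernel \<mu> k t s) * nonlin b k s i \<partial>halfline)"
    by (intro integral_cong_AE) (measurable, auto elim!: eventually_mono simp: nonlin_def)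
  then show ?thesis by (simp add: Phi_def)
qed

lemma realize_coeffs:
  assumes ok: "coeffs_ok a" and zero: "\<And>i t. a i 0 t = 0"
  obtains v where "v \<in> calY" "\<And>i k. AE t in halfline. coeffs_of v i k t = a i k t"
proof
  define v where "v = (\<chi> i. distr_of_coeffs (a i))"
  have meas [measurable]: "a i k \<in> borel_measurable borel" for i k using ok by (simp add: coeffs_ok_def)
  have fin: "nsum (\<lambda>k. \<integral>\<^sup>+t. ennreal (norm (a i k t)) \<partial>halfline) < \<infinity>" for i
  proof -
    have "nsum (\<lambda>k. \<integral>\<^sup>+t. ennreal (norm (a i k t)) \<partial>halfline) \<le> nsum (\<lambda>k. \<integral>\<^sup>+t. ennreal (mag a k t) \<partial>halfline)"
      by (intro nn_integral_mono ennreal_leI norm_component_le_mag)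
    also have "\<dots> \<le> y_norm (\<lambda>k t. ennreal (mag a k t))"
      by (rule nn_integral_le_y_norm) (measurable, simp add: mag_eq_0 zero)
    also have "\<dots> < \<infinity>" using ok by (simp add: coeffs_ok_def coeffs_norm_def)
    finally show ?thesis .
  qed
  have rep: "represents (a i k) (time_coeff_distr (v $ i) k)" for i k
    using distr_of_coeffs_represents[of "a i" k, OF meas fin] by (simp add: v_def)
  show AE: "AE t in halfline. coeffs_of v i k t = a i k t" for i k
    unfolding coeffs_of_def by (rule time_coeff_AE[OF rep])
  have dist: "v $ i \<in> distr_spacetime" for i using distr_of_coeffs_distr[of "a i", OF meas fin] by (simp add: v_def)
  have cm: "coeffs_of v i k \<in> borel_measurable borel" for i k
    using time_coeff_represents[OF rep[of i k]] by (simp add: represents_def coeffs_of_def)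
  have "coeffs_norm (coeffs_of v) = coeffs_norm a" by (rule coeffs_norm_cong_AE[OF cm meas AE])
  then have "norm_calXm1 v + norm_calX1 v < \<infinity>" using ok by (simp add: coeffs_ok_def norm_Y_eq[symmetric] norm_Y_def)
  then have n: "norm_calXm1 v < \<infinity>" "norm_calX1 v < \<infinity>" by auto
  have z: "time_coeff_distr (v $ i) 0 \<psi> = 0" if "\<psi> \<in> test_time" for i \<psi>
    using rep[of i 0] that by (simp add: represents_def zero set_lebesgue_integral_def)
  have "regular_coeffs v" unfolding regular_coeffs_def using rep by blast
  then show "v \<in> calY" using dist n z by (simp add: calY_def calXm1_def calX1_def)
qed

theorem theorem1:
  fixes \<mu> :: real
  assumes "\<mu> > 0"
  shows "\<exists>\<epsilon>0>0. \<exists>K>0.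
    (let sol = (\<lambda>v0 v. mild_solution \<mu> v0 v \<and> norm_Y v \<le> ennreal K * norm_Xm1 v0);
         B = {v0 \<in> Xm1. norm_Xm1 v0 < ennreal \<epsilon>0};
         S = (\<lambda>v0. THE v. sol v0 v)
     in (\<forall>v0\<in>B. \<exists>!v. sol v0 v) \<and>
        (\<forall>v0\<in>B. \<forall>e>0. \<exists>d>0. \<forall>w0\<in>B.
           norm_Xm1 (w0 - v0) < ennreal d \<longrightarrow> norm_Y (S w0 - S v0) < ennreal e))"
proof -
  define \<alpha> where "\<alpha> = 1 + 1 / \<mu>"
  \<comment> \<open>Chosen such that \<open>36 \<alpha>\<close>, the Lipschitz constant of \<open>Phi_diff\<close>, times the bound \<open>4 \<alpha> \<epsilon>\<close> on the
    sum of the norms of two solutions is \<open>1/2\<close>.\<close>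
  define \<epsilon> where "\<epsilon> = 1 / (288 * \<alpha>\<^sup>2)"
  have \<alpha>: "0 < \<alpha>" using assms by (simp add: \<alpha>_def add_pos_pos)
  have \<epsilon>: "0 < \<epsilon>" using \<alpha> by (simp add: \<epsilon>_def)
  interpret viscosity \<mu> "ennreal \<alpha>" by unfold_locales (use assms in \<open>simp_all add: \<alpha>_def\<close>)
  define sol where "sol = (\<lambda>v0 v. mild_solution \<mu> v0 v \<and> norm_Y v \<le> ennreal (2 * \<alpha>) * norm_Xm1 v0)"
  define B where "B = {v0 \<in> Xm1. norm_Xm1 v0 < ennreal \<epsilon>}"
  define S where "S = (\<lambda>v0. THE v. sol v0 v)"
  have two: "2 * (ennreal \<alpha> * x) = ennreal (2 * \<alpha>) * x" for x :: ennreal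
    using \<alpha> by (simp add: ennreal_mult mult.assoc)
  have small: "ennreal \<alpha> * 36 * (x + y) \<le> ennreal (1 / 2)"
    if "x \<le> ennreal (2 * \<alpha>) * norm_Xm1 v0" "y \<le> ennreal (2 * \<alpha>) * norm_Xm1 w0" "v0 \<in> B" "w0 \<in> B" for x y v0 w0
  proof -
    have "x + y \<le> ennreal (2 * \<alpha>) * norm_Xm1 v0 + ennreal (2 * \<alpha>) * norm_Xm1 w0"
      by (intro add_mono that)
    also have "\<dots> \<le> ennreal (2 * \<alpha>) * ennreal \<epsilon> + ennreal (2 * \<alpha>) * ennreal \<epsilon>"
      using that by (intro add_mono mult_left_mono) (auto simp: B_def)
    also have "\<dots> = ennreal (4 * \<alpha> * \<epsilon>)"
      using \<alpha> \<epsilon> by (simp flip: ennreal_mult ennreal_plus)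
    finally have "ennreal \<alpha> * 36 * (x + y) \<le> ennreal \<alpha> * 36 * ennreal (4 * \<alpha> * \<epsilon>)"
      by (intro mult_left_mono) auto
    also have "\<dots> = ennreal (\<alpha> * 36 * (4 * \<alpha> * \<epsilon>))"
    proof -
      have "ennreal (\<alpha> * 36 * (4 * \<alpha> * \<epsilon>)) = ennreal (\<alpha> * 36) * ennreal (4 * \<alpha> * \<epsilon>)"
        using \<alpha> \<epsilon> by (intro ennreal_mult) auto
      also have "ennreal (\<alpha> * 36) = ennreal \<alpha> * ennreal 36" using \<alpha> by (intro ennreal_mult) auto
      finally show ?thesis by simp
    qed
    also have "\<alpha> * 36 * (4 * \<alpha> * \<epsilon>) = 1 / 2"
      using \<alpha> by (simp add: \<epsilon>_def power2_eq_square)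
    finally show ?thesis .
  qed
  have solD: "solves (initial_coeffs v0) (coeffs_of v) \<and> v \<in> calY \<and> coeffs_norm (coeffs_of v) \<le> ennreal (2 * \<alpha>) * norm_Xm1 v0" if "sol v0 v" for v0 v
    using that mild_imp_solves[OF assms, of v0 v] calY_coeffs_ok[of v]
    by (auto simp: sol_def solves_def norm_Y_eq mild_solution_def)
  have ex: "\<exists>!v. sol v0 v" if v0: "v0 \<in> B" for v0
  proof (rule ex_ex1I)
    have X: "v0 \<in> Xm1" using v0 by (simp add: B_def)
    have "initial_coeffs v0 i 0 = 0" for i using X by (simp add: Xm1_def initial_coeffs_def)
    moreover have "initial_norm (\<lambda>k. ennreal (cmag (initial_coeffs v0) k)) < \<infinity>" using X by (simp add: Xm1_def norm_Xm1_eq)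
    moreover have "ennreal \<alpha> * 36 * (2 * (ennreal \<alpha> * initial_norm (\<lambda>k. ennreal (cmag (initial_coeffs v0) k))) +
       2 * (ennreal \<alpha> * initial_norm (\<lambda>k. ennreal (cmag (initial_coeffs v0) k)))) \<le> ennreal (1 / 2)"
      unfolding two norm_Xm1_eq[symmetric] by (rule small[OF order_refl order_refl v0 v0])
    ultimately obtain a where a: "solves (initial_coeffs v0) a" "\<And>i t. a i 0 t = 0"
      "coeffs_norm a \<le> 2 * (ennreal \<alpha> * initial_norm (\<lambda>k. ennreal (cmag (initial_coeffs v0) k)))"
      using existence[of "initial_coeffs v0"] by blast
    have ok: "coeffs_ok a" using a(1) by (simp add: solves_def)
    obtain v where v: "v \<in> calY" and eq: "\<And>i k. AE t in halfline. coeffs_of v i k t = a i k t"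
      using realize_coeffs[OF ok a(2)] by blast
    have okv: "coeffs_ok (coeffs_of v)" by (rule calY_coeffs_ok[OF v])
    have [measurable]: "a i k \<in> borel_measurable borel" "coeffs_of v i k \<in> borel_measurable borel" for i k
      using ok okv by (auto simp: coeffs_ok_def)
    have "coeffs_norm (coeffs_of v) = coeffs_norm a" by (rule coeffs_norm_cong_AE[OF _ _ eq]) measurable
    then have "norm_Y v \<le> ennreal (2 * \<alpha>) * norm_Xm1 v0" using a(3) by (simp only: norm_Y_eq norm_Xm1_eq two)
    moreover have "mild_solution \<mu> v0 v"
    proof (rule solves_imp_mild[OF assms v X], intro allI)
      fix i k
      have "AE t in halfline. a i k t = Phi \<mu> (initial_coeffs v0) a i k t" using a(1) by (simp add: solves_def)
      then show "AE t in halfline. coeffs_of v i k t = Phi \<mu> (initial_coeffs v0) (coeffs_of v) i k t"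
        using eq[of i k] by eventually_elim (simp add: Phi_cong_AE[OF _ _ eq])
    qed
    ultimately show "\<exists>v. sol v0 v" by (auto simp: sol_def)
  next
    fix v w assume v: "sol v0 v" and w: "sol v0 w"
    show "v = w"
    proof (rule calY_eqI)
      show "v \<in> calY" "w \<in> calY" using solD[OF v] solD[OF w] by auto
      show "AE t in halfline. time_coeff (v $ i) k t = time_coeff (w $ i) k t" for i k
        using uniqueness[of "initial_coeffs v0" "coeffs_of v" "coeffs_of w" i k] solD[OF v] solD[OF w] small[of _ v0 _ v0] v0 by (simp add: coeffs_of_def)
    qed
  qed
  have solS: "sol v0 (S v0)" if "v0 \<in> B" for v0
    unfolding S_def by (rule theI'[OF ex[OF that]])
  have lip: "norm_Y (S w0 - S v0) \<le> ennreal (2 * \<alpha>) * norm_Xm1 (w0 - v0)" if v0: "v0 \<in> B" and w0: "w0 \<in> B" for v0 w0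
  proof -
    note sv = solD[OF solS[OF v0]] and sw = solD[OF solS[OF w0]]
    have "norm_Y (S w0 - S v0) = coeffs_norm (coeffs_of (S w0) \<ominus> coeffs_of (S v0))"
      unfolding norm_Y_eq
    proof (rule coeffs_norm_cong_AE)
      show "coeffs_of (S w0 - S v0) i k \<in> borel_measurable borel" for i k
        using time_coeff_diff_measurable[of "S w0" "S v0"] sv sw by (simp add: coeffs_of_def)
      show "(\<lambda>t. coeffs_of (S w0) i k t - coeffs_of (S v0) i k t) \<in> borel_measurable borel" for i k
        using calY_measurable sv sw unfolding coeffs_of_def by (intro borel_measurable_diff) auto
      show "AE t in halfline. coeffs_of (S w0 - S v0) i k t = coeffs_of (S w0) i k t - coeffs_of (S v0) i k t" for i k
        using time_coeff_diff_AE[of "S w0" "S v0"] sv sw by (simp add: coeffs_of_def)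
    qed
    also have "\<dots> \<le> 2 * (ennreal \<alpha> * initial_norm (\<lambda>k. ennreal (cmag (\<lambda>i k. initial_coeffs w0 i k - initial_coeffs v0 i k) k)))"
      using sv sw by (intro stability small[OF _ _ w0 v0]) auto
    also have "(\<lambda>i k. initial_coeffs w0 i k - initial_coeffs v0 i k) = initial_coeffs (w0 - v0)"
      by (simp add: initial_coeffs_def fourier_coeff_def fun_eq_iff diff_divide_distrib)
    finally show ?thesis by (simp only: two norm_Xm1_eq)
  qed
  have cont: "\<exists>d>0. \<forall>w0\<in>B. norm_Xm1 (w0 - v0) < ennreal d \<longrightarrow> norm_Y (S w0 - S v0) < ennreal e"
    if v0: "v0 \<in> B" and e: "e > 0" for v0 e
  proof (intro exI[of _ "e / (2 * \<alpha>)"] conjI ballI impI)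
    show "0 < e / (2 * \<alpha>)" using e \<alpha> by simp
    fix w0 assume w0: "w0 \<in> B" and d: "norm_Xm1 (w0 - v0) < ennreal (e / (2 * \<alpha>))"
    have "norm_Y (S w0 - S v0) \<le> ennreal (2 * \<alpha>) * norm_Xm1 (w0 - v0)" by (rule lip[OF v0 w0])
    also have "\<dots> < ennreal (2 * \<alpha>) * ennreal (e / (2 * \<alpha>))"
      using \<alpha> d by (intro ennreal_mult_strict_left_mono) auto
    also have "\<dots> = ennreal (2 * \<alpha> * (e / (2 * \<alpha>)))" using \<alpha> e by (intro ennreal_mult[symmetric]) auto
    also have "2 * \<alpha> * (e / (2 * \<alpha>)) = e" using \<alpha> by simp
    finally show "norm_Y (S w0 - S v0) < ennreal e" .
  qed
  have "(\<forall>v0\<in>B. \<exists>!v. sol v0 v) \<and> (\<forall>v0\<in>B. \<forall>e>0. \<exists>d>0. \<forall>w0\<in>B.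
     norm_Xm1 (w0 - v0) < ennreal d \<longrightarrow> norm_Y (S w0 - S v0) < ennreal e)"
    using ex cont by blast
  note main = this[unfolded S_def B_def sol_def]
  have "0 < 2 * \<alpha>" using \<alpha> by simp
  then show ?thesis
    unfolding Let_def using \<epsilon> main by blast
qed

end
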